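(* Let $\Sigma$ be a finite alphabet, $w$ a positive integer, and $\tau=(R_1,\dots,R_m)$ a relational vocabulary. Given a monadic second-order sentence $\psi$ over the vocabulary of strings over the alphabet $\mathcal{B}(\Sigma,w,\tau)$ and a first-order sentence $\varphi$ over $\tau$, one can decide whether there exists a string $D_0\otimes D_1\otimes\cdots\otimes D_m\in\mathcal{B}(\Sigma,w,\tau)^{\circledast}$ such that $D_0\otimes\cdots\otimes D_m\models\psi$ and $\mathcal{S}(D_0,\dots,D_m)\models\varphi$.
   Context: Padding and tensor products. Fix a padding symbol $\#$ not in any alphabet considered. For alphabets $\Gamma_1,\dots,\Gamma_a$, $\Gamma_1\otimes\cdots\otimes\Gamma_a$ is the Cartesian product regarded as an alphabet, and $\Gamma^{\otimes a}$ its $a$-fold power. For nonempty strings $u_i$ over $\Gamma_i$ of lengths $n_i$, $u_1\otimes\cdots\otimes u_a$ is the string of length $\max_i n_i$ whose $j$-th symbol is the tuple of $j$-th symbols of the $u_i$, with $\#$ in place of missing symbols. For languages, $L_1\otimes\cdots\otimes L_a=\{u_1\otimes\cdots\otimes u_a:u_i\in L_i\}$ and $L^{\otimes a}$ is the $a$-fold product. For a language $L$ over a tensor alphabet, $\mathcal{R}(L)=\{(u_1,\dots,u_a):u_1\otimes\cdots\otimes u_a\in L\}$. ODDs. For an alphabet $\Sigma$ and $w\ge1$, a $(\Sigma,w)$-layer is a tuple $B=(\ell,r,T,I,F,\iota,\phi)$ with $\ell,r\subseteq\{0,\dots,w-1\}$, $T\subseteq\ell\times(\Sigma\sqcup\{\#\})\times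 r$, $I\subseteq\ell$, $F\subseteq r$, $\iota,\phi$ Booleans, $I=\emptyset$ if $\iota$ is false and $F=\emptyset$ if $\phi$ is false. $\mathcal{B}(\Sigma,w)$ is the finite set of such layers, an alphabet. A $(\Sigma,w)$-ODD of length $k$ is a string $B_1\cdots B_k$ over $\mathcal{B}(\Sigma,w)$ with $\ell(B_{i+1})=r(B_i)$, $\iota(B_i)$ true iff $i=1$, $\phi(B_i)$ true iff $i=k$; $\mathcal{B}(\Sigma,w,k)$ is the set of them. A nonempty string $\sigma_1\cdots\sigma_{k'}$ over $\Sigma$, $k'\le k$, is accepted if, padding it with $\#$ to length $k$ (symbols $\hat\sigma_i$), there are $(p_i,\hat\sigma_i,q_i)\in T(B_i)$ with $p_{i+1}=q_i$, $p_1\in I(B_1)$, $q_k\in F(B_k)$; $L(D)$ is the set of accepted strings. Structural tuples. $\tau=(R_1,\dots,R_m)$ has arities $a_i$. A tuple $(D_0,\dots,D_m)$ is $(\Sigma,w,\tau)$-structural if for some $k\ge1$, $D_0\in\mathcal{B}(\Sigma,w,k)$, $D_i\in\mathcal{B}(\Sigma^{\otimes a_i},w,k)$ and $L(D_i)\subseteq L(D_0)^{\otimes a_i}$ for $i\in[m]$; its derived structure $\mathcal{S}(D_0,\dots,D_m)$ is the $\tau$-structure with domain $L(D_0)$ interpreting $R_i$ as $\mathcal{R}(L(D_i))$. Let $\mathcal{B}(\Sigma,w,\tau)=\mathcal{B}(\Sigma,w)\otimes\mathcal{B}(\Sigma^{\otimes a_1},w)\otimes\cdots\otimes\mathcal{B}(\Sigma^{\otimes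 a_m},w)$, and let $\mathcal{B}(\Sigma,w,\tau)^{\circledast}$ be the set of strings $D_0\otimes\cdots\otimes D_m$ over $\mathcal{B}(\Sigma,w,\tau)$ such that $(D_0,\dots,D_m)$ is $(\Sigma,w,\tau)$-structural. Strings over an alphabet $\Gamma$ are viewed as logical structures over the standard vocabulary of $\Gamma$-strings (positions, their linear order, and a unary predicate for each letter of $\Gamma$), which is the setting for monadic second-order sentences over strings. *)

theory Defs
  imports Main "HOL-Library.Nat_Bijection"
begin

section \<open>Computability\<close>

text \<open>Partial recursive functions. Recursion and minimisation act on the first argument.\<close>

datatype recf =
    Zero
  | Succ
  | Proj nat
  | Comp recf "recf list"
  | Prec recf recf
  | Mu recf

inductive rec_eval :: "recf \<Rightarrow> nat list \<Rightarrow> nat \<Rightarrow> bool" where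
  Zero: "rec_eval Zero xs 0"
| Succ: "rec_eval Succ [x] (Suc x)"
| Proj: "i < length xs \<Longrightarrow> rec_eval (Proj i) xs (xs ! i)"
| Comp: "list_all2 (\<lambda>g y. rec_eval g xs y) gs ys \<Longrightarrow> rec_eval f ys z \<Longrightarrow>
         rec_eval (Comp f gs) xs z"
| Prec_0: "rec_eval f xs y \<Longrightarrow> rec_eval (Prec f g) (0 # xs) y"
| Prec_Suc: "rec_eval (Prec f g) (n # xs) r \<Longrightarrow> rec_eval g (n # r # xs) y \<Longrightarrow>
         rec_eval (Prec f g) (Suc n # xs) y"
| Mu: "rec_eval f (n # xs) 0 \<Longrightarrow> \<forall>i<n. \<exists>y. rec_eval f (i # xs) (Suc y) \<Longrightarrow>
         rec_eval (Mu f) xs n"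

inductive_cases rec_eval_ZeroE: "rec_eval Zero xs y"
inductive_cases rec_eval_SuccE: "rec_eval Succ xs y"
inductive_cases rec_eval_ProjE: "rec_eval (Proj i) xs y"
inductive_cases rec_eval_CompE: "rec_eval (Comp f gs) xs y"
inductive_cases rec_eval_Prec_0E: "rec_eval (Prec f g) (0 # xs) y"
inductive_cases rec_eval_Prec_SucE: "rec_eval (Prec f g) (Suc n # xs) y"
inductive_cases rec_eval_MuE: "rec_eval (Mu f) xs y"

lemma rec_eval_functional: "rec_eval f xs y \<Longrightarrow> rec_eval f xs z \<Longrightarrow> y = z"
proof (induction arbitrary: z rule: rec_eval.induct)
  case (Zero xs)
  then show ?case by (rule rec_eval_ZeroE) simp
next
  case (Succ x)
  then show ?case by (rule rec_eval_SuccE) simp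
next
  case (Proj i xs)
  from Proj.prems show ?case by (rule rec_eval_ProjE) simp
next
  case (Comp xs gs ys f y)
  from Comp.prems obtain ys' where ys': "list_all2 (\<lambda>g y. rec_eval g xs y) gs ys'" "rec_eval f ys' z"
    by (rule rec_eval_CompE)
  have "ys = ys'"
  proof (rule nth_equalityI)
    show "length ys = length ys'"
      using list_all2_lengthD[OF Comp.IH(1)] list_all2_lengthD[OF ys'(1)] by (rule trans[OF sym])
    show "ys ! i = ys' ! i" if "i < length ys" for i
    proof -
      from list_all2_lengthD[OF Comp.IH(1)] that have "i < length gs" by (simp only:)
      moreover from list_all2_nthD[OF Comp.IH(1) this]
      have "\<forall>z. rec_eval (gs ! i) xs z \<longrightarrow> ys ! i = z" by blast
      moreover from ys'(1) \<open>i < length gs\<close> have "rec_eval (gs ! i) xs (ys' ! i)"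
        by (rule list_all2_nthD)
      ultimately show ?thesis by blast
    qed
  qed
  with ys'(2) Comp.IH(2) show ?case by simp
next
  case (Prec_0 f xs y g)
  from Prec_0.prems have "rec_eval f xs z" by (rule rec_eval_Prec_0E)
  then show ?case by (rule Prec_0.IH)
next
  case (Prec_Suc f g n xs r y)
  from Prec_Suc.prems obtain r' where r': "rec_eval (Prec f g) (n # xs) r'" "rec_eval g (n # r' # xs) z"
    by (rule rec_eval_Prec_SucE)
  from r'(1) have "r = r'" by (rule Prec_Suc.IH(1))
  with r'(2) have "rec_eval g (n # r # xs) z" by (simp only:)
  then show ?case by (rule Prec_Suc.IH(2))
next
  case (Mu f n xs)
  from Mu.prems have z: "rec_eval f (z # xs) 0" "\<forall>i<z. \<exists>y. rec_eval f (i # xs) (Suc y)"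
    by (auto elim: rec_eval_MuE)
  have "\<not> n < z"
  proof
    assume "n < z"
    with z(2) obtain y where "rec_eval f (n # xs) (Suc y)" by blast
    from Mu.IH(1)[OF this] show False by simp
  qed
  moreover have "\<not> z < n"
  proof
    assume "z < n"
    with Mu.IH(2) obtain y where "\<forall>t. rec_eval f (z # xs) t \<longrightarrow> Suc y = t" by blast
    with z(1) show False by blast
  qed
  ultimately show ?case by simp
qed

text \<open>The decision problem with instances \<open>A\<close>, coded as numbers by \<open>code\<close>, and yes-instances
  those satisfying \<open>P\<close>.\<close>

definition decidable :: "'i set \<Rightarrow> ('i \<Rightarrow> nat) \<Rightarrow> ('i \<Rightarrow> bool) \<Rightarrow> bool" where
  "decidable A code P \<longleftrightarrow> (\<exists>f. \<forall>x\<in>A. rec_eval f [code x] (if P x then 1 else 0))"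


section \<open>First-order logic over a relational vocabulary\<close>

text \<open>A vocabulary is the list of the arities of its relation symbols; these are numbered from 0.\<close>

datatype fo =
    FRel nat "nat list"
  | FEq nat nat
  | FNeg fo
  | FConj fo fo
  | FEx nat fo

record 'u struct =
  universe :: "'u set"
  interp :: "nat \<Rightarrow> 'u list set"

primrec fo_sat :: "'u struct \<Rightarrow> (nat \<Rightarrow> 'u) \<Rightarrow> fo \<Rightarrow> bool" where
  "fo_sat S v (FRel i xs) \<longleftrightarrow> map v xs \<in> interp S i"
| "fo_sat S v (FEq x y) \<longleftrightarrow> v x = v y"
| "fo_sat S v (FNeg \<phi>) \<longleftrightarrow> \<not> fo_sat S v \<phi>"
| "fo_sat S v (FConj \<phi> \<chi>) \<longleftrightarrow> fo_sat S v \<phi> \<and> fo_sat S v \<chi>"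
| "fo_sat S v (FEx x \<phi>) \<longleftrightarrow> (\<exists>u\<in>universe S. fo_sat S (v(x := u)) \<phi>)"

primrec fo_free :: "fo \<Rightarrow> nat set" where
  "fo_free (FRel i xs) = set xs"
| "fo_free (FEq x y) = {x, y}"
| "fo_free (FNeg \<phi>) = fo_free \<phi>"
| "fo_free (FConj \<phi> \<chi>) = fo_free \<phi> \<union> fo_free \<chi>"
| "fo_free (FEx x \<phi>) = fo_free \<phi> - {x}"

primrec fo_over :: "nat list \<Rightarrow> fo \<Rightarrow> bool" where
  "fo_over \<tau> (FRel i xs) \<longleftrightarrow> i < length \<tau> \<and> length xs = \<tau> ! i"
| "fo_over \<tau> (FEq x y) \<longleftrightarrow> True"
| "fo_over \<tau> (FNeg \<phi>) \<longleftrightarrow> fo_over \<tau> \<phi>"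
| "fo_over \<tau> (FConj \<phi> \<chi>) \<longleftrightarrow> fo_over \<tau> \<phi> \<and> fo_over \<tau> \<chi>"
| "fo_over \<tau> (FEx x \<phi>) \<longleftrightarrow> fo_over \<tau> \<phi>"

definition fo_sentences :: "nat list \<Rightarrow> fo set" where
  "fo_sentences \<tau> = {\<phi>. fo_over \<tau> \<phi> \<and> fo_free \<phi> = {}}"

text \<open>The domain may be empty, so assignments range over the whole type; the truth value of a
  sentence does not depend on the assignment.\<close>

definition fo_models :: "'u struct \<Rightarrow> fo \<Rightarrow> bool" where
  "fo_models S \<phi> \<longleftrightarrow> (\<forall>v. fo_sat S v \<phi>)"

lemma fo_sat_cong: "\<forall>x\<in>fo_free \<phi>. v x = v' x \<Longrightarrow> fo_sat S v \<phi> = fo_sat S v' \<phi>"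
proof (induction \<phi> arbitrary: v v')
  case (FRel i xs)
  then have "map v xs = map v' xs" by simp
  then show ?case by (simp only: fo_sat.simps)
next
  case (FConj \<phi> \<chi>)
  from FConj.IH(1)[of v v'] FConj.IH(2)[of v v'] FConj.prems show ?case by simp
next
  case (FNeg \<phi>)
  from FNeg.IH[of v v'] FNeg.prems show ?case by simp
next
  case (FEx x \<phi>)
  have "fo_sat S (v(x := u)) \<phi> = fo_sat S (v'(x := u)) \<phi>" for u
    by (rule FEx.IH) (use FEx.prems in auto)
  then show ?case by simp
qed simp

primrec fo_code :: "fo \<Rightarrow> nat" where
  "fo_code (FRel i xs) = prod_encode (0, prod_encode (i, list_encode xs))"
| "fo_code (FEq x y) = prod_encode (1, prod_encode (x, y))"
| "fo_code (FNeg \<phi>) = prod_encode (2, fo_code \<phi>)"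
| "fo_code (FConj \<phi> \<chi>) = prod_encode (3, prod_encode (fo_code \<phi>, fo_code \<chi>))"
| "fo_code (FEx x \<phi>) = prod_encode (4, prod_encode (x, fo_code \<phi>))"

lemma fo_code_inject: "fo_code \<phi> = fo_code \<chi> \<Longrightarrow> \<phi> = \<chi>"
proof (induction \<phi> arbitrary: \<chi>)
  case (FRel i xs) then show ?case by (cases \<chi>) (auto simp: prod_encode_eq list_encode_eq)
next
  case (FEq x y) then show ?case by (cases \<chi>) (auto simp: prod_encode_eq)
next
  case (FNeg \<phi>) then show ?case by (cases \<chi>) (auto simp: prod_encode_eq)
next
  case (FConj \<phi>1 \<phi>2) then show ?case by (cases \<chi>) (auto simp: prod_encode_eq)
next
  case (FEx x \<phi>) then show ?case by (cases \<chi>) (auto simp: prod_encode_eq)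
qed


section \<open>Monadic second-order logic over strings\<close>

text \<open>First-order and set variables are numbered separately. \<open>MLetter b x\<close> says that position \<open>x\<close>
  carries the letter \<open>b\<close>, and \<open>MMem x X\<close> that \<open>x\<close> lies in the set \<open>X\<close>.\<close>

datatype 'b mso =
    MLess nat nat
  | MEq nat nat
  | MLetter 'b nat
  | MMem nat nat
  | MNeg "'b mso"
  | MConj "'b mso" "'b mso"
  | MEx1 nat "'b mso"
  | MEx2 nat "'b mso"

primrec mso_sat :: "'b list \<Rightarrow> (nat \<Rightarrow> nat) \<Rightarrow> (nat \<Rightarrow> nat set) \<Rightarrow> 'b mso \<Rightarrow> bool" where
  "mso_sat s v V (MLess x y) \<longleftrightarrow> v x < v y"
| "mso_sat s v V (MEq x y) \<longleftrightarrow> v x = v y"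
| "mso_sat s v V (MLetter b x) \<longleftrightarrow> v x < length s \<and> s ! v x = b"
| "mso_sat s v V (MMem x X) \<longleftrightarrow> v x \<in> V X"
| "mso_sat s v V (MNeg \<psi>) \<longleftrightarrow> \<not> mso_sat s v V \<psi>"
| "mso_sat s v V (MConj \<psi> \<chi>) \<longleftrightarrow> mso_sat s v V \<psi> \<and> mso_sat s v V \<chi>"
| "mso_sat s v V (MEx1 x \<psi>) \<longleftrightarrow> (\<exists>i<length s. mso_sat s (v(x := i)) V \<psi>)"
| "mso_sat s v V (MEx2 X \<psi>) \<longleftrightarrow> (\<exists>P\<subseteq>{..<length s}. mso_sat s v (V(X := P)) \<psi>)"

primrec mso_free1 :: "'b mso \<Rightarrow> nat set" where
  "mso_free1 (MLess x y) = {x, y}"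
| "mso_free1 (MEq x y) = {x, y}"
| "mso_free1 (MLetter b x) = {x}"
| "mso_free1 (MMem x X) = {x}"
| "mso_free1 (MNeg \<psi>) = mso_free1 \<psi>"
| "mso_free1 (MConj \<psi> \<chi>) = mso_free1 \<psi> \<union> mso_free1 \<chi>"
| "mso_free1 (MEx1 x \<psi>) = mso_free1 \<psi> - {x}"
| "mso_free1 (MEx2 X \<psi>) = mso_free1 \<psi>"

primrec mso_free2 :: "'b mso \<Rightarrow> nat set" where
  "mso_free2 (MLess x y) = {}"
| "mso_free2 (MEq x y) = {}"
| "mso_free2 (MLetter b x) = {}"
| "mso_free2 (MMem x X) = {X}"
| "mso_free2 (MNeg \<psi>) = mso_free2 \<psi>"
| "mso_free2 (MConj \<psi> \<chi>) = mso_free2 \<psi> \<union> mso_free2 \<chi>"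
| "mso_free2 (MEx1 x \<psi>) = mso_free2 \<psi>"
| "mso_free2 (MEx2 X \<psi>) = mso_free2 \<psi> - {X}"

text \<open>The automatically generated \<open>set_mso \<psi>\<close> is the set of letters occurring in \<open>\<psi>\<close>.\<close>

definition mso_sentences :: "'b set \<Rightarrow> 'b mso set" where
  "mso_sentences \<Gamma> = {\<psi>. set_mso \<psi> \<subseteq> \<Gamma> \<and> mso_free1 \<psi> = {} \<and> mso_free2 \<psi> = {}}"

definition mso_models :: "'b list \<Rightarrow> 'b mso \<Rightarrow> bool" where
  "mso_models s \<psi> \<longleftrightarrow> (\<forall>v V. mso_sat s v V \<psi>)"

lemma mso_sat_cong:
  "\<forall>x\<in>mso_free1 \<psi>. v x = v' x \<Longrightarrow> \<forall>X\<in>mso_free2 \<psi>. V X = V' X \<Longrightarrow>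
   mso_sat s v V \<psi> = mso_sat s v' V' \<psi>"
proof (induction \<psi> arbitrary: v v' V V')
  case (MNeg \<psi>)
  from MNeg.IH[of v v' V V'] MNeg.prems show ?case by simp
next
  case (MConj \<psi> \<chi>)
  from MConj.IH(1)[of v v' V V'] MConj.IH(2)[of v v' V V'] MConj.prems show ?case by simp
next
  case (MEx1 x \<psi>)
  have "mso_sat s (v(x := i)) V \<psi> = mso_sat s (v'(x := i)) V' \<psi>" for i
    by (rule MEx1.IH) (use MEx1.prems in auto)
  then show ?case by simp
next
  case (MEx2 X \<psi>)
  have "mso_sat s v (V(X := P)) \<psi> = mso_sat s v' (V'(X := P)) \<psi>" for P
    by (rule MEx2.IH) (use MEx2.prems in auto)
  then show ?case by simp
qed simp_all

primrec mso_code :: "('b \<Rightarrow> nat) \<Rightarrow> 'b mso \<Rightarrow> nat" where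
  "mso_code enc (MLess x y) = prod_encode (0, prod_encode (x, y))"
| "mso_code enc (MEq x y) = prod_encode (1, prod_encode (x, y))"
| "mso_code enc (MLetter b x) = prod_encode (2, prod_encode (enc b, x))"
| "mso_code enc (MMem x X) = prod_encode (3, prod_encode (x, X))"
| "mso_code enc (MNeg \<psi>) = prod_encode (4, mso_code enc \<psi>)"
| "mso_code enc (MConj \<psi> \<chi>) = prod_encode (5, prod_encode (mso_code enc \<psi>, mso_code enc \<chi>))"
| "mso_code enc (MEx1 x \<psi>) = prod_encode (6, prod_encode (x, mso_code enc \<psi>))"
| "mso_code enc (MEx2 X \<psi>) = prod_encode (7, prod_encode (X, mso_code enc \<psi>))"


lemma mso_code_inject:
  assumes "inj_on enc \<Gamma>"
  shows "set_mso \<psi> \<subseteq> \<Gamma> \<Longrightarrow> set_mso \<chi> \<subseteq> \<Gamma> \<Longrightarrow> mso_code enc \<psi> = mso_code enc \<chi> \<Longrightarrow> \<psi> = \<chi>"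
proof (induction \<psi> arbitrary: \<chi>)
  case (MLess x y) then show ?case by (cases \<chi>) (auto simp: prod_encode_eq)
next
  case (MEq x y) then show ?case by (cases \<chi>) (auto simp: prod_encode_eq)
next
  case (MLetter b x) then show ?case by (cases \<chi>) (auto simp: prod_encode_eq inj_onD[OF assms])
next
  case (MMem x X) then show ?case by (cases \<chi>) (auto simp: prod_encode_eq)
next
  case (MNeg \<psi>) then show ?case by (cases \<chi>) (auto simp: prod_encode_eq)
next
  case (MConj \<psi>1 \<psi>2) then show ?case by (cases \<chi>) (auto simp: prod_encode_eq)
next
  case (MEx1 x \<psi>) then show ?case by (cases \<chi>) (auto simp: prod_encode_eq)
next
  case (MEx2 X \<psi>) then show ?case by (cases \<chi>) (auto simp: prod_encode_eq)
qed


section \<open>Padding and tensor products\<close>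

text \<open>The padding symbol is \<open>None\<close>; tuples are lists.\<close>

definition pad_nth :: "'a list \<Rightarrow> nat \<Rightarrow> 'a option" where
  "pad_nth u j = (if j < length u then Some (u ! j) else None)"

definition tensor :: "'a list list \<Rightarrow> 'a option list list" where
  "tensor us = map (\<lambda>j. map (\<lambda>u. pad_nth u j) us) [0..<Max (length ` set us)]"

definition lang_power :: "'a list set \<Rightarrow> nat \<Rightarrow> 'a option list list set" where
  "lang_power L a = {tensor us | us. length us = a \<and> set us \<subseteq> L}"

definition lang_rel :: "nat \<Rightarrow> 'a option list list set \<Rightarrow> 'a list list set" where
  "lang_rel a L = {us. length us = a \<and> [] \<notin> set us \<and> tensor us \<in> L}"

text \<open>The tensor power of an alphabet. With \<open>padded = False\<close> it is the Cartesian power of \<open>\<Sigma>\<close>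
  itself, so that only tensor products of strings of equal length are strings over it. With
  \<open>padded = True\<close> it is the Cartesian power of \<open>\<Sigma>\<close> extended by the padding symbol, over which
  every tensor product of strings over \<open>\<Sigma>\<close> is a string. Both conventions are treated.\<close>

definition alphabet_power :: "bool \<Rightarrow> 'a set \<Rightarrow> nat \<Rightarrow> 'a option list set" where
  "alphabet_power padded \<Sigma> a =
     {t. length t = a \<and> set t \<subseteq> (if padded then insert None (Some ` \<Sigma>) else Some ` \<Sigma>)}"


section \<open>Ordered decision diagrams\<close>

record 'a layer =
  left :: "nat set"
  right :: "nat set"
  transitions :: "(nat \<times> 'a option \<times> nat) set"
  initial :: "nat set"
  final :: "nat set"
  is_first :: bool
  is_last :: bool

definition layers :: "'a set \<Rightarrow> nat \<Rightarrow> 'a layer set" where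
  "layers \<Sigma> w = {B. left B \<subseteq> {..<w} \<and> right B \<subseteq> {..<w} \<and>
     transitions B \<subseteq> left B \<times> insert None (Some ` \<Sigma>) \<times> right B \<and>
     initial B \<subseteq> left B \<and> final B \<subseteq> right B \<and>
     (\<not> is_first B \<longrightarrow> initial B = {}) \<and> (\<not> is_last B \<longrightarrow> final B = {})}"

definition odds :: "'a set \<Rightarrow> nat \<Rightarrow> nat \<Rightarrow> 'a layer list set" where
  "odds \<Sigma> w k = {D. length D = k \<and> set D \<subseteq> layers \<Sigma> w \<and>
     (\<forall>i. Suc i < k \<longrightarrow> left (D ! Suc i) = right (D ! i)) \<and>
     (\<forall>i<k. is_first (D ! i) \<longleftrightarrow> i = 0) \<and>
     (\<forall>i<k. is_last (D ! i) \<longleftrightarrow> Suc i = k)}"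

text \<open>That an accepted string is over \<open>\<Sigma>\<close> follows from the typing of the transitions.\<close>

definition odd_lang :: "'a layer list \<Rightarrow> 'a list set" where
  "odd_lang D = {s. s \<noteq> [] \<and> length s \<le> length D \<and>
     (\<exists>p q. (\<forall>i<length D. (p i, pad_nth s i, q i) \<in> transitions (D ! i)) \<and>
            (\<forall>i. Suc i < length D \<longrightarrow> p (Suc i) = q i) \<and>
            p 0 \<in> initial (D ! 0) \<and> q (length D - 1) \<in> final (D ! (length D - 1)))}"


section \<open>Structural tuples and derived structures\<close>

text \<open>A tuple \<open>(D\<^sub>0, \<dots>, D\<^sub>m)\<close> is given by \<open>D\<^sub>0\<close> and the list \<open>Ds\<close> of the others, so the diagram of
  the relation symbol with number \<open>i\<close> is \<open>Ds ! i\<close>.\<close>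

definition structural ::
  "bool \<Rightarrow> 'a set \<Rightarrow> nat \<Rightarrow> nat list \<Rightarrow> 'a layer list \<Rightarrow> 'a option list layer list list \<Rightarrow> bool" where
  "structural padded \<Sigma> w \<tau> D0 Ds \<longleftrightarrow> length Ds = length \<tau> \<and>
     (\<exists>k\<ge>1. D0 \<in> odds \<Sigma> w k \<and>
        (\<forall>i<length \<tau>. Ds ! i \<in> odds (alphabet_power padded \<Sigma> (\<tau> ! i)) w k \<and>
           odd_lang (Ds ! i) \<subseteq> lang_power (odd_lang D0) (\<tau> ! i)))"

definition derived_struct ::
  "nat list \<Rightarrow> 'a layer list \<Rightarrow> 'a option list layer list list \<Rightarrow> 'a list struct" where
  "derived_struct \<tau> D0 Ds =
     \<lparr>universe = odd_lang D0, interp = (\<lambda>i. lang_rel (\<tau> ! i) (odd_lang (Ds ! i)))\<rparr>"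

type_synonym 'a layer_tuple = "'a layer \<times> 'a option list layer list"

definition layer_tuples :: "bool \<Rightarrow> 'a set \<Rightarrow> nat \<Rightarrow> nat list \<Rightarrow> 'a layer_tuple set" where
  "layer_tuples padded \<Sigma> w \<tau> = layers \<Sigma> w \<times>
     {Bs. length Bs = length \<tau> \<and>
        (\<forall>i<length \<tau>. Bs ! i \<in> layers (alphabet_power padded \<Sigma> (\<tau> ! i)) w)}"

text \<open>The string \<open>D\<^sub>0 \<otimes> \<dots> \<otimes> D\<^sub>m\<close>; in a structural tuple all lengths agree, so no padding occurs.\<close>

definition odd_tensor ::
  "'a layer list \<Rightarrow> 'a option list layer list list \<Rightarrow> 'a layer_tuple list" where
  "odd_tensor D0 Ds = map (\<lambda>j. (D0 ! j, map (\<lambda>D. D ! j) Ds)) [0..<length D0]"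

end

(* The tracks of a word of layer tuples carry everything the two logics quantify over: a position or a
   set of positions is a 0/1 track, and an element of the derived structure, padded to the length of
   the diagrams, is a track of symbols. Being structural and the atomic formulas of both logics are then
   regular conditions on words of tuples of tracks. Only the number of states is needed: negation keeps
   it, conjunction multiplies, quantification exponentiates, so a tower of exponentials in the code of the
   instance bounds the length of a shortest solution. The decision procedure tries all shorter
   strings and evaluates the formulas by brute force, without constructing any automaton for them. *)

theory Submission
  imports Defs
begin

section \<open>A calculus of recursive functions\<close>

text \<open>Once the string itself is quantified as a track, only a blank word remains, in which
  nothing but the length varies. Solvability then means that some word over a single letter is
  accepted, and a pigeonhole on the visited states bounds the length of a shortest one. For this the
  automata only have to exist, so letters may be all functions \<open>nat \<Rightarrow> nat\<close>:
  each letter carries every track at once, and no alphabet has to follow the free variables.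

  Two things must still be uniform in the instance. One number of states has to serve the infinitely
  many atoms of both logics; it can, since an atom only changes how letters are read by automata of
  bounded size. And one recursive function has to evaluate all formulas; it is a course-of-values
  recursion along their codes, with words coded by numbers. In contrast, \<Sigma>, \<open>w\<close>
  and \<tau> are fixed, so automata for diagrams enter that function as finite tables.

  An element of the structure is a nonempty string no longer than the diagrams; padding makes it a
  track of the same word.\<close>

definition rec_fn :: "nat \<Rightarrow> (nat list \<Rightarrow> nat) \<Rightarrow> bool" where
  "rec_fn n f \<longleftrightarrow> (\<exists>r. \<forall>xs. length xs = n \<longrightarrow> rec_eval r xs (f xs))"

lemma rec_fn_cong: "(\<And>xs. length xs = n \<Longrightarrow> f xs = g xs) \<Longrightarrow> rec_fn n f = rec_fn n g"
  by (auto simp: rec_fn_def)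

lemma rec_fn_nth: "i < n \<Longrightarrow> rec_fn n (\<lambda>xs. xs ! i)"
  unfolding rec_fn_def by (intro exI[of _ "Proj i"]) (auto intro: rec_eval.Proj)

lemma rec_fn_comp:
  assumes "rec_fn (length fs) g" and "\<forall>f\<in>set fs. rec_fn n f"
  shows "rec_fn n (\<lambda>xs. g (map (\<lambda>f. f xs) fs))"
proof -
  from assms(1) obtain r where r: "\<And>ys. length ys = length fs \<Longrightarrow> rec_eval r ys (g ys)"
    unfolding rec_fn_def by blast
  from assms(2) obtain h where h: "\<And>f xs. f \<in> set fs \<Longrightarrow> length xs = n \<Longrightarrow> rec_eval (h f) xs (f xs)"
    unfolding rec_fn_def by metis
  show ?thesis
    unfolding rec_fn_def
  proof (intro exI[of _ "Comp r (map h fs)"] allI impI)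
    fix xs :: "nat list" assume "length xs = n"
    then show "rec_eval (Comp r (map h fs)) xs (g (map (\<lambda>f. f xs) fs))"
      by (intro rec_eval.Comp[OF _ r]) (auto simp: list_all2_conv_all_nth h)
  qed
qed

lemma rec_fn_comp1: "rec_fn 1 F \<Longrightarrow> rec_fn n f \<Longrightarrow> rec_fn n (\<lambda>xs. F [f xs])"
  using rec_fn_comp[of "[f]" F n] by simp

lemma rec_fn_comp2: "rec_fn 2 F \<Longrightarrow> rec_fn n f \<Longrightarrow> rec_fn n g \<Longrightarrow> rec_fn n (\<lambda>xs. F [f xs, g xs])"
  using rec_fn_comp[of "[f, g]" F n] by (simp add: numeral_2_eq_2)

lemma rec_fn_0: "rec_fn n (\<lambda>_. 0)"
  unfolding rec_fn_def by (intro exI[of _ Zero]) (auto intro: rec_eval.Zero)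

lemma rec_fn_Suc: "rec_fn n f \<Longrightarrow> rec_fn n (\<lambda>xs. Suc (f xs))"
proof -
  have "rec_fn 1 (\<lambda>xs. Suc (xs ! 0))"
    unfolding rec_fn_def by (intro exI[of _ Succ]) (auto simp: length_Suc_conv intro: rec_eval.Succ)
  then show "rec_fn n f \<Longrightarrow> rec_fn n (\<lambda>xs. Suc (f xs))"
    using rec_fn_comp1[of "\<lambda>xs. Suc (xs ! 0)" n f] by simp
qed

lemma rec_fn_const: "rec_fn n (\<lambda>_. c)"
  by (induction c) (auto intro: rec_fn_0 rec_fn_Suc)

lemma rec_fn_prec:
  assumes "rec_fn n g" and "rec_fn (Suc (Suc n)) h"
  shows "rec_fn (Suc n) (\<lambda>xs. rec_nat (g (tl xs)) (\<lambda>i r. h (i # r # tl xs)) (hd xs))"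
proof -
  from assms obtain rg rh where
    rg: "\<And>xs. length xs = n \<Longrightarrow> rec_eval rg xs (g xs)" and
    rh: "\<And>xs. length xs = Suc (Suc n) \<Longrightarrow> rec_eval rh xs (h xs)"
    unfolding rec_fn_def by blast
  have *: "rec_eval (Prec rg rh) (m # ys) (rec_nat (g ys) (\<lambda>i r. h (i # r # ys)) m)"
    if "length ys = n" for m ys
  proof (induction m)
    case 0
    show ?case using rec_eval.Prec_0[OF rg[OF that]] by simp
  next
    case (Suc m)
    show ?case using rec_eval.Prec_Suc[OF Suc rh] that by simp
  qed
  show ?thesis
    unfolding rec_fn_def
    by (intro exI[of _ "Prec rg rh"]) (auto simp: length_Suc_conv *)
qed

text \<open>Functions of several arguments are handled as unary ones by means of the pairing function.\<close>

abbreviation (input) pfst :: "nat \<Rightarrow> nat" where "pfst z \<equiv> fst (prod_decode z)"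
abbreviation (input) psnd :: "nat \<Rightarrow> nat" where "psnd z \<equiv> snd (prod_decode z)"
abbreviation (input) pair :: "nat \<Rightarrow> nat \<Rightarrow> nat" where "pair a b \<equiv> prod_encode (a, b)"

definition comp_fn :: "(nat \<Rightarrow> nat) \<Rightarrow> bool" where
  "comp_fn f \<longleftrightarrow> rec_fn 1 (\<lambda>xs. f (xs ! 0))"

definition comp_pred :: "(nat \<Rightarrow> bool) \<Rightarrow> bool" where
  "comp_pred P \<longleftrightarrow> comp_fn (\<lambda>x. if P x then 1 else 0)"

named_theorems comp

lemma comp_fn_lift1:
  "rec_fn 1 (\<lambda>xs. F (xs ! 0)) \<Longrightarrow> comp_fn f \<Longrightarrow> comp_fn (\<lambda>x. F (f x))"
  unfolding comp_fn_def using rec_fn_comp1[of "\<lambda>xs. F (xs ! 0)" 1] by simp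

lemma comp_fn_lift2:
  "rec_fn 2 (\<lambda>xs. F (xs ! 0) (xs ! 1)) \<Longrightarrow> comp_fn f \<Longrightarrow> comp_fn g \<Longrightarrow> comp_fn (\<lambda>x. F (f x) (g x))"
  unfolding comp_fn_def using rec_fn_comp2[of "\<lambda>xs. F (xs ! 0) (xs ! 1)" 1] by simp

lemma comp_fn_compose: "comp_fn F \<Longrightarrow> comp_fn f \<Longrightarrow> comp_fn (\<lambda>x. F (f x))"
  unfolding comp_fn_def[of F] by (rule comp_fn_lift1)

section \<open>Arithmetic, case distinctions and connectives\<close>

lemma rec_fn_add: "rec_fn 2 (\<lambda>xs. xs ! 0 + xs ! 1)"
proof -
  have "rec_fn 2 (\<lambda>xs. rec_nat (tl xs ! 0) (\<lambda>i r. Suc ((i # r # tl xs) ! 1)) (hd xs))"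
    using rec_fn_prec[of 1 "\<lambda>xs. xs ! 0" "\<lambda>xs. Suc (xs ! 1)"]
    by (simp add: rec_fn_nth rec_fn_Suc numeral_2_eq_2)
  moreover have "rec_nat b (\<lambda>i r. Suc r) a = a + b" for a b :: nat by (induction a) auto
  ultimately show ?thesis
    by (subst rec_fn_cong[of 2 _ "\<lambda>xs. rec_nat (tl xs ! 0) (\<lambda>i r. Suc ((i # r # tl xs) ! 1)) (hd xs)"])
      (auto simp: numeral_2_eq_2 length_Suc_conv)
qed

lemma rec_fn_mult: "rec_fn 2 (\<lambda>xs. xs ! 0 * xs ! 1)"
proof -
  have "rec_fn 3 (\<lambda>xs. xs ! 2 + xs ! 1)"
    using rec_fn_comp2[OF rec_fn_add rec_fn_nth[of 2 3] rec_fn_nth[of 1 3]] by simp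
  then have "rec_fn 2 (\<lambda>xs. rec_nat 0 (\<lambda>i r. (i # r # tl xs) ! 2 + (i # r # tl xs) ! 1) (hd xs))"
    using rec_fn_prec[of 1 "\<lambda>xs. 0" "\<lambda>xs. xs ! 2 + xs ! 1"]
    by (simp add: rec_fn_0 numeral_2_eq_2 numeral_3_eq_3)
  moreover have "rec_nat 0 (\<lambda>i r. b + r) a = a * b" for a b :: nat by (induction a) auto
  ultimately show ?thesis
    by (subst rec_fn_cong[of 2 _ "\<lambda>xs. rec_nat 0 (\<lambda>i r. (i # r # tl xs) ! 2 + (i # r # tl xs) ! 1) (hd xs)"])
      (auto simp: numeral_2_eq_2 length_Suc_conv)
qed

lemma rec_fn_pred: "rec_fn 1 (\<lambda>xs. xs ! 0 - 1)"
proof -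
  have "rec_fn 1 (\<lambda>xs. rec_nat 0 (\<lambda>i r. (i # r # tl xs) ! 0) (hd xs))"
    using rec_fn_prec[of 0 "\<lambda>xs. 0" "\<lambda>xs. xs ! 0"] by (simp add: rec_fn_nth rec_fn_0)
  moreover have "rec_nat 0 (\<lambda>i r. i) a = a - 1" for a :: nat by (cases a) auto
  ultimately show ?thesis
    by (subst rec_fn_cong[of 1 _ "\<lambda>xs. rec_nat 0 (\<lambda>i r. (i # r # tl xs) ! 0) (hd xs)"])
      (auto simp: length_Suc_conv)
qed

lemma rec_fn_diff: "rec_fn 2 (\<lambda>xs. xs ! 0 - xs ! 1)"
proof -
  have "rec_fn 3 (\<lambda>xs. xs ! 1 - 1)"
    using rec_fn_comp1[OF rec_fn_pred rec_fn_nth[of 1 3]] by simp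
  then have "rec_fn 2 (\<lambda>xs. rec_nat (tl xs ! 0) (\<lambda>i r. (i # r # tl xs) ! 1 - 1) (hd xs))"
    using rec_fn_prec[of 1 "\<lambda>xs. xs ! 0" "\<lambda>xs. xs ! 1 - 1"]
    by (simp add: rec_fn_nth numeral_2_eq_2 numeral_3_eq_3)
  from rec_fn_comp2[OF this rec_fn_nth[of 1 2] rec_fn_nth[of 0 2]]
  have "rec_fn 2 (\<lambda>xs. rec_nat (xs ! 0) (\<lambda>i r. r - 1) (xs ! 1))" by simp
  moreover have "rec_nat a (\<lambda>i r. r - 1) b = a - b" for a b :: nat by (induction b) auto
  ultimately show ?thesis by simp
qed

lemma comp_fn_id [comp]: "comp_fn (\<lambda>x. x)"
  unfolding comp_fn_def by (rule rec_fn_nth) simp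

lemma comp_fn_const [comp]: "comp_fn (\<lambda>x. c)"
  unfolding comp_fn_def by (rule rec_fn_const)

lemmas comp_fn_add [comp] = comp_fn_lift2[OF rec_fn_add]
lemmas comp_fn_mult [comp] = comp_fn_lift2[OF rec_fn_mult]
lemmas comp_fn_diff [comp] = comp_fn_lift2[OF rec_fn_diff]

lemma comp_fn_Suc [comp]: "comp_fn f \<Longrightarrow> comp_fn (\<lambda>x. Suc (f x))"
  unfolding comp_fn_def by (rule rec_fn_Suc)

lemma comp_fn_if_zero: "comp_fn f \<Longrightarrow> comp_fn g \<Longrightarrow> comp_fn h \<Longrightarrow> comp_fn (\<lambda>x. if f x = 0 then g x else h x)"
proof -
  assume a: "comp_fn f" "comp_fn g" "comp_fn h"
  \<comment> \<open>Subtraction is truncated, so \<open>1 - f x\<close> is the truth value of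
    \<open>f x = 0\<close> and the case distinction is a sum of two products.\<close>
  have "(\<lambda>x. if f x = 0 then g x else h x) = (\<lambda>x. (1 - f x) * g x + (1 - (1 - f x)) * h x)"
    by auto
  then show ?thesis by (simp only:) (intro comp a)
qed

lemma comp_fn_if [comp]:
  assumes "comp_pred P" "comp_fn g" "comp_fn h"
  shows "comp_fn (\<lambda>x. if P x then g x else h x)"
proof -
  have "(\<lambda>x. if P x then g x else h x) = (\<lambda>x. if (if P x then 1::nat else 0) = 0 then h x else g x)"
    by auto
  then show ?thesis using assms comp_fn_if_zero unfolding comp_pred_def by simp
qed

lemma comp_pred_le [comp]:
  assumes "comp_fn f" "comp_fn g"
  shows "comp_pred (\<lambda>x. f x \<le> g x)"
proof -
  have "(\<lambda>x. if f x \<le> g x then 1 else 0) = (\<lambda>x. if f x - g x = 0 then 1 else 0 :: nat)" by auto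
  then show ?thesis
    unfolding comp_pred_def by (simp only:) (intro comp comp_fn_if_zero assms)
qed

lemma comp_pred_const [comp]: "comp_pred (\<lambda>x. b)"
  unfolding comp_pred_def by (rule comp)

lemma comp_pred_not [comp]: "comp_pred P \<Longrightarrow> comp_pred (\<lambda>x. \<not> P x)"
proof -
  assume "comp_pred P"
  then have "comp_fn (\<lambda>x. if P x then 0 else 1)" by (intro comp)
  moreover have "(\<lambda>x. if P x then 0 else 1) = (\<lambda>x. if \<not> P x then 1 else 0 :: nat)" by auto
  ultimately show ?thesis unfolding comp_pred_def by simp
qed

lemma comp_pred_conj [comp]: "comp_pred P \<Longrightarrow> comp_pred Q \<Longrightarrow> comp_pred (\<lambda>x. P x \<and> Q x)"
proof -
  assume "comp_pred P" "comp_pred Q"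
  then have "comp_fn (\<lambda>x. if P x then (if Q x then 1 else 0) else 0)" by (intro comp)
  moreover have "(\<lambda>x. if P x then (if Q x then 1 else 0) else 0) = (\<lambda>x. if P x \<and> Q x then 1 else 0 :: nat)" by auto
  ultimately show ?thesis unfolding comp_pred_def by simp
qed

lemma comp_pred_disj [comp]: "comp_pred P \<Longrightarrow> comp_pred Q \<Longrightarrow> comp_pred (\<lambda>x. P x \<or> Q x)"
  using comp_pred_not[OF comp_pred_conj[OF comp_pred_not comp_pred_not]] by simp

lemma comp_pred_imp [comp]: "comp_pred P \<Longrightarrow> comp_pred Q \<Longrightarrow> comp_pred (\<lambda>x. P x \<longrightarrow> Q x)"
  unfolding imp_conv_disj by (intro comp)

lemma comp_pred_if [comp]:
  assumes "comp_pred P" "comp_pred Q" "comp_pred R"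
  shows "comp_pred (\<lambda>x. if P x then Q x else R x)"
proof -
  have "comp_pred (\<lambda>x. (P x \<longrightarrow> Q x) \<and> (\<not> P x \<longrightarrow> R x))" by (intro comp assms)
  then show ?thesis by (simp only: if_bool_eq_conj)
qed

lemma comp_pred_less [comp]: "comp_fn f \<Longrightarrow> comp_fn g \<Longrightarrow> comp_pred (\<lambda>x. f x < g x)"
  using comp_pred_le[OF comp_fn_Suc] by (simp add: Suc_le_eq)

lemma comp_pred_eq [comp]: "comp_fn f \<Longrightarrow> comp_fn g \<Longrightarrow> comp_pred (\<lambda>x. f x = g x)"
proof -
  assume "comp_fn f" "comp_fn g"
  then have "comp_pred (\<lambda>x. f x \<le> g x \<and> g x \<le> f x)" by (intro comp)
  moreover have "(\<lambda>x. f x \<le> g x \<and> g x \<le> f x) = (\<lambda>x. f x = g x)" by auto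
  ultimately show ?thesis by simp
qed

lemma comp_pred_compose: "comp_pred P \<Longrightarrow> comp_fn f \<Longrightarrow> comp_pred (\<lambda>x. P (f x))"
  unfolding comp_pred_def by (rule comp_fn_compose)

section \<open>Inverting the pairing function\<close>

lemma rec_fn_triangle: "rec_fn 1 (\<lambda>xs. triangle (xs ! 0))"
proof -
  have "rec_fn 2 (\<lambda>xs. xs ! 1 + Suc (xs ! 0))"
    using rec_fn_comp2[OF rec_fn_add rec_fn_nth[of 1 2] rec_fn_Suc[OF rec_fn_nth[of 0 2]]] by simp
  then have "rec_fn 1 (\<lambda>xs. rec_nat 0 (\<lambda>i r. (i # r # tl xs) ! 1 + Suc ((i # r # tl xs) ! 0)) (hd xs))"
    using rec_fn_prec[of 0 "\<lambda>xs. 0" "\<lambda>xs. xs ! 1 + Suc (xs ! 0)"]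
    by (simp add: rec_fn_0 numeral_2_eq_2)
  moreover have "rec_nat 0 (\<lambda>i r. Suc (r + i)) a = triangle a" for a :: nat
    by (induction a) auto
  ultimately show ?thesis
    by (subst rec_fn_cong[of 1 _ "\<lambda>xs. rec_nat 0 (\<lambda>i r. (i # r # tl xs) ! 1 + Suc ((i # r # tl xs) ! 0)) (hd xs)"])
      (auto simp: length_Suc_conv)
qed

lemmas comp_fn_triangle = comp_fn_lift1[OF rec_fn_triangle]

lemma comp_fn_pair [comp]: "comp_fn f \<Longrightarrow> comp_fn g \<Longrightarrow> comp_fn (\<lambda>x. pair (f x) (g x))"
  by (simp add: prod_encode_def) (intro comp comp_fn_triangle)

text \<open>The number of the antidiagonal on which the pair coded by \<open>z\<close> lies, that
  is, the largest \<open>d\<close> with \<open>triangle d \<le> z\<close>. It grows by at most one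
  per step, so primitive recursion finds it.\<close>

primrec diagonal :: "nat \<Rightarrow> nat" where
  "diagonal 0 = 0"
| "diagonal (Suc z) = (if triangle (Suc (diagonal z)) \<le> Suc z then Suc (diagonal z) else diagonal z)"

lemma triangle_diagonal: "triangle (diagonal z) \<le> z \<and> z < triangle (Suc (diagonal z))"
  by (induction z) auto

lemma triangle_mono: "i \<le> j \<Longrightarrow> triangle i \<le> triangle j"
  unfolding triangle_def by (intro div_le_mono mult_le_mono) auto

lemma diagonal_prod_encode: "diagonal (pair a b) = a + b"
proof -
  let ?d = "diagonal (pair a b)"
  have z: "triangle (a + b) \<le> pair a b" "pair a b < triangle (Suc (a + b))"
    by (auto simp: prod_encode_def)
  have "\<not> Suc ?d \<le> a + b"
    using triangle_mono[of "Suc ?d" "a + b"] triangle_diagonal[of "pair a b"] z by linarith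
  moreover have "\<not> Suc (a + b) \<le> ?d"
    using triangle_mono[of "Suc (a + b)" ?d] triangle_diagonal[of "pair a b"] z by linarith
  ultimately show ?thesis by linarith
qed

lemma prod_decode_diagonal:
  "pfst z = z - triangle (diagonal z)" "psnd z = diagonal z - pfst z"
proof -
  obtain a b where z: "z = pair a b" by (metis prod_decode_inverse surj_pair)
  show "pfst z = z - triangle (diagonal z)" "psnd z = diagonal z - pfst z"
    using prod_encode_inverse[of "(a, b)"] unfolding z diagonal_prod_encode
    by (simp_all add: prod_encode_def)
qed

lemma rec_fn_diagonal: "rec_fn 1 (\<lambda>xs. diagonal (xs ! 0))"
proof -
  define S where "S = (\<lambda>i r. if triangle (Suc r) - Suc i = 0 then Suc r else r)"
  have S: "S i r = (1 - (triangle (Suc r) - Suc i)) + r" for i r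
    unfolding S_def by simp
  have t': "rec_fn 2 (\<lambda>xs. triangle (Suc (xs ! 1)))"
    using rec_fn_comp1[OF rec_fn_triangle rec_fn_Suc[OF rec_fn_nth[of 1 2]]] by simp
  have d: "rec_fn 2 (\<lambda>xs. triangle (Suc (xs ! 1)) - Suc (xs ! 0))"
    using rec_fn_comp2[OF rec_fn_diff t' rec_fn_Suc[OF rec_fn_nth[of 0 2]]] by simp
  have d': "rec_fn 2 (\<lambda>xs. 1 - (triangle (Suc (xs ! 1)) - Suc (xs ! 0)))"
    using rec_fn_comp2[OF rec_fn_diff rec_fn_const d] by simp
  have "rec_fn 2 (\<lambda>xs. S (xs ! 0) (xs ! 1))"
    using rec_fn_comp2[OF rec_fn_add d' rec_fn_nth[of 1 2]] unfolding S by simp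
  then have "rec_fn 1 (\<lambda>xs. rec_nat 0 (\<lambda>i r. S ((i # r # tl xs) ! 0) ((i # r # tl xs) ! 1)) (hd xs))"
    using rec_fn_prec[of 0 "\<lambda>xs. 0" "\<lambda>xs. S (xs ! 0) (xs ! 1)"]
    by (simp add: rec_fn_0 numeral_2_eq_2)
  moreover have "rec_nat 0 S a = diagonal a" for a :: nat
    by (induction a) (auto simp: S_def)
  ultimately show ?thesis
    by (subst rec_fn_cong[of 1 _ "\<lambda>xs. rec_nat 0 (\<lambda>i r. S ((i # r # tl xs) ! 0) ((i # r # tl xs) ! 1)) (hd xs)"])
      (auto simp: length_Suc_conv)
qed

lemma comp_fn_pfst [comp]: "comp_fn f \<Longrightarrow> comp_fn (\<lambda>x. pfst (f x))"
  unfolding prod_decode_diagonal(1) by (intro comp comp_fn_triangle comp_fn_lift1[OF rec_fn_diagonal])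

lemma comp_fn_psnd [comp]: "comp_fn f \<Longrightarrow> comp_fn (\<lambda>x. psnd (f x))"
  unfolding prod_decode_diagonal(2) by (intro comp comp_fn_lift1[OF rec_fn_diagonal])

text \<open>The step of a recursion with parameter takes three arguments; the last hypothesis asks
  for it as a unary function of the nested pair of counter, value and parameter.\<close>

lemma comp_fn_rec [comp]:
  assumes "comp_fn n" "comp_fn g" "comp_fn (\<lambda>z. h (pfst z) (pfst (psnd z)) (psnd (psnd z)))"
  shows "comp_fn (\<lambda>x. rec_nat (g x) (\<lambda>i r. h i r x) (n x))"
proof -
  let ?H = "\<lambda>z. h (pfst z) (pfst (psnd z)) (psnd (psnd z))"
  have p: "rec_fn 2 (\<lambda>xs. pair (xs ! 0) (xs ! 1))"
  proof -
    have "rec_fn 2 (\<lambda>xs. triangle (xs ! 0 + xs ! 1))"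
      using rec_fn_comp1[OF rec_fn_triangle rec_fn_add] by simp
    from rec_fn_comp2[OF rec_fn_add this rec_fn_nth[of 0 2]] show ?thesis
      by (simp add: prod_encode_def)
  qed
  have "rec_fn 3 (\<lambda>xs. pair (xs ! 1) (xs ! 2))"
    using rec_fn_comp2[OF p rec_fn_nth[of 1 3] rec_fn_nth[of 2 3]] by simp
  from rec_fn_comp2[OF p rec_fn_nth[of 0 3] this]
  have "rec_fn 3 (\<lambda>xs. pair (xs ! 0) (pair (xs ! 1) (xs ! 2)))" by simp
  from rec_fn_comp1[OF assms(3)[unfolded comp_fn_def] this]
  have "rec_fn 3 (\<lambda>xs. h (xs ! 0) (xs ! 1) (xs ! 2))" by simp
  then have "rec_fn 2 (\<lambda>xs. rec_nat (g (tl xs ! 0)) (\<lambda>i r. h i r (tl xs ! 0)) (hd xs))"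
    using rec_fn_prec[of 1 "\<lambda>xs. g (xs ! 0)" "\<lambda>xs. h (xs ! 0) (xs ! 1) (xs ! 2)"] assms(2)
    by (simp add: comp_fn_def numeral_2_eq_2 numeral_3_eq_3)
  from rec_fn_comp2[OF this assms(1)[unfolded comp_fn_def] rec_fn_nth[of 0 1]]
  show ?thesis unfolding comp_fn_def by simp
qed

section \<open>Bounded quantifiers, division and finite tables\<close>

lemma comp_pred_Bex [comp]:
  assumes "comp_fn n" "comp_pred (\<lambda>z. P (pfst z) (psnd z))"
  shows "comp_pred (\<lambda>x. \<exists>i<n x. P i x)"
proof -
  have "comp_fn (\<lambda>x. rec_nat 0 (\<lambda>i r. if P i x then 1 else r) (n x))"
    using comp_pred_compose[OF assms(2), of "\<lambda>z. pair (pfst z) (psnd (psnd z))"]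
    by (intro comp assms) (simp add: comp)
  moreover have "rec_nat 0 (\<lambda>i r. if P i x then 1 else r) m = (if \<exists>i<m. P i x then 1 else 0 :: nat)" for x m
    by (induction m) (auto simp: less_Suc_eq)
  ultimately show ?thesis unfolding comp_pred_def by simp
qed

lemma comp_pred_Ball [comp]:
  assumes "comp_fn n" "comp_pred (\<lambda>z. P (pfst z) (psnd z))"
  shows "comp_pred (\<lambda>x. \<forall>i<n x. P i x)"
  using comp_pred_not[OF comp_pred_Bex[OF assms(1) comp_pred_not[OF assms(2)]]] by simp

lemma comp_fn_power [comp]:
  assumes "comp_fn f" "comp_fn g"
  shows "comp_fn (\<lambda>x. f x ^ g x)"
proof -
  have "comp_fn (\<lambda>x. rec_nat 1 (\<lambda>i r. f x * r) (g x))"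
    by (intro comp assms comp_fn_compose[of f])
  moreover have "rec_nat 1 (\<lambda>i r. b * r) m = b ^ m" for b m :: nat by (induction m) auto
  ultimately show ?thesis by simp
qed

lemma comp_fn_div [comp]:
  assumes "comp_fn f" "comp_fn g"
  shows "comp_fn (\<lambda>x. f x div g x)"
proof -
  have *: "comp_fn (\<lambda>x. if g x = 0 then 0 else rec_nat 0 (\<lambda>i r. if Suc r * g x \<le> f x then Suc r else r) (f x))"
    by (intro comp assms comp_fn_compose[of f] comp_fn_compose[of g])
  \<comment> \<open>The recursion counts upwards while the next multiple of \<open>b\<close> still
    fits. After \<open>m\<close> rounds it holds the quotient capped at \<open>m\<close>, so
    \<open>f x\<close> rounds are enough.\<close>
  have **: "rec_nat 0 (\<lambda>i r. if Suc r * b \<le> a then Suc r else r) m = min m (a div b)" if "b > 0" for a b m :: nat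
  proof (induction m)
    case (Suc m)
    have "Suc r * b \<le> a \<longleftrightarrow> Suc r \<le> a div b" for r
      using less_eq_div_iff_mult_less_eq[OF that, of "Suc r" a] by simp
    with Suc show ?case by (auto simp: min_def)
  qed simp
  have "(\<lambda>x. if g x = 0 then 0 else rec_nat 0 (\<lambda>i r. if Suc r * g x \<le> f x then Suc r else r) (f x)) =
    (\<lambda>x. f x div g x)"
    by (auto simp del: mult_Suc simp: fun_eq_iff ** min_absorb2)
  with * show ?thesis by (simp only:)
qed

lemma comp_fn_mod [comp]: "comp_fn f \<Longrightarrow> comp_fn g \<Longrightarrow> comp_fn (\<lambda>x. f x mod g x)"
  unfolding minus_mult_div_eq_mod[symmetric] by (intro comp)

text \<open>A lookup table, whatever \<open>f\<close> is. Through it the arbitrary coding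
  \<open>enc\<close> and transition functions obtained by choice enter recursive functions.\<close>

lemma comp_fn_finite:
  assumes "finite S"
  shows "comp_fn (\<lambda>x. if x \<in> S then f x else 0)"
  using assms
proof (induction S rule: finite_induct)
  case (insert a S)
  have "(\<lambda>x. if x \<in> insert a S then f x else 0) = (\<lambda>x. if x = a then f a else if x \<in> S then f x else 0)"
    by auto
  then show ?case by (simp only:) (intro comp insert.IH)
qed (simp add: comp)

lemma comp_pred_finite: "finite S \<Longrightarrow> comp_pred (\<lambda>x. x \<in> S)"
  unfolding comp_pred_def by (rule comp_fn_finite)

section \<open>Digit expansions and course-of-values recursion\<close>

definition digit :: "nat \<Rightarrow> nat \<Rightarrow> nat \<Rightarrow> nat" where
  "digit c e i = e div c ^ i mod c"

lemma comp_fn_digit [comp]: "comp_fn f \<Longrightarrow> comp_fn g \<Longrightarrow> comp_fn (\<lambda>x. digit c (f x) (g x))"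
  unfolding digit_def by (intro comp)

lemma digit_less: "c > 0 \<Longrightarrow> digit c e i < c"
  by (simp add: digit_def)

lemma digit_zero: "e < c ^ i \<Longrightarrow> digit c e i = 0"
  by (simp add: digit_def)

lemma digit_add_low: "i < m \<Longrightarrow> digit c (e + d * c ^ m) i = digit c e i"
proof -
  assume "i < m"
  then obtain j where m: "m = Suc (i + j)" by (metis less_imp_Suc_add)
  show ?thesis
  proof (cases "c = 0")
    case False
    have "e + d * c ^ m = e + (d * c ^ j * c) * c ^ i" by (simp add: m power_add mult_ac)
    then have "(e + d * c ^ m) div c ^ i = d * c ^ j * c + e div c ^ i"
      using False div_mult_self1[of "c ^ i" e "d * c ^ j * c"] by (simp only: power_not_zero refl not_False_eq_True)
    then show ?thesis by (simp add: digit_def)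
  qed (simp add: digit_def m)
qed

lemma digit_add_top: "e < c ^ m \<Longrightarrow> d < c \<Longrightarrow> digit c (e + d * c ^ m) m = d"
  by (simp add: digit_def)

text \<open>Every array of \<open>N\<close> entries below \<open>c\<close> is coded by a number
  below \<open>c ^ N\<close>; a quantifier over arrays thus becomes a bounded quantifier over
  numbers.\<close>

lemma digits_exist:
  assumes "c > 0" and "\<And>i. i < N \<Longrightarrow> f i < c"
  shows "\<exists>e < c ^ N. \<forall>i<N. digit c e i = f i"
  using assms(2)
proof (induction N)
  case (Suc N)
  then obtain e where e: "e < c ^ N" "\<forall>i<N. digit c e i = f i" by auto
  have "e + f N * c ^ N < Suc (f N) * c ^ N" using e(1) by simp
  also have "\<dots> \<le> c * c ^ N" by (intro mult_le_mono1) (simp add: Suc_leI Suc.prems)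
  finally have "e + f N * c ^ N < c ^ Suc N" by simp
  moreover have "\<forall>i<Suc N. digit c (e + f N * c ^ N) i = f i"
    using e Suc.prems by (auto simp: less_Suc_eq digit_add_low digit_add_top)
  ultimately show ?case by blast
qed (simp add: assms)

primrec history :: "(nat \<Rightarrow> nat \<Rightarrow> nat \<Rightarrow> bool) \<Rightarrow> nat \<Rightarrow> nat \<Rightarrow> nat" where
  "history rule x 0 = 0"
| "history rule x (Suc m) = history rule x m + (if rule x m (history rule x m) then 1 else 0) * 2 ^ m"

lemma history_less: "history rule x m < 2 ^ m"
  by (induction m) auto

lemma digit_history: "i < m \<Longrightarrow> digit 2 (history rule x m) i = 1 \<longleftrightarrow> rule x i (history rule x i)"
proof (induction m)
  case (Suc m)
  show ?case
  proof (cases "i = m")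
    case True
    then show ?thesis
      using history_less[of rule x m] by (simp only: history.simps) (subst digit_add_top, auto)
  next
    case False
    with Suc show ?thesis by (simp only: history.simps) (subst digit_add_low, auto)
  qed
qed simp

text \<open>Course-of-values recursion for predicates: the third argument of \<open>rule\<close> is a number whose
  binary digits are the truth values at the smaller arguments.\<close>

lemma course_of_values:
  assumes "comp_pred (\<lambda>z. rule (pfst z) (pfst (psnd z)) (psnd (psnd z)))"
  obtains P where "comp_pred (\<lambda>z. P (pfst z) (psnd z))"
    and "\<And>x m. \<exists>R. P x m = rule x m R \<and> (\<forall>i<m. digit 2 R i = 1 \<longleftrightarrow> P x i)"
proof
  let ?P = "\<lambda>x m. rule x m (history rule x m)"
  have *: "history rule x m = rec_nat 0 (\<lambda>i r. r + (if rule x i r then 1 else 0) * 2 ^ i) m" for x m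
    by (induction m) auto
  have h: "comp_fn (\<lambda>z. history rule (pfst z) (psnd z))"
    unfolding *
    using comp_pred_compose[OF assms, of "\<lambda>z. pair (pfst (psnd (psnd z))) (pair (pfst z) (pfst (psnd z)))"]
    by (intro comp) (simp add: comp)
  show "comp_pred (\<lambda>z. ?P (pfst z) (psnd z))"
    using comp_pred_compose[OF assms, of "\<lambda>z. pair (pfst z) (pair (psnd z) (history rule (pfst z) (psnd z)))"]
    by (simp add: comp h)
  show "\<exists>R. ?P x m = rule x m R \<and> (\<forall>i<m. digit 2 R i = 1 \<longleftrightarrow> ?P x i)" for x m
    using digit_history by blast
qed

section \<open>Recognizable languages over arbitrary letter types\<close>

text \<open>\<open>recog N P\<close>: a deterministic automaton with \<open>N\<close> states recognizes \<open>P\<close>. The letter type may be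
  infinite, so projections along arbitrary relations between letters are available.\<close>

definition recog :: "nat \<Rightarrow> ('b list \<Rightarrow> bool) \<Rightarrow> bool" where
  "recog N P \<longleftrightarrow> (\<exists>\<delta> q0 F. q0 < N \<and> (\<forall>q<N. \<forall>b. \<delta> q b < N) \<and> (\<forall>u. P u \<longleftrightarrow> F (foldl \<delta> q0 u)))"

abbreviation regular :: "('b list \<Rightarrow> bool) \<Rightarrow> bool" where
  "regular P \<equiv> \<exists>N. recog N P"

lemma recogI:
  assumes "s < N" "\<And>q b. q < N \<Longrightarrow> \<delta> q b < N" "\<And>u. P u \<longleftrightarrow> F (foldl \<delta> s u)"
  shows "recog N P"
  unfolding recog_def using assms by blast

lemma foldl_less: "q < (N::nat) \<Longrightarrow> (\<And>q b. q < N \<Longrightarrow> \<delta> q b < N) \<Longrightarrow> foldl \<delta> q u < N"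
  by (induction u arbitrary: q) auto

lemma recog_mono: "recog N P \<Longrightarrow> N \<le> M \<Longrightarrow> recog M P"
proof -
  assume "recog N P" "N \<le> M"
  then obtain \<delta> q0 F where a: "q0 < N" "\<And>q b. q < N \<Longrightarrow> \<delta> q b < N" "\<And>u. P u \<longleftrightarrow> F (foldl \<delta> q0 u)"
    unfolding recog_def by blast
  \<comment> \<open>Transitions must stay in range at the added states as well; these loop and are
    never reached.\<close>
  have *: "foldl (\<lambda>q b. if q < N then \<delta> q b else q) q u = foldl \<delta> q u" if "q < N" for q u
    using that by (induction u arbitrary: q) (auto simp: a(2))
  show ?thesis
  proof (rule recogI)
    show "P u \<longleftrightarrow> F (foldl (\<lambda>q b. if q < N then \<delta> q b else q) q0 u)" for u
      using a(3) *[OF a(1)] by simp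
  qed (use a \<open>N \<le> M\<close> in \<open>auto intro: less_le_trans\<close>)
qed

lemma recog_map: "recog N P \<Longrightarrow> recog N (\<lambda>u. P (map h u))"
proof -
  assume "recog N P"
  then obtain \<delta> q0 F where a: "q0 < N" "\<And>q b. q < N \<Longrightarrow> \<delta> q b < N" "\<And>u. P u \<longleftrightarrow> F (foldl \<delta> q0 u)"
    unfolding recog_def by blast
  then show ?thesis by (intro recogI[where \<delta> = "\<lambda>q b. \<delta> q (h b)" and F = F]) (auto simp: foldl_map)
qed

lemma recog_not: "recog N P \<Longrightarrow> recog N (\<lambda>u. \<not> P u)"
proof -
  assume "recog N P"
  then obtain \<delta> q0 F where "q0 < N" "\<And>q b. q < N \<Longrightarrow> \<delta> q b < N" "\<And>u. P u \<longleftrightarrow> F (foldl \<delta> q0 u)"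
    unfolding recog_def by blast
  then show ?thesis by (intro recogI[where F = "\<lambda>q. \<not> F q"]) auto
qed

lemma recog_conj:
  assumes "recog N P" "recog M Q"
  shows "recog (N * M) (\<lambda>u. P u \<and> Q u)"
proof -
  from assms(1) obtain \<delta>1 q1 F1 where a: "q1 < N" "\<And>q b. q < N \<Longrightarrow> \<delta>1 q b < N" "\<And>u. P u \<longleftrightarrow> F1 (foldl \<delta>1 q1 u)"
    unfolding recog_def by blast
  from assms(2) obtain \<delta>2 q2 F2 where b: "q2 < M" "\<And>q b. q < M \<Longrightarrow> \<delta>2 q b < M" "\<And>u. Q u \<longleftrightarrow> F2 (foldl \<delta>2 q2 u)"
    unfolding recog_def by blast
  \<comment> \<open>The pair of states \<open>(p, r)\<close> is the number
    \<open>p * M + r\<close>.\<close>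
  define \<delta> where "\<delta> q b = \<delta>1 (q div M) b * M + \<delta>2 (q mod M) b" for q b
  have lt: "p * M + r < N * M" if "p < N" "r < M" for p r
  proof -
    have "p * M + r < Suc p * M" using that by simp
    also have "\<dots> \<le> N * M" using that by (intro mult_le_mono1) simp
    finally show ?thesis .
  qed
  have M: "0 < M" using b(1) by simp
  have \<delta>: "\<delta> q b < N * M" if "q < N * M" for q b
    unfolding \<delta>_def using that M by (intro lt a b) (auto simp: less_mult_imp_div_less)
  have *: "foldl \<delta> (p * M + r) u = foldl \<delta>1 p u * M + foldl \<delta>2 r u" if "p < N" "r < M" for p r u
    using that
  proof (induction u arbitrary: p r)
    case (Cons c u)
    then have "\<delta> (p * M + r) c = \<delta>1 p c * M + \<delta>2 r c" by (simp add: \<delta>_def)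
    then show ?case using Cons a b by simp
  qed simp
  show ?thesis
  proof (rule recogI[where F = "\<lambda>q. F1 (q div M) \<and> F2 (q mod M)"])
    show "(P u \<and> Q u) \<longleftrightarrow> F1 (foldl \<delta> (q1 * M + q2) u div M) \<and> F2 (foldl \<delta> (q1 * M + q2) u mod M)" for u
      using foldl_less[of q2 M \<delta>2 u] a b by (simp add: *)
  qed (use lt a b \<delta> in auto)
qed

lemma set_encode_less: "A \<subseteq> {..<N} \<Longrightarrow> set_encode A < 2 ^ N"
proof -
  assume "A \<subseteq> {..<N}"
  then have "set_encode A \<le> (\<Sum>i<N. 2 ^ i)" unfolding set_encode_def by (intro sum_mono2) auto
  also have "\<dots> < 2 ^ N" by (induction N) auto
  finally show ?thesis .
qed

text \<open>An automaton whose states are the subsets of \<open>{..<N}\<close>, numbered by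
  \<open>set_encode\<close>. Only the state \<open>S u\<close> reached after each word and its
  change under a letter have to be described.\<close>

lemma recog_set_automaton:
  assumes "\<And>u. S u \<subseteq> {..<N}" "\<And>u b. S (u @ [b]) = D (S u) b" "\<And>u. P u \<longleftrightarrow> G (S u)"
  shows "recog (2 ^ N) P"
proof -
  \<comment> \<open>Away from the sets that are reached, \<open>D\<close> may leave
    \<open>{..<N}\<close>; the default 0 keeps the successor in range.\<close>
  define \<delta> where "\<delta> q b = (if D (set_decode q) b \<subseteq> {..<N} then set_encode (D (set_decode q) b) else 0)" for q b
  have fin: "finite (S u)" for u using assms(1) finite_subset by blast
  have *: "foldl \<delta> (set_encode (S [])) u = set_encode (S u)" for u
  proof (induction u rule: rev_induct)
    case (snoc b u)
    have "D (S u) b \<subseteq> {..<N}" using assms(1)[of "u @ [b]"] by (simp add: assms(2))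
    with snoc show ?case by (simp add: \<delta>_def set_encode_inverse[OF fin] assms(2))
  qed simp
  show ?thesis
  proof (rule recogI[where F = "\<lambda>q. G (set_decode q)" and \<delta> = \<delta> and s = "set_encode (S [])"])
    show "P u \<longleftrightarrow> G (set_decode (foldl \<delta> (set_encode (S [])) u))" for u
      by (simp add: * set_encode_inverse[OF fin] assms(3))
      show "set_encode (S []) < 2 ^ N" by (rule set_encode_less) (rule assms(1))
  qed (auto simp: \<delta>_def intro!: set_encode_less)
qed

text \<open>Subset construction: the state after \<open>u\<close> is the set of states reached on
  words related to \<open>u\<close>. A letter may be related to infinitely many others, but only
  finitely many states can result.\<close>

lemma recog_projection:
  assumes "recog N P"
  shows "recog (2 ^ N) (\<lambda>u. \<exists>u'. list_all2 R u u' \<and> P u')"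
proof -
  from assms obtain \<delta> q0 F where a: "q0 < N" "\<And>q b. q < N \<Longrightarrow> \<delta> q b < N" "\<And>u. P u \<longleftrightarrow> F (foldl \<delta> q0 u)"
    unfolding recog_def by blast
  show ?thesis
  proof (rule recog_set_automaton[where S = "\<lambda>u. {foldl \<delta> q0 u' | u'. list_all2 R u u'}"
        and G = "\<lambda>A. \<exists>q\<in>A. F q" and D = "\<lambda>A b. {\<delta> q b' | q b'. q \<in> A \<and> R b b'}"])
    show "{foldl \<delta> q0 u' | u'. list_all2 R u u'} \<subseteq> {..<N}" for u
      using foldl_less[of q0 N \<delta>] a by auto
    show "{foldl \<delta> q0 u' | u'. list_all2 R (u @ [b]) u'} =
      {\<delta> q b' | q b'. q \<in> {foldl \<delta> q0 u' | u'. list_all2 R u u'} \<and> R b b'}" for u b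
    proof -
      have "list_all2 R (u @ [b]) u' \<longleftrightarrow> (\<exists>v b'. u' = v @ [b'] \<and> list_all2 R u v \<and> R b b')" for u'
      proof (cases u' rule: rev_cases)
        case (snoc v c)
        show ?thesis
          by (cases "length u = length v") (auto simp: snoc list_all2_append dest: list_all2_lengthD)
      qed simp
      then show ?thesis by force
    qed
    show "(\<exists>u'. list_all2 R u u' \<and> P u') \<longleftrightarrow> (\<exists>q\<in>{foldl \<delta> q0 u' | u'. list_all2 R u u'}. F q)" for u
      using a(3) by auto
  qed
qed

section \<open>Elementary automata and pumping\<close>

lemma recog_const: "recog 1 (\<lambda>u. c)"
  by (rule recogI[where F = "\<lambda>_. c" and s = 0 and \<delta> = "\<lambda>_ _. 0"]) auto

lemma recog_Bex: "recog 2 (\<lambda>u. \<exists>b\<in>set u. C b)"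
proof (rule recogI)
  show "(\<exists>b\<in>set u. C b) \<longleftrightarrow> foldl (\<lambda>q b. if q = 1 \<or> C b then 1 else 0) 0 u = (1::nat)" for u
    by (induction u rule: rev_induct) auto
qed auto

lemma recog_Ball: "recog 2 (\<lambda>u. \<forall>b\<in>set u. C b)"
  using recog_not[OF recog_Bex[of "\<lambda>b. \<not> C b"]] by simp

lemma recog_last: "recog 2 (\<lambda>u. u \<noteq> [] \<and> C (last u))"
proof (rule recogI)
  show "(u \<noteq> [] \<and> C (last u)) \<longleftrightarrow> foldl (\<lambda>q b. if C b then 1 else 0) 0 u = (1::nat)" for u
    by (induction u rule: rev_induct) auto
qed auto

lemma recog_hd: "recog 3 (\<lambda>u. u \<noteq> [] \<and> C (hd u))"
proof (rule recogI)
  show "(u \<noteq> [] \<and> C (hd u)) \<longleftrightarrow> foldl (\<lambda>q b. if q = 0 then if C b then 1 else 2 else q) 0 u = (1::nat)" for u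
  proof -
    have "foldl (\<lambda>q b. if q = 0 then if C b then 1 else 2 else q) 0 u =
      (if u = [] then 0 else if C (hd u) then 1 else (2::nat))"
      by (induction u rule: rev_induct) (auto simp: hd_append)
    then show ?thesis by simp
  qed
qed auto

text \<open>The automaton has to remember the previous letter, whose type may be infinite. The
  relation may therefore depend on it only through \<open>f\<close>, which has finite range.\<close>

lemma regular_adjacent:
  assumes "finite (range f)" and "\<And>b b'. R b b' \<longleftrightarrow> T (f b) b'"
  shows "regular (\<lambda>u. \<forall>i. Suc i < length u \<longrightarrow> R (u ! i) (u ! Suc i))"
proof -
  from finite_imp_inj_to_nat_seg[OF assms(1)] obtain g :: "_ \<Rightarrow> nat" and n where
    g: "g ` range f = {i. i < n}" "inj_on g (range f)" by blast
  have gn: "g (f b) < n" for b using g(1) by auto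
  have gi: "inv_into (range f) g (g (f b)) = f b" for b using g(2) by simp
  let ?inv = "inv_into (range f) g"
  \<comment> \<open>State 0 means that nothing has been read, state 1 is the sink after a violation,
    and \<open>g (f b) + 2\<close> remembers the last letter \<open>b\<close>.\<close>
  define \<delta> where "\<delta> q b = (if q = 0 then g (f b) + 2 else if q = 1 then 1
    else if T (?inv (q - 2)) b then g (f b) + 2 else 1)" for q b
  have *: "foldl \<delta> 0 u = (if u = [] then 0 else
      if \<forall>i. Suc i < length u \<longrightarrow> R (u ! i) (u ! Suc i) then g (f (last u)) + 2 else 1)" for u
  proof (induction u rule: rev_induct)
    case (snoc b u)
    have "(\<forall>i. Suc i < length (u @ [b]) \<longrightarrow> R ((u @ [b]) ! i) ((u @ [b]) ! Suc i)) \<longleftrightarrow>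
      (\<forall>i. Suc i < length u \<longrightarrow> R (u ! i) (u ! Suc i)) \<and> (u \<noteq> [] \<longrightarrow> R (last u) b)" (is "?L \<longleftrightarrow> ?R")
    proof
      assume L: ?L
      have "R (u ! i) (u ! Suc i)" if "Suc i < length u" for i
        using L[rule_format, of i] that by (simp add: nth_append)
      moreover have "R (last u) b" if "u \<noteq> []"
        using L[rule_format, of "length u - 1"] that by (simp add: nth_append last_conv_nth)
      ultimately show ?R by blast
    next
      assume R: ?R
      show ?L
      proof (intro allI impI)
        fix i assume i: "Suc i < length (u @ [b])"
        show "R ((u @ [b]) ! i) ((u @ [b]) ! Suc i)"
        proof (cases "Suc i < length u")
          case True
          then show ?thesis using R by (simp add: nth_append)
        next
          case False
          with i have "Suc i = length u" "u \<noteq> []" by auto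
          then show ?thesis using R by (simp add: nth_append last_conv_nth flip: \<open>Suc i = length u\<close>)
        qed
      qed
    qed
    with snoc show ?case by (auto simp: \<delta>_def gi assms(2))
  qed simp
  have "recog (n + 2) (\<lambda>u. \<forall>i. Suc i < length u \<longrightarrow> R (u ! i) (u ! Suc i))"
  proof (rule recogI[where F = "\<lambda>q. q \<noteq> 1" and \<delta> = \<delta> and s = 0])
    show "(\<forall>i. Suc i < length u \<longrightarrow> R (u ! i) (u ! Suc i)) \<longleftrightarrow> foldl \<delta> 0 u \<noteq> 1" for u
      by (auto simp: *)
  qed (auto simp: \<delta>_def gn)
  then show ?thesis by blast
qed

lemma regular_Ball: "regular (\<lambda>u. \<forall>b\<in>set u. C b)"
  using recog_Ball by blast

lemma regular_hd: "regular (\<lambda>u. u \<noteq> [] \<and> C (hd u))"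
  using recog_hd by blast

lemma regular_last: "regular (\<lambda>u. u \<noteq> [] \<and> C (last u))"
  using recog_last by blast

lemma regular_map: "regular P \<Longrightarrow> regular (\<lambda>u. P (map h u))"
  using recog_map by blast

lemma regular_not: "regular P \<Longrightarrow> regular (\<lambda>u. \<not> P u)"
  using recog_not by blast

lemma regular_conj: "regular P \<Longrightarrow> regular Q \<Longrightarrow> regular (\<lambda>u. P u \<and> Q u)"
  using recog_conj by blast

lemma regular_projection: "regular P \<Longrightarrow> regular (\<lambda>u. \<exists>u'. list_all2 R u u' \<and> P u')"
  using recog_projection by blast

lemma regular_Ball_less: "(\<And>i. i < (n::nat) \<Longrightarrow> regular (P i)) \<Longrightarrow> regular (\<lambda>u. \<forall>i<n. P i u)"
proof (induction n)
  case (Suc n)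
  then have "regular (\<lambda>u. P n u \<and> (\<forall>i<n. P i u))" by (intro regular_conj) auto
  moreover have "(\<lambda>u. P n u \<and> (\<forall>i<n. P i u)) = (\<lambda>u. \<forall>i<Suc n. P i u)" by (auto simp: less_Suc_eq fun_eq_iff)
  ultimately show ?case by simp
qed (use recog_const in auto)

text \<open>Along a shortest accepted word no state repeats, since cutting out the loop would leave
  a shorter accepted word over the same letter. The bound of the search comes from here.\<close>

lemma recog_replicate:
  assumes "recog N P" "P (replicate k b)"
  shows "\<exists>k'<N. P (replicate k' b)"
proof -
  from assms(1) obtain \<delta> q0 F where a: "q0 < N" "\<And>q b. q < N \<Longrightarrow> \<delta> q b < N" "\<And>u. P u \<longleftrightarrow> F (foldl \<delta> q0 u)"
    unfolding recog_def by blast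
  define st where "st i = foldl \<delta> q0 (replicate i b)" for i
  define k0 where "k0 = (LEAST k. P (replicate k b))"
  have k0: "P (replicate k0 b)" unfolding k0_def by (rule LeastI) (rule assms(2))
  have st_add: "st (i + j) = foldl \<delta> (st i) (replicate j b)" for i j
    by (simp add: st_def replicate_add)
  have "inj_on st {..k0}"
  proof (rule linorder_inj_onI)
    fix i j assume ij: "i < j" "i \<in> {..k0}" "j \<in> {..k0}"
    show "st i \<noteq> st j"
    proof
      assume "st i = st j"
      with ij have "st (i + (k0 - j)) = st k0" using st_add[of i "k0 - j"] st_add[of j "k0 - j"] by simp
      with k0 have "P (replicate (i + (k0 - j)) b)" by (simp add: a(3) st_def)
      then have "k0 \<le> i + (k0 - j)" unfolding k0_def by (rule Least_le)
      with ij show False by auto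
    qed
  qed auto
  moreover have "st ` {..k0} \<subseteq> {..<N}" unfolding st_def using foldl_less[of q0 N \<delta>] a by auto
  ultimately have "card {..k0} \<le> card {..<N}" by (metis card_inj_on_le finite_lessThan)
  then have "k0 < N" by simp
  with k0 show ?thesis by blast
qed

text \<open>Only letters \<open>H a\<close> with \<open>a \<in> S\<close> occur, so a finite table
  describes all transitions that are used and the run is a primitive recursion. As \<open>P\<close>
  is fixed, its automaton may be picked by choice.\<close>

lemma comp_pred_regular:
  assumes "regular P" "finite S" "comp_fn n" "comp_fn (\<lambda>z. g (pfst z) (psnd z))" "\<And>i x. g i x \<in> S"
  shows "comp_pred (\<lambda>x. P (map (\<lambda>i. H (g i x)) [0..<n x]))"
proof -
  from assms(1) obtain N where "recog N P" ..
  then obtain \<delta> q0 F where a: "q0 < N" "\<And>q b. q < N \<Longrightarrow> \<delta> q b < N" "\<And>u. P u \<longleftrightarrow> F (foldl \<delta> q0 u)"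
    unfolding recog_def by blast
  define \<delta>' where "\<delta>' = (\<lambda>y. if y \<in> prod_encode ` ({..<N} \<times> S) then \<delta> (pfst y) (H (psnd y)) else 0)"
  have \<delta>': "comp_fn \<delta>'" unfolding \<delta>'_def by (rule comp_fn_finite) (simp add: assms(2))
  have run: "rec_nat q0 (\<lambda>i q. \<delta>' (pair q (g i x))) m = foldl \<delta> q0 (map (\<lambda>i. H (g i x)) [0..<m])" for m x
  proof (induction m)
    case (Suc m)
    let ?q = "foldl \<delta> q0 (map (\<lambda>i. H (g i x)) [0..<m])"
    have "?q < N" using a by (intro foldl_less) auto
    with assms(5)[of m x] have "pair ?q (g m x) \<in> prod_encode ` ({..<N} \<times> S)" by blast
    with Suc show ?case by (simp add: \<delta>'_def)
  qed simp
  have "comp_fn (\<lambda>x. rec_nat q0 (\<lambda>i q. \<delta>' (pair q (g i x))) (n x))"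
    using comp_fn_compose[OF assms(4), of "\<lambda>z. pair (pfst z) (psnd (psnd z))"]
    by (intro comp assms comp_fn_compose[OF \<delta>']) (simp add: comp)
  from comp_pred_compose[OF comp_pred_finite[of "{q. q < N \<and> F q}"] this]
  have "comp_pred (\<lambda>x. foldl \<delta> q0 (map (\<lambda>i. H (g i x)) [0..<n x]) \<in> {q. q < N \<and> F q})"
    by (simp add: run)
  moreover have "(\<lambda>x. foldl \<delta> q0 (map (\<lambda>i. H (g i x)) [0..<n x]) \<in> {q. q < N \<and> F q}) =
    (\<lambda>x. P (map (\<lambda>i. H (g i x)) [0..<n x]))"
    using a foldl_less[of q0 N \<delta>] by auto
  ultimately show ?thesis by simp
qed

section \<open>Formulas over words of tuples of tracks\<close>

text \<open>A position of a word carries one value below \<open>c\<close> for each variable, so a variable denotes a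
  track of values. Both logics are instances: formulas are coded with tag \<open>n\<close> for negation, \<open>n + 1\<close>
  for conjunction, smaller tags for atoms and larger ones for quantifiers. \<open>GEx t x\<close> quantifies over
  the track with number \<open>8 * x + t\<close> relativised to the guard with code \<open>pair t x\<close>, so different kinds
  of variables use different tracks.\<close>

datatype gf = GAtom nat | GNeg gf | GConj gf gf | GEx nat nat gf

primrec gcode :: "nat \<Rightarrow> gf \<Rightarrow> nat" where
  "gcode n (GAtom a) = a"
| "gcode n (GNeg f) = pair n (gcode n f)"
| "gcode n (GConj f g) = pair (Suc n) (pair (gcode n f) (gcode n g))"
| "gcode n (GEx t x f) = pair t (pair x (gcode n f))"

primrec gwf :: "nat \<Rightarrow> gf \<Rightarrow> bool" where
  "gwf n (GAtom a) \<longleftrightarrow> pfst a < n"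
| "gwf n (GNeg f) \<longleftrightarrow> gwf n f"
| "gwf n (GConj f g) \<longleftrightarrow> gwf n f \<and> gwf n g"
| "gwf n (GEx t x f) \<longleftrightarrow> Suc n < t \<and> t < 8 \<and> gwf n f"

text \<open>The quantifier relates words letter by letter, the form that
  \<open>recog_projection\<close> handles. Its tag \<open>t\<close> exceeds those of the atoms, so
  guards and atoms share the function \<open>At\<close> without clashing.\<close>

primrec gsat :: "nat \<Rightarrow> (nat \<Rightarrow> (nat \<Rightarrow> nat) list \<Rightarrow> bool) \<Rightarrow> gf \<Rightarrow> (nat \<Rightarrow> nat) list \<Rightarrow> bool" where
  "gsat c At (GAtom a) u \<longleftrightarrow> At a u"
| "gsat c At (GNeg f) u \<longleftrightarrow> \<not> gsat c At f u"
| "gsat c At (GConj f g) u \<longleftrightarrow> gsat c At f u \<and> gsat c At g u"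
| "gsat c At (GEx t x f) u \<longleftrightarrow>
    (\<exists>u'. list_all2 (\<lambda>b b'. \<exists>d<c. b' = b(8 * x + t := d)) u u' \<and> At (pair t x) u' \<and> gsat c At f u')"

section \<open>Codes of subformulas and the number of states\<close>

lemma le_triangle: "m \<le> triangle m"
  by (induction m) auto

lemma prod_encode_ge: "a \<le> pair a b" "b \<le> pair a b"
  using le_triangle[of "a + b"] by (auto simp: prod_encode_def)

text \<open>A nonzero tag makes the code of a compound formula exceed those of its parts, on which
  both the state bound and the recursive evaluation rest. Hence \<open>0 < n\<close> for the tag of
  negation.\<close>

lemma prod_encode_greater: "0 < t \<Longrightarrow> r < pair t r"
  using le_triangle[of "t + r"] by (auto simp: prod_encode_def)

text \<open>One level pays for the most expensive step, a quantifier: conjunction with a guard of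
  \<open>M\<close> states followed by the subset construction.\<close>

primrec tower :: "nat \<Rightarrow> nat \<Rightarrow> nat" where
  "tower M 0 = M"
| "tower M (Suc n) = 2 ^ (M * tower M n)"

lemma comp_fn_tower [comp]: "comp_fn f \<Longrightarrow> comp_fn (\<lambda>x. tower M (f x))"
proof -
  assume "comp_fn f"
  then have "comp_fn (\<lambda>x. rec_nat M (\<lambda>i r. 2 ^ (M * r)) (f x))" by (intro comp)
  moreover have "rec_nat M (\<lambda>i r. 2 ^ (M * r)) n = tower M n" for n by (induction n) auto
  ultimately show ?thesis by simp
qed

lemma tower_mono: "1 \<le> M \<Longrightarrow> i \<le> j \<Longrightarrow> tower M i \<le> tower M j"
proof (rule lift_Suc_mono_le[of "tower M"])
  fix n assume "1 \<le> M"
  have "tower M n \<le> 2 ^ tower M n" by (simp add: less_imp_le)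
  also have "\<dots> \<le> 2 ^ (M * tower M n)" using \<open>1 \<le> M\<close> by (intro power_increasing) auto
  finally show "tower M n \<le> tower M (Suc n)" by simp
qed

lemma tower_square: "2 \<le> M \<Longrightarrow> tower M n * tower M n \<le> tower M (Suc n)"
proof -
  assume "2 \<le> M"
  have "tower M n * tower M n \<le> 2 ^ tower M n * 2 ^ tower M n"
    by (intro mult_le_mono) (simp_all add: less_imp_le)
  also have "\<dots> = 2 ^ (2 * tower M n)" by (simp add: mult_2 power_add)
  also have "\<dots> \<le> 2 ^ (M * tower M n)" using \<open>2 \<le> M\<close> by (intro power_increasing) auto
  finally show ?thesis by simp
qed

text \<open>The height of the tower is the code of the formula, not its quantifier depth: the code
  exceeds those of the subformulas and is what the decision procedure receives as input.\<close>

lemma recog_gsat: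
  assumes At: "\<And>a. recog M (At a)" and M: "2 \<le> M" and n: "0 < n"
  shows "gwf n f \<Longrightarrow> recog (tower M (gcode n f)) (gsat c At f)"
proof (induction f)
  case (GAtom a)
  have "M \<le> tower M a" using tower_mono[of M 0 a] M by simp
  with recog_mono[OF At] show ?case by simp
next
  case (GNeg f)
  have "tower M (gcode n f) \<le> tower M (gcode n (GNeg f))"
    using M prod_encode_ge(2)[of "gcode n f" n] by (intro tower_mono) auto
  from recog_mono[OF _ this] GNeg recog_not show ?case by auto
next
  case (GConj f g)
  let ?r = "pair (gcode n f) (gcode n g)"
  have "recog (tower M ?r) (gsat c At f)"
    using GConj.IH(1) GConj.prems M by (intro recog_mono[OF _ tower_mono[OF _ prod_encode_ge(1)]]) auto
  moreover have "recog (tower M ?r) (gsat c At g)"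
    using GConj.IH(2) GConj.prems M by (intro recog_mono[OF _ tower_mono[OF _ prod_encode_ge(2)]]) auto
  ultimately have "recog (tower M ?r * tower M ?r) (\<lambda>u. gsat c At f u \<and> gsat c At g u)"
    by (rule recog_conj)
  moreover have "tower M ?r * tower M ?r \<le> tower M (gcode n (GConj f g))"
    using tower_square[OF M, of ?r] tower_mono[of M "Suc ?r" "gcode n (GConj f g)"] M
      prod_encode_greater[of "Suc n" ?r] by simp
  ultimately show ?case using recog_mono by auto
next
  case (GEx t x f)
  let ?r = "gcode n f"
  have "recog (2 ^ (M * tower M ?r)) (gsat c At (GEx t x f))"
    using GEx unfolding gsat.simps by (intro recog_projection recog_conj At) auto
  moreover have "Suc ?r \<le> gcode n (GEx t x f)"
    using GEx.prems prod_encode_greater[of t "pair x ?r"] prod_encode_ge(2)[of ?r x] by simp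
  then have "tower M (Suc ?r) \<le> tower M (gcode n (GEx t x f))"
    using M by (intro tower_mono) auto
  ultimately show ?case unfolding tower.simps by (rule recog_mono)
qed

section \<open>Words coded by numbers and the evaluation of formulas\<close>

lemma div_mult_add_less: "r < (m::nat) \<Longrightarrow> (q * m + r) div m = q"
  using div_mult_self3[of m q r] by simp

text \<open>Track \<open>y\<close> occupies the \<open>k\<close> digits from \<open>y * k\<close>
  on, track after track rather than position after position. So a code below
  \<open>c ^ (k * N)\<close> leaves all tracks from \<open>N\<close> on zero, and a code below
  \<open>c ^ k\<close> fills track 0 alone.\<close>

definition word :: "nat \<Rightarrow> nat \<Rightarrow> nat \<Rightarrow> (nat \<Rightarrow> nat) list" where
  "word c k e = map (\<lambda>j y. digit c e (y * k + j)) [0..<k]"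

lemma length_word [simp]: "length (word c k e) = k"
  by (simp add: word_def)

lemma nth_word [simp]: "j < k \<Longrightarrow> word c k e ! j = (\<lambda>y. digit c e (y * k + j))"
  by (simp add: word_def)

lemma digit_word_zero:
  assumes "0 < c" "e < c ^ (k * N)" "N \<le> y"
  shows "digit c e (y * k + j) = 0"
proof (rule digit_zero)
  have "k * N \<le> y * k + j" using assms(3) by (metis mult.commute mult_le_mono1 trans_le_add1)
  then have "c ^ (k * N) \<le> c ^ (y * k + j)" using assms(1) by (intro power_increasing) auto
  with assms(2) show "e < c ^ (y * k + j)" by linarith
qed

lemma word_exists:
  assumes "0 < c" "\<And>j y. j < length u \<Longrightarrow> (u ! j) y < c" "\<And>j y. j < length u \<Longrightarrow> N \<le> y \<Longrightarrow> (u ! j) y = 0"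
  shows "\<exists>e<c ^ (length u * N). word c (length u) e = u"
proof -
  let ?k = "length u"
  have "\<exists>e<c ^ (?k * N). \<forall>i<?k * N. digit c e i = (u ! (i mod ?k)) (i div ?k)"
  proof (rule digits_exist)
    fix i assume "i < ?k * N"
    then have "?k > 0" by (cases ?k) auto
    then show "(u ! (i mod ?k)) (i div ?k) < c" by (intro assms(2)) simp
  qed (rule assms(1))
  then obtain e where e: "e < c ^ (?k * N)" "\<And>i. i < ?k * N \<Longrightarrow> digit c e i = (u ! (i mod ?k)) (i div ?k)"
    by blast
  have "digit c e (y * ?k + j) = (u ! j) y" if j: "j < ?k" for j y
  proof (cases "y < N")
    case True
    have "y * ?k + j < Suc y * ?k" using j by simp
    also have "\<dots> \<le> N * ?k" using True by (intro mult_le_mono1) simp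
    finally have "y * ?k + j < ?k * N" by (simp add: mult.commute)
    moreover have "(y * ?k + j) div ?k = y" using j by (simp add: div_mult_add_less)
    ultimately show ?thesis using j by (simp add: e(2))
  next
    case False
    then show ?thesis using digit_word_zero[OF assms(1) e(1)] assms(3) j by simp
  qed
  then have "word c ?k e = u" by (intro nth_equalityI) (auto simp: fun_eq_iff)
  with e(1) show ?thesis by blast
qed

text \<open>This turns the rewriting of a track into a bounded quantifier over codes. The bound is
  kept because \<open>x < N\<close>: no digit of a track from \<open>N\<close> on becomes
  nonzero.\<close>

lemma word_update:
  assumes "0 < c" "e < c ^ (k * N)" "x < N"
  shows "list_all2 (\<lambda>b b'. \<exists>d<c. b' = b(x := d)) (word c k e) u \<longleftrightarrow>
    (\<exists>e'<c ^ (k * N). (\<forall>y<N. \<forall>j<k. y \<noteq> x \<longrightarrow> digit c e (y * k + j) = digit c e' (y * k + j)) \<and> u = word c k e')"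
    (is "?L \<longleftrightarrow> ?R")
proof
  assume L: ?L
  then have len: "length u = k" by (auto dest: list_all2_lengthD)
  have u: "\<exists>d<c. u ! j = (\<lambda>y. digit c e (y * k + j))(x := d)" if "j < k" for j
    using list_all2_nthD[OF L, of j] that by simp
  have "\<exists>e'<c ^ (length u * N). word c (length u) e' = u"
  proof (rule word_exists[OF assms(1)])
    show "(u ! j) y < c" if "j < length u" for j y
      using u[of j] that digit_less[OF assms(1)] len by auto
    show "(u ! j) y = 0" if "j < length u" "N \<le> y" for j y
      using u[of j] that digit_word_zero[OF assms(1,2)] assms(3) len by auto
  qed
  then obtain e' where e': "e' < c ^ (k * N)" "u = word c k e'" using len by auto
  have "digit c e (y * k + j) = digit c e' (y * k + j)" if "j < k" "y \<noteq> x" for y j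
    using u[OF that(1)] that by (auto simp: e'(2) fun_eq_iff)
  with e' show ?R by blast
next
  assume ?R
  then obtain e' where e': "e' < c ^ (k * N)" "u = word c k e'"
    "\<And>y j. y < N \<Longrightarrow> j < k \<Longrightarrow> y \<noteq> x \<Longrightarrow> digit c e (y * k + j) = digit c e' (y * k + j)" by blast
  have "(\<lambda>y. digit c e' (y * k + j)) = (\<lambda>y. digit c e (y * k + j))(x := digit c e' (x * k + j))" if "j < k" for j
  proof
    fix y
    show "digit c e' (y * k + j) = ((\<lambda>y. digit c e (y * k + j))(x := digit c e' (x * k + j))) y"
      using e'(3)[of y j] digit_word_zero[OF assms(1,2)] digit_word_zero[OF assms(1) e'(1)] that
      by (cases "y < N") auto
  qed
  then show ?L
    using digit_less[OF assms(1)] unfolding e'(2) list_all2_conv_all_nth by auto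
qed

text \<open>With \<open>E = c ^ (k * N)\<close>, the argument \<open>f * E + e\<close> combines a
  formula code and a word code. All arguments with a smaller formula code come earlier, whatever the
  word, so course-of-values recursion knows the truth of a subformula also at the words that a
  quantifier runs through.\<close>

lemma comp_gsat:
  assumes c: "0 < c" and n: "0 < n"
    and At: "comp_pred (\<lambda>z. At (pfst z) (word c (pfst (psnd z)) (psnd (psnd z))))"
  obtains Ev where
    "comp_pred (\<lambda>z. Ev (pfst z) (psnd z))"
    "\<And>k N f e. gwf n f \<Longrightarrow> 8 * gcode n f + 8 \<le> N \<Longrightarrow> e < c ^ (k * N) \<Longrightarrow>
      Ev (pair k N) (gcode n f * c ^ (k * N) + e) \<longleftrightarrow> gsat c At f (word c k e)"
proof -
  have At': "comp_pred (\<lambda>x. At (a x) (word c (k x) (e x)))" if "comp_fn a" "comp_fn k" "comp_fn e" for a k e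
    using comp_pred_compose[OF At, of "\<lambda>x. pair (a x) (pair (k x) (e x))"] that by (simp add: comp)
  \<comment> \<open>The digits of \<open>R\<close> are the truth values found so far. The last
    branch is the quantifier, stated on codes as in \<open>word_update\<close>.\<close>
  define body where "body k N E f e R \<longleftrightarrow>
    (if pfst f < n then At f (word c k e)
     else if pfst f = n then \<not> digit 2 R (psnd f * E + e) = 1
     else if pfst f = Suc n then digit 2 R (pfst (psnd f) * E + e) = 1 \<and> digit 2 R (psnd (psnd f) * E + e) = 1
     else (\<exists>e'<E. (\<forall>y<N. \<forall>j<k. y \<noteq> 8 * pfst (psnd f) + pfst f \<longrightarrow>
              digit c e (y * k + j) = digit c e' (y * k + j)) \<and>
            At (pair (pfst f) (pfst (psnd f))) (word c k e') \<and> digit 2 R (psnd (psnd f) * E + e') = 1))"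
    for k N E f e R
  have body: "comp_pred (\<lambda>x. body (k x) (N x) (E x) (f x) (e x) (R x))"
    if that: "comp_fn k" "comp_fn N" "comp_fn E" "comp_fn f" "comp_fn e" "comp_fn R" for k N E f e R
  proof -
    have that': "comp_fn (\<lambda>x. k (g x))" "comp_fn (\<lambda>x. N (g x))" "comp_fn (\<lambda>x. E (g x))" "comp_fn (\<lambda>x. f (g x))"
      "comp_fn (\<lambda>x. e (g x))" "comp_fn (\<lambda>x. R (g x))" if "comp_fn g" for g
      using that by (auto intro: \<open>comp_fn k\<close> \<open>comp_fn N\<close> \<open>comp_fn E\<close> \<open>comp_fn f\<close> \<open>comp_fn e\<close> \<open>comp_fn R\<close>
          comp_fn_compose)
    show ?thesis
      unfolding body_def by (intro comp At' that that')
  qed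
  define rule where "rule x m R \<longleftrightarrow> body (pfst x) (psnd x) (c ^ (pfst x * psnd x))
    (m div c ^ (pfst x * psnd x)) (m mod c ^ (pfst x * psnd x)) R" for x m R
  have "comp_pred (\<lambda>z. rule (pfst z) (pfst (psnd z)) (psnd (psnd z)))"
    unfolding rule_def by (intro comp body)
  from course_of_values[OF this] obtain Ev where Ev: "comp_pred (\<lambda>z. Ev (pfst z) (psnd z))"
    "\<And>x m. \<exists>R. Ev x m = rule x m R \<and> (\<forall>i<m. digit 2 R i = 1 \<longleftrightarrow> Ev x i)" by blast
  \<comment> \<open>The recursion in terms of pairs: for \<open>g < f\<close> and
    \<open>e' < E\<close> the argument \<open>g * E + e'\<close> is below
    \<open>(g + 1) * E\<close>, hence already treated.\<close>
  have step: "\<exists>R. Ev (pair k N) (f * c ^ (k * N) + e) = body k N (c ^ (k * N)) f e R \<and>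
      (\<forall>g<f. \<forall>e'<c ^ (k * N). digit 2 R (g * c ^ (k * N) + e') = 1 \<longleftrightarrow> Ev (pair k N) (g * c ^ (k * N) + e'))"
    if e: "e < c ^ (k * N)" for k N f e
  proof -
    let ?E = "c ^ (k * N)"
    from Ev(2)[of "pair k N" "f * ?E + e"] obtain R where
      R: "Ev (pair k N) (f * ?E + e) = rule (pair k N) (f * ?E + e) R"
      "\<And>i. i < f * ?E + e \<Longrightarrow> digit 2 R i = 1 \<longleftrightarrow> Ev (pair k N) i" by blast
    have "digit 2 R (g * ?E + e') = 1 \<longleftrightarrow> Ev (pair k N) (g * ?E + e')" if "g < f" "e' < ?E" for g e'
    proof (rule R(2))
      have "g * ?E + e' < Suc g * ?E" using that(2) by simp
      also have "\<dots> \<le> f * ?E" using that(1) by (intro mult_le_mono1) simp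
      finally show "g * ?E + e' < f * ?E + e" by simp
    qed
    moreover have "(f * ?E + e) div ?E = f" "(f * ?E + e) mod ?E = e"
      using e by (simp_all add: div_mult_add_less)
    ultimately show ?thesis using R(1) unfolding rule_def prod_encode_inverse fst_conv snd_conv by metis
  qed
  have Ev_code: "Ev (pair k N) (gcode n f * c ^ (k * N) + e) \<longleftrightarrow> gsat c At f (word c k e)"
    if "gwf n f" "8 * gcode n f + 8 \<le> N" "e < c ^ (k * N)" for k N f e
    using that
  proof (induction f arbitrary: e)
    case (GAtom a)
    from step[OF GAtom(3)] obtain R where
      "Ev (pair k N) (a * c ^ (k * N) + e) = body k N (c ^ (k * N)) a e R" by blast
    with GAtom(1) show ?case by (simp add: body_def)
  next
    case (GNeg f)
    let ?c = "gcode n (GNeg f)"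
    from step[OF GNeg.prems(3), of ?c] obtain R where
      R: "Ev (pair k N) (?c * c ^ (k * N) + e) = body k N (c ^ (k * N)) ?c e R"
      "\<And>g e'. g < ?c \<Longrightarrow> e' < c ^ (k * N) \<Longrightarrow>
        digit 2 R (g * c ^ (k * N) + e') = 1 \<longleftrightarrow> Ev (pair k N) (g * c ^ (k * N) + e')" by blast
    have lt: "gcode n f < ?c" using prod_encode_greater[OF n] by simp
    then have "Ev (pair k N) (gcode n f * c ^ (k * N) + e) \<longleftrightarrow> gsat c At f (word c k e)"
      using GNeg.prems by (intro GNeg.IH) auto
    then show ?case unfolding R(1) using R(2)[OF lt GNeg.prems(3)] by (simp add: body_def)
  next
    case (GConj f g)
    let ?c = "gcode n (GConj f g)"
    from step[OF GConj.prems(3), of ?c] obtain R where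
      R: "Ev (pair k N) (?c * c ^ (k * N) + e) = body k N (c ^ (k * N)) ?c e R"
      "\<And>g e'. g < ?c \<Longrightarrow> e' < c ^ (k * N) \<Longrightarrow>
        digit 2 R (g * c ^ (k * N) + e') = 1 \<longleftrightarrow> Ev (pair k N) (g * c ^ (k * N) + e')" by blast
    have lt: "gcode n f < ?c" "gcode n g < ?c"
      using prod_encode_greater[of "Suc n" "pair (gcode n f) (gcode n g)"]
        prod_encode_ge[of "gcode n f" "gcode n g"] prod_encode_ge(2)[of "gcode n g" "gcode n f"]
      unfolding gcode.simps by linarith+
    then have "Ev (pair k N) (gcode n f * c ^ (k * N) + e) \<longleftrightarrow> gsat c At f (word c k e)"
      "Ev (pair k N) (gcode n g * c ^ (k * N) + e) \<longleftrightarrow> gsat c At g (word c k e)"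
      using GConj.prems GConj.IH[of e] by simp_all
    then show ?case
      unfolding R(1) using R(2)[OF lt(1) GConj.prems(3)] R(2)[OF lt(2) GConj.prems(3)] by (simp add: body_def)
  next
    case (GEx t x f)
    let ?c = "gcode n (GEx t x f)"
    from step[OF GEx.prems(3), of ?c] obtain R where
      R: "Ev (pair k N) (?c * c ^ (k * N) + e) = body k N (c ^ (k * N)) ?c e R"
      "\<And>g e'. g < ?c \<Longrightarrow> e' < c ^ (k * N) \<Longrightarrow>
        digit 2 R (g * c ^ (k * N) + e') = 1 \<longleftrightarrow> Ev (pair k N) (g * c ^ (k * N) + e')" by blast
    have lt: "gcode n f < ?c" "x < ?c"
      using GEx.prems(1) prod_encode_greater[of t "pair x (gcode n f)"] prod_encode_ge(1)[of x "gcode n f"]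
        prod_encode_ge(2)[of "gcode n f" x] by auto
    \<comment> \<open>Here the lower bound on \<open>N\<close> is used: \<open>x\<close> is below
      the code and \<open>t\<close> below 8.\<close>
    with GEx.prems have x: "8 * x + t < N" by auto
    have "Ev (pair k N) (gcode n f * c ^ (k * N) + e') \<longleftrightarrow> gsat c At f (word c k e')" if "e' < c ^ (k * N)" for e'
      using GEx.prems lt that by (intro GEx.IH) auto
    then have IH: "digit 2 R (gcode n f * c ^ (k * N) + e') = 1 \<longleftrightarrow> gsat c At f (word c k e')"
      if "e' < c ^ (k * N)" for e'
      using R(2)[OF lt(1) that] that by simp
    have "Ev (pair k N) (?c * c ^ (k * N) + e) \<longleftrightarrow>
      (\<exists>e'<c ^ (k * N). (\<forall>y<N. \<forall>j<k. y \<noteq> 8 * x + t \<longrightarrow> digit c e (y * k + j) = digit c e' (y * k + j)) \<and>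
            At (pair t x) (word c k e') \<and> gsat c At f (word c k e'))"
      unfolding R(1) using GEx.prems(1) IH by (auto simp: body_def)
    also have "\<dots> \<longleftrightarrow> gsat c At (GEx t x f) (word c k e)"
      unfolding gsat.simps word_update[OF c GEx.prems(3) x] by blast
    finally show ?case .
  qed
  from Ev(1) Ev_code show ?thesis by (rule that)
qed

section \<open>Languages of decision diagrams\<close>

text \<open>A run as a property of one word whose letters pair a layer with a symbol: the diagram is
  part of the input, not of the automaton. The conditions on \<open>snd\<close> say that the symbols
  form a padded nonempty string, and \<open>q i < w\<close> keeps the memory finite.\<close>

definition accepted :: "nat \<Rightarrow> ('c layer \<times> 'c option) list \<Rightarrow> bool" where
  "accepted w z \<longleftrightarrow> z \<noteq> [] \<and> snd (hd z) \<noteq> None \<and>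
    (\<forall>i. Suc i < length z \<longrightarrow> snd (z ! i) = None \<longrightarrow> snd (z ! Suc i) = None) \<and>
    (\<exists>p q. (\<forall>i<length z. q i < w \<and> (p i, snd (z ! i), q i) \<in> transitions (fst (z ! i))) \<and>
      (\<forall>i. Suc i < length z \<longrightarrow> p (Suc i) = q i) \<and>
      p 0 \<in> initial (fst (z ! 0)) \<and> q (length z - 1) \<in> final (fst (z ! (length z - 1))))"

lemma Ball_set_zip:
  "length xs = length ys \<Longrightarrow> (\<forall>x\<in>set (zip xs ys). P x) \<longleftrightarrow> (\<forall>i<length xs. P (xs ! i, ys ! i))"
  by (fastforce simp: set_zip)

text \<open>Projection along \<open>fst\<close>: the automaton guesses an additional track, with
  values of any type.\<close>

lemma regular_exists_track:
  assumes "regular P"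
  shows "regular (\<lambda>u. \<exists>t. length t = length u \<and> P (zip u t))"
proof -
  have *: "(\<exists>u'. list_all2 (\<lambda>b x. fst x = b) u u' \<and> P u') \<longleftrightarrow> (\<exists>t. length t = length u \<and> P (zip u t))" for u
  proof
    assume "\<exists>u'. list_all2 (\<lambda>b x. fst x = b) u u' \<and> P u'"
    then obtain u' where u': "list_all2 (\<lambda>b x. fst x = b) u u'" "P u'" by blast
    then have "u = map fst u'" by (intro nth_equalityI) (auto simp: list_all2_conv_all_nth)
    with u' show "\<exists>t. length t = length u \<and> P (zip u t)"
      by (intro exI[of _ "map snd u'"]) (simp add: zip_map_fst_snd)
  next
    assume "\<exists>t. length t = length u \<and> P (zip u t)"
    then obtain t where "length t = length u" "P (zip u t)" by blast
    then show "\<exists>u'. list_all2 (\<lambda>b x. fst x = b) u u' \<and> P u'"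
      by (intro exI[of _ "zip u t"]) (auto simp: list_all2_conv_all_nth)
  qed
  from regular_projection[OF assms, of "\<lambda>b x. fst x = b"] show ?thesis unfolding * .
qed

lemma regular_accepted: "regular (accepted w)"
proof -
  define P :: "(('a layer \<times> 'a option) \<times> nat \<times> nat) list \<Rightarrow> bool" where
    "P u \<longleftrightarrow> (\<forall>b\<in>set u. snd (snd b) < w \<and> (fst (snd b), snd (fst b), snd (snd b)) \<in> transitions (fst (fst b))) \<and>
      (\<forall>i. Suc i < length u \<longrightarrow> snd (snd (u ! i)) < w \<and> fst (snd (u ! Suc i)) = snd (snd (u ! i))) \<and>
      (u \<noteq> [] \<and> fst (snd (hd u)) \<in> initial (fst (fst (hd u)))) \<and>
      (u \<noteq> [] \<and> snd (snd (last u)) \<in> final (fst (fst (last u))))" for u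
  \<comment> \<open>Capping the state at \<open>w\<close> leaves finitely many values to remember; a
    value that was cut off violates \<open>m < w\<close>.\<close>
  have adj: "regular (\<lambda>u. \<forall>i. Suc i < length u \<longrightarrow> snd (snd (u ! i)) < w \<and> fst (snd (u ! Suc i)) = snd (snd (u ! i)))"
    by (rule regular_adjacent[where f = "\<lambda>b. min (snd (snd b)) w" and T = "\<lambda>m b. m < w \<and> fst (snd b) = m"])
      (auto intro: finite_subset[of _ "{..w}"])
  have "regular P"
    unfolding P_def
    by (rule regular_conj[OF regular_Ball regular_conj[OF adj regular_conj[OF regular_hd regular_last]]])
  then have run: "regular (\<lambda>z. \<exists>t. length t = length z \<and> P (zip z t))"
    by (rule regular_exists_track)
  have pad: "regular (\<lambda>z :: ('a layer \<times> 'a option) list. \<forall>i. Suc i < length z \<longrightarrow> snd (z ! i) = None \<longrightarrow> snd (z ! Suc i) = None)"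
    by (rule regular_adjacent[where f = "\<lambda>b. snd b = None" and T = "\<lambda>m b. m \<longrightarrow> snd b = None"]) auto
  have *: "accepted w z \<longleftrightarrow> (z \<noteq> [] \<and> snd (hd z) \<noteq> None) \<and>
    (\<forall>i. Suc i < length z \<longrightarrow> snd (z ! i) = None \<longrightarrow> snd (z ! Suc i) = None) \<and>
    (\<exists>t. length t = length z \<and> P (zip z t))" for z :: "('a layer \<times> 'a option) list"
  proof -
    have "(\<exists>t. length t = length z \<and> P (zip z t)) \<longleftrightarrow>
      (\<exists>p q. (\<forall>i<length z. q i < w \<and> (p i, snd (z ! i), q i) \<in> transitions (fst (z ! i))) \<and>
      (\<forall>i. Suc i < length z \<longrightarrow> p (Suc i) = q i) \<and>
      p 0 \<in> initial (fst (z ! 0)) \<and> q (length z - 1) \<in> final (fst (z ! (length z - 1))))" (is "?L \<longleftrightarrow> ?R")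
      if "z \<noteq> []"
    proof
      assume ?L
      then obtain t where t: "length t = length z" "P (zip z t)" by blast
      have nz: "zip z t \<noteq> []" using t(1) that by (cases z; cases t) auto
      have ne: "hd (zip z t) = (z ! 0, t ! 0)" "last (zip z t) = (z ! (length z - 1), t ! (length z - 1))"
        using t(1) that unfolding hd_conv_nth[OF nz] last_conv_nth[OF nz] by simp_all
      show ?R
      proof (intro exI conjI)
        show "\<forall>i<length z. snd (t ! i) < w \<and> (fst (t ! i), snd (z ! i), snd (t ! i)) \<in> transitions (fst (z ! i))"
          using t unfolding P_def by (simp add: Ball_set_zip)
        show "\<forall>i. Suc i < length z \<longrightarrow> fst (t ! Suc i) = snd (t ! i)"
          using t unfolding P_def by auto
        show "fst (t ! 0) \<in> initial (fst (z ! 0))" "snd (t ! (length z - 1)) \<in> final (fst (z ! (length z - 1)))"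
          using t unfolding P_def ne by simp_all
      qed
    next
      assume ?R
      then obtain p q where pq: "\<And>i. i < length z \<Longrightarrow> q i < w \<and> (p i, snd (z ! i), q i) \<in> transitions (fst (z ! i))"
        "\<And>i. Suc i < length z \<Longrightarrow> p (Suc i) = q i"
        "p 0 \<in> initial (fst (z ! 0))" "q (length z - 1) \<in> final (fst (z ! (length z - 1)))" by blast
      let ?t = "map (\<lambda>i. (p i, q i)) [0..<length z]"
      have ne: "zip z ?t \<noteq> []" using that by (cases z) (auto simp: upt_rec)
      have "P (zip z ?t)"
        unfolding P_def using pq that ne by (simp add: Ball_set_zip hd_conv_nth last_conv_nth)
      then show ?L by (intro exI[of _ ?t]) simp
    qed
    then show ?thesis unfolding accepted_def by blast
  qed
  have "regular (\<lambda>z :: ('a layer \<times> 'a option) list. accepted w z)"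
    unfolding * by (rule regular_conj[OF regular_hd regular_conj[OF pad run]])
  then show ?thesis by simp
qed

section \<open>Padded strings and tensor products as tracks\<close>

definition pads :: "nat \<Rightarrow> 'c list \<Rightarrow> 'c option list" where
  "pads k s = map (pad_nth s) [0..<k]"

lemma length_pads [simp]: "length (pads k s) = k"
  by (simp add: pads_def)

lemma nth_pads [simp]: "i < k \<Longrightarrow> pads k s ! i = pad_nth s i"
  by (simp add: pads_def)

lemma pads_inject:
  assumes "length s \<le> k" "length s' \<le> k" "\<And>j. j < k \<Longrightarrow> pad_nth s j = pad_nth s' j"
  shows "s = s'"
proof -
  have lt: "j < length s \<longleftrightarrow> j < length s'" for j
    using assms(3)[of j] assms(1,2) by (cases "j < k") (auto simp: pad_nth_def split: if_splits)
  have len: "length s = length s'" using lt[of "length s"] lt[of "length s'"] by linarith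
  show ?thesis
  proof (rule nth_equalityI[OF len])
    fix i assume "i < length s"
    with assms(3)[of i] assms(1) len show "s ! i = s' ! i" by (simp add: pad_nth_def)
  qed
qed

text \<open>The bound \<open>q i < w\<close> comes from the layers, whose transitions end in a
  subset of \<open>{..<w}\<close>; the shape of the padding comes from
  \<open>pad_nth\<close>.\<close>

lemma in_odd_lang_iff:
  assumes D: "D \<in> odds S w k" and "k \<ge> 1" and s: "s \<noteq> []" "length s \<le> k"
  shows "s \<in> odd_lang D \<longleftrightarrow> accepted w (zip D (pads k s))"
proof -
  have k: "length D = k" and lay: "\<And>i. i < k \<Longrightarrow> D ! i \<in> layers S w" using D by (auto simp: odds_def)
  then have ne: "zip D (pads k s) \<noteq> []" using \<open>k \<ge> 1\<close> by (metis One_nat_def Suc_le_lessD length_greater_0_conv length_pads length_zip min.idem)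
  have w: "q < w" if "(p, x, q) \<in> transitions (D ! i)" "i < k" for p x q i
    using lay[OF that(2)] that(1) unfolding layers_def by auto
  have "snd (hd (zip D (pads k s))) \<noteq> None"
    using ne s k \<open>k \<ge> 1\<close> by (simp add: hd_conv_nth pad_nth_def)
  moreover have "\<forall>i. Suc i < k \<longrightarrow> pad_nth s i = None \<longrightarrow> pad_nth s (Suc i) = None"
    by (auto simp: pad_nth_def)
  ultimately show ?thesis
    using ne s k \<open>k \<ge> 1\<close> w unfolding accepted_def odd_lang_def by (auto; metis)
qed

text \<open>Padding persists once it has begun, so the symbols before the first \<open>None\<close>
  form the string.\<close>

lemma accepted_pads:
  assumes "accepted w (zip D t)" "length D = k" "length t = k"
  obtains s where "s \<noteq> []" "length s \<le> k" "t = pads k s"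
proof -
  let ?tw = "takeWhile (\<lambda>x. x \<noteq> None) t"
  let ?s = "map the ?tw"
  from assms have t: "t \<noteq> []" "hd t \<noteq> None" "\<And>i. Suc i < k \<Longrightarrow> t ! i = None \<Longrightarrow> t ! Suc i = None"
    unfolding accepted_def by (auto simp: hd_zip hd_conv_nth)
  have low: "t ! j \<noteq> None" if "j < length ?tw" for j
    using set_takeWhileD[of "t ! j" "\<lambda>x. x \<noteq> None" t] that nth_mem[OF that] by (simp add: takeWhile_nth)
  have high: "t ! j = None" if "length ?tw \<le> j" "j < k" for j
    using that
  proof (induction j rule: dec_induct)
    case base
    then show ?case using nth_length_takeWhile[of "\<lambda>x. x \<noteq> None" t] assms by simp
  qed (use t in auto)
  have "?s \<noteq> []" using t by (cases t) auto
  moreover have le: "length ?s \<le> k" using length_takeWhile_le[of "\<lambda>x. x \<noteq> None" t] assms by simp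
  moreover have "t = pads k ?s"
  proof (rule nth_equalityI)
    fix j assume "j < length t"
    then show "t ! j = pads k ?s ! j"
      using low[of j] high[of j] assms(3) by (auto simp: pad_nth_def takeWhile_nth)
  qed (simp add: assms)
  ultimately show thesis by (rule that)
qed

text \<open>Where all components have ended, so has their tensor product: a tuple of nothing but
  padding stands for the padding symbol of the product, not for a letter of it.\<close>

definition collapse :: "'c option list \<Rightarrow> 'c option list option" where
  "collapse xs = (if \<forall>x\<in>set xs. x = None then None else Some xs)"

lemma length_tensor [simp]: "length (tensor us) = Max (length ` set us)"
  by (simp add: tensor_def)

lemma less_length_tensor: "us \<noteq> [] \<Longrightarrow> j < length (tensor us) \<longleftrightarrow> (\<exists>u\<in>set us. j < length u)"
  by (simp add: Max_gr_iff)

lemma pad_nth_tensor: "us \<noteq> [] \<Longrightarrow> pad_nth (tensor us) j = collapse (map (\<lambda>u. pad_nth u j) us)"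
  using less_length_tensor[of us j]
  by (auto simp: pad_nth_def[of "tensor us"] collapse_def tensor_def pad_nth_def[of _ j])

lemma tensor_bounds:
  assumes "us \<noteq> []" "\<And>u. u \<in> set us \<Longrightarrow> u \<noteq> [] \<and> length u \<le> k"
  shows "tensor us \<noteq> []" "length (tensor us) \<le> k"
proof -
  have "hd us \<in> set us" using assms(1) by simp
  then have "0 < length (tensor us)"
    using assms unfolding less_length_tensor[OF assms(1)] by blast
  then show "tensor us \<noteq> []" by blast
  show "length (tensor us) \<le> k" using assms by simp
qed

lemma tensor_in_odd_lang_iff:
  assumes "D \<in> odds S w k" "k \<ge> 1" "us \<noteq> []" "\<And>u. u \<in> set us \<Longrightarrow> u \<noteq> [] \<and> length u \<le> k"
  shows "tensor us \<in> odd_lang D \<longleftrightarrow>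
    accepted w (zip D (map (\<lambda>j. collapse (map (\<lambda>u. pad_nth u j) us)) [0..<k]))"
proof -
  have "pads k (tensor us) = map (\<lambda>j. collapse (map (\<lambda>u. pad_nth u j) us)) [0..<k]"
    by (simp add: pads_def pad_nth_tensor[OF assms(3)])
  with in_odd_lang_iff[OF assms(1,2) tensor_bounds[OF assms(3,4)]] show ?thesis by simp
qed

section \<open>Diagrams and structural tuples as regular languages\<close>

lemma odd_langD: "s \<in> odd_lang D \<Longrightarrow> s \<noteq> [] \<and> length s \<le> length D"
  by (simp add: odd_lang_def)

lemma odds_length: "D \<in> odds S w k \<Longrightarrow> length D = k"
  by (simp add: odds_def)

text \<open>Everything is a condition on single layers, on neighbours or on the two ends.
  Intersecting with \<open>{..<w}\<close> leaves finitely many right frontiers to remember and does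
  not change those of layers of width \<open>w\<close>.\<close>

lemma regular_odds: "regular (\<lambda>D. D \<noteq> [] \<and> D \<in> odds S w (length D))"
proof -
  have *: "(D \<noteq> [] \<and> D \<in> odds S w (length D)) \<longleftrightarrow>
    (\<forall>B\<in>set D. B \<in> layers S w) \<and>
    (\<forall>i. Suc i < length D \<longrightarrow> left (D ! Suc i) = right (D ! i) \<inter> {..<w}) \<and>
    (\<forall>i. Suc i < length D \<longrightarrow> \<not> is_last (D ! i) \<and> \<not> is_first (D ! Suc i)) \<and>
    (D \<noteq> [] \<and> is_first (hd D)) \<and> (D \<noteq> [] \<and> is_last (last D))" (is "?L \<longleftrightarrow> ?R") for D
  proof
    assume L: ?L
    have lay: "right (D ! i) \<inter> {..<w} = right (D ! i)" if "i < length D" for i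
    proof -
      have "D ! i \<in> layers S w" using L nth_mem[OF that] unfolding odds_def by blast
      then show ?thesis unfolding layers_def by blast
    qed
    with L show ?R
      unfolding odds_def by (auto simp: hd_conv_nth last_conv_nth)
  next
    assume R: ?R
    then have lay: "right (D ! i) \<inter> {..<w} = right (D ! i)" if "i < length D" for i
      using nth_mem[OF that] unfolding layers_def by blast
    have "is_first (D ! i) \<longleftrightarrow> i = 0" if "i < length D" for i
      using R that by (cases i) (auto simp: hd_conv_nth)
    moreover have "is_last (D ! i) \<longleftrightarrow> Suc i = length D" if "i < length D" for i
    proof (cases "Suc i = length D")
      case True
      then have "D ! i = last D" using R by (metis diff_Suc_1 last_conv_nth)
      with True R show ?thesis by simp
    qed (use R that in auto)
    ultimately show ?L using R lay unfolding odds_def by auto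
  qed
  have adj1: "regular (\<lambda>D. \<forall>i. Suc i < length D \<longrightarrow> left (D ! Suc i) = right (D ! i) \<inter> {..<w})"
    by (rule regular_adjacent[where f = "\<lambda>B. right B \<inter> {..<w}" and T = "\<lambda>A B. left B = A"])
      (auto intro: finite_subset[of _ "Pow {..<w}"])
  have adj2: "regular (\<lambda>D. \<forall>i. Suc i < length D \<longrightarrow> \<not> is_last (D ! i) \<and> \<not> is_first (D ! Suc i))"
    by (rule regular_adjacent[where f = is_last and T = "\<lambda>l B. \<not> l \<and> \<not> is_first B"]) auto
  show ?thesis
    unfolding *
    by (rule regular_conj[OF regular_Ball regular_conj[OF adj1 regular_conj[OF adj2 regular_conj[OF regular_hd regular_last]]]])
qed

text \<open>The inclusion of the \<open>i\<close>-th language in the \<open>a\<close>-th power of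
  the first one, as a formula over tracks: no track \<open>t\<close> accepted by the
  \<open>i\<close>-th diagram lacks a track \<open>T\<close> of \<open>a\<close>-tuples that
  collapses to it and has all components accepted by the first diagram. The negations make it a
  combination of complements and projections.\<close>

definition inclusion :: "nat \<Rightarrow> nat \<Rightarrow> nat \<Rightarrow> 'a layer_tuple list \<Rightarrow> bool" where
  "inclusion w i a u \<longleftrightarrow> \<not> (\<exists>t. length t = length u \<and>
    accepted w (map (\<lambda>x. (snd (fst x) ! i, snd x)) (zip u t)) \<and>
    \<not> (\<exists>T. length T = length (zip u t) \<and>
      (\<forall>x\<in>set (zip (zip u t) T). length (snd x) = a \<and> snd (fst x) = collapse (snd x)) \<and>
      (\<forall>l<a. accepted w (map (\<lambda>x. (fst (fst (fst x)), snd x ! l)) (zip (zip u t) T)))))"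

lemma regular_inclusion: "regular (inclusion w i a)"
proof -
  have "regular (\<lambda>y :: (('a layer_tuple \<times> 'a option list option) \<times> 'a option list) list.
    (\<forall>x\<in>set y. length (snd x) = a \<and> snd (fst x) = collapse (snd x)) \<and>
      (\<forall>l<a. accepted w (map (\<lambda>x. (fst (fst (fst x)), snd x ! l)) y)))"
    by (intro regular_conj[OF regular_Ball] regular_Ball_less regular_map regular_accepted)
  from regular_exists_track[OF this]
  have "regular (\<lambda>z :: ('a layer_tuple \<times> 'a option list option) list.
    accepted w (map (\<lambda>x. (snd (fst x) ! i, snd x)) z) \<and>
    \<not> (\<exists>T. length T = length z \<and>
      (\<forall>x\<in>set (zip z T). length (snd x) = a \<and> snd (fst x) = collapse (snd x)) \<and>
      (\<forall>l<a. accepted w (map (\<lambda>x. (fst (fst (fst x)), snd x ! l)) (zip z T)))))"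
    by (intro regular_conj regular_not regular_map regular_accepted)
  from regular_not[OF regular_exists_track[OF this]]
  have "regular (\<lambda>u :: 'a layer_tuple list. inclusion w i a u)" unfolding inclusion_def .
  then show ?thesis by simp
qed

definition diag :: "'a layer_tuple list \<Rightarrow> nat \<Rightarrow> 'a option list layer list" where
  "diag u i = map (\<lambda>B. snd B ! i) u"

lemma inclusion_iff:
  fixes u :: "'a layer_tuple list"
  assumes k: "length u = k" "k \<ge> 1" and D0: "map fst u \<in> odds \<Sigma> w k" and Di: "diag u i \<in> odds S w k" and a: "a \<ge> 1"
  shows "inclusion w i a u \<longleftrightarrow> odd_lang (diag u i) \<subseteq> lang_power (odd_lang (map fst u)) a"
proof -
  have m1: "map (\<lambda>x. (snd (fst x) ! i, snd x)) (zip u t) = zip (diag u i) t" if "length t = k" for t :: "'a option list option list"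
    using that k by (intro nth_equalityI) (auto simp: diag_def)
  have m2: "map (\<lambda>x. (fst (fst (fst x)), snd x ! l)) (zip (zip u t) T) = zip (map fst u) (map (\<lambda>os. os ! l) T)"
    if "length t = k" "length T = k" for t :: "'a option list option list" and T l
    using that k by (intro nth_equalityI) auto
  have len: "length (diag u i) = k" using Di by (rule odds_length)
  show ?thesis
  proof
    assume inc: "inclusion w i a u"
    show "odd_lang (diag u i) \<subseteq> lang_power (odd_lang (map fst u)) a"
    proof
      fix z assume z: "z \<in> odd_lang (diag u i)"
      with len have z': "z \<noteq> []" "length z \<le> k" by (auto dest: odd_langD)
      have "accepted w (zip (diag u i) (pads k z))"
        using in_odd_lang_iff[OF Di k(2) z'] z by simp
      with inc[unfolded inclusion_def] m1[of "pads k z"] k have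
        "\<exists>T. length T = k \<and>
          (\<forall>x\<in>set (zip (zip u (pads k z)) T). length (snd x) = a \<and> snd (fst x) = collapse (snd x)) \<and>
          (\<forall>l<a. accepted w (map (\<lambda>x. (fst (fst (fst x)), snd x ! l)) (zip (zip u (pads k z)) T)))"
        by auto
      then obtain T where T: "length T = k"
        "\<forall>x\<in>set (zip (zip u (pads k z)) T). length (snd x) = a \<and> snd (fst x) = collapse (snd x)"
        "\<forall>l<a. accepted w (map (\<lambda>x. (fst (fst (fst x)), snd x ! l)) (zip (zip u (pads k z)) T))"
        by blast
      have Tj: "length (T ! j) = a" "pad_nth z j = collapse (T ! j)" if "j < k" for j
        using T(2) T(1) k that by (simp_all add: Ball_set_zip)
      \<comment> \<open>Each component of the guessed tuples is accepted by the first diagram, hence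
        is the padding of one of its strings; these are the factors of the tensor product.\<close>
      have "\<exists>s. s \<in> odd_lang (map fst u) \<and> map (\<lambda>os. os ! l) T = pads k s" if "l < a" for l
      proof -
        have acc: "accepted w (zip (map fst u) (map (\<lambda>os. os ! l) T))"
          using T(1,3) that by (simp add: m2)
        then obtain s where s: "s \<noteq> []" "length s \<le> k" "map (\<lambda>os. os ! l) T = pads k s"
          using k T(1) by (elim accepted_pads[where k = k]) auto
        with acc in_odd_lang_iff[OF D0 k(2) s(1,2)] show ?thesis by auto
      qed
      then obtain s where s: "\<And>l. l < a \<Longrightarrow> s l \<in> odd_lang (map fst u)"
        "\<And>l. l < a \<Longrightarrow> map (\<lambda>os. os ! l) T = pads k (s l)" by metis
      let ?us = "map s [0..<a]"
      have ne: "?us \<noteq> []" using a by simp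
      have us: "x \<noteq> [] \<and> length x \<le> k" if "x \<in> set ?us" for x
        using that s(1) odd_langD[of _ "map fst u"] k by force
      \<comment> \<open>Both strings have length at most \<open>k\<close>, so comparing their
        paddings to length \<open>k\<close> suffices.\<close>
      have "tensor ?us = z"
      proof (rule pads_inject[OF tensor_bounds(2)[OF ne us] z'(2)])
        fix j assume j: "j < k"
        have "T ! j ! l = pad_nth (s l) j" if "l < a" for l
          using arg_cong[OF s(2)[OF that], of "\<lambda>t. t ! j"] j T(1) by simp
        then have "map (\<lambda>v. pad_nth v j) ?us = T ! j"
          using Tj(1)[OF j] by (intro nth_equalityI) auto
        then show "pad_nth (tensor ?us) j = pad_nth z j"
          using Tj(2)[OF j] by (simp only: pad_nth_tensor[OF ne])
      qed
      then show "z \<in> lang_power (odd_lang (map fst u)) a"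
        unfolding lang_power_def using s(1) by (intro CollectI exI[of _ ?us]) auto
    qed
  next
    assume sub: "odd_lang (diag u i) \<subseteq> lang_power (odd_lang (map fst u)) a"
    show "inclusion w i a u"
      unfolding inclusion_def
    proof (intro notI, elim exE conjE)
      fix t :: "'a option list option list"
      assume t: "length t = length u" "accepted w (map (\<lambda>x. (snd (fst x) ! i, snd x)) (zip u t))"
        and no: "\<nexists>T. length T = length (zip u t) \<and>
          (\<forall>x\<in>set (zip (zip u t) T). length (snd x) = a \<and> snd (fst x) = collapse (snd x)) \<and>
          (\<forall>l<a. accepted w (map (\<lambda>x. (fst (fst (fst x)), snd x ! l)) (zip (zip u t) T)))"
      from t k have tk: "length t = k" and acc: "accepted w (zip (diag u i) t)" by (auto simp: m1)
      from accepted_pads[OF acc len tk] obtain z where z: "z \<noteq> []" "length z \<le> k" "t = pads k z" by blast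
      with acc in_odd_lang_iff[OF Di k(2) z(1,2)] sub have "z \<in> lang_power (odd_lang (map fst u)) a" by auto
      then obtain us where us: "z = tensor us" "length us = a" "set us \<subseteq> odd_lang (map fst u)"
        unfolding lang_power_def by blast
      then have ne: "us \<noteq> []" using a by auto
      let ?T = "map (\<lambda>j. map (\<lambda>v. pad_nth v j) us) [0..<k]"
      have "\<forall>x\<in>set (zip (zip u t) ?T). length (snd x) = a \<and> snd (fst x) = collapse (snd x)"
        using us(2) k tk by (simp add: Ball_set_zip z(3) us(1) pad_nth_tensor[OF ne])
      moreover have "accepted w (map (\<lambda>x. (fst (fst (fst x)), snd x ! l)) (zip (zip u t) ?T))" if "l < a" for l
      proof -
        have mem: "us ! l \<in> odd_lang (map fst u)" using us that by auto
        then have ul: "us ! l \<noteq> []" "length (us ! l) \<le> k" using k by (auto dest: odd_langD)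
        have "map (\<lambda>os. os ! l) ?T = pads k (us ! l)"
          using that us(2) by (intro nth_equalityI) auto
        then show ?thesis
          using in_odd_lang_iff[OF D0 k(2) ul] mem tk by (simp only: m2 length_map length_upt diff_zero)
      qed
      ultimately show False using no tk k by (auto dest!: spec[of _ ?T])
    qed
  qed
qed

definition struct_lang :: "bool \<Rightarrow> 'a set \<Rightarrow> nat \<Rightarrow> nat list \<Rightarrow> 'a layer_tuple list \<Rightarrow> bool" where
  "struct_lang padded \<Sigma> w \<tau> u \<longleftrightarrow> set u \<subseteq> layer_tuples padded \<Sigma> w \<tau> \<and>
    structural padded \<Sigma> w \<tau> (map fst u) (map (diag u) [0..<length \<tau>])"

lemma struct_langD:
  assumes "struct_lang padded \<Sigma> w \<tau> u"
  shows "length u \<ge> 1" "map fst u \<in> odds \<Sigma> w (length u)"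
    "i < length \<tau> \<Longrightarrow> diag u i \<in> odds (alphabet_power padded \<Sigma> (\<tau> ! i)) w (length u)"
    "set u \<subseteq> layer_tuples padded \<Sigma> w \<tau>"
proof -
  from assms obtain k where k: "k \<ge> 1" "map fst u \<in> odds \<Sigma> w k"
    "\<And>i. i < length \<tau> \<Longrightarrow> diag u i \<in> odds (alphabet_power padded \<Sigma> (\<tau> ! i)) w k"
    unfolding struct_lang_def structural_def by auto
  from odds_length[OF k(2)] have "length u = k" by simp
  with k show "length u \<ge> 1" "map fst u \<in> odds \<Sigma> w (length u)"
    "i < length \<tau> \<Longrightarrow> diag u i \<in> odds (alphabet_power padded \<Sigma> (\<tau> ! i)) w (length u)" by auto
  show "set u \<subseteq> layer_tuples padded \<Sigma> w \<tau>" using assms unfolding struct_lang_def by blast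
qed

text \<open>Positive arities enter through \<open>inclusion_iff\<close>: the length of a tensor
  product is a maximum over its factors, so there must be at least one.\<close>

lemma regular_struct_lang:
  assumes "\<forall>a\<in>set \<tau>. a \<ge> 1"
  shows "regular (struct_lang padded \<Sigma> w \<tau>)"
proof -
  have *: "struct_lang padded \<Sigma> w \<tau> u \<longleftrightarrow> (\<forall>b\<in>set u. b \<in> layer_tuples padded \<Sigma> w \<tau>) \<and>
    (map fst u \<noteq> [] \<and> map fst u \<in> odds \<Sigma> w (length (map fst u))) \<and>
    (\<forall>i<length \<tau>. (map (\<lambda>B. snd B ! i) u \<noteq> [] \<and>
        map (\<lambda>B. snd B ! i) u \<in> odds (alphabet_power padded \<Sigma> (\<tau> ! i)) w (length (map (\<lambda>B. snd B ! i) u))) \<and>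
      inclusion w i (\<tau> ! i) u)" (is "?L \<longleftrightarrow> ?R") for u
  proof
    assume L: ?L
    note D = struct_langD[OF L]
    have "u \<noteq> []" using D(1) by auto
    moreover have "inclusion w i (\<tau> ! i) u" if "i < length \<tau>" for i
      using L inclusion_iff[OF refl D(1,2) D(3)[OF that]] assms that
      unfolding struct_lang_def structural_def by auto
    ultimately show ?R using D unfolding diag_def by auto
  next
    assume R: ?R
    then have k: "length u \<ge> 1" by (cases u) auto
    have "odd_lang (diag u i) \<subseteq> lang_power (odd_lang (map fst u)) (\<tau> ! i)" if "i < length \<tau>" for i
      using R k that inclusion_iff[of u "length u" \<Sigma> w i "alphabet_power padded \<Sigma> (\<tau> ! i)" "\<tau> ! i"] assms
      unfolding diag_def by auto
    then show ?L using R k unfolding struct_lang_def structural_def diag_def by auto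
  qed
  have "regular (\<lambda>u. struct_lang padded \<Sigma> w \<tau> u)"
    unfolding * by (intro regular_conj[OF regular_Ball] regular_conj[OF regular_map[OF regular_odds]]
        regular_Ball_less regular_inclusion)
  then show ?thesis by simp
qed

lemma odd_tensor_inverse:
  assumes "structural padded \<Sigma> w \<tau> D0 Ds"
  shows "map fst (odd_tensor D0 Ds) = D0" "map (diag (odd_tensor D0 Ds)) [0..<length \<tau>] = Ds"
    "struct_lang padded \<Sigma> w \<tau> (odd_tensor D0 Ds)"
proof -
  from assms obtain k where k: "length Ds = length \<tau>" "D0 \<in> odds \<Sigma> w k"
    "\<And>i. i < length \<tau> \<Longrightarrow> Ds ! i \<in> odds (alphabet_power padded \<Sigma> (\<tau> ! i)) w k"
    unfolding structural_def by blast
  note len = odds_length[OF k(2)] odds_length[OF k(3)]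
  show 1: "map fst (odd_tensor D0 Ds) = D0"
    by (intro nth_equalityI) (auto simp: odd_tensor_def)
  have "diag (odd_tensor D0 Ds) i = Ds ! i" if "i < length \<tau>" for i
    using that len k(1) by (intro nth_equalityI) (auto simp: odd_tensor_def diag_def)
  then show 2: "map (diag (odd_tensor D0 Ds)) [0..<length \<tau>] = Ds"
    using k(1) by (intro nth_equalityI) auto
  have "b \<in> layer_tuples padded \<Sigma> w \<tau>" if b: "b \<in> set (odd_tensor D0 Ds)" for b
  proof -
    from b obtain j where j: "j < k" "b = (D0 ! j, map (\<lambda>D. D ! j) Ds)" using len by (auto simp: odd_tensor_def)
    have "D0 ! j \<in> layers \<Sigma> w" using j k(2) unfolding odds_def by auto
    moreover have "Ds ! i ! j \<in> layers (alphabet_power padded \<Sigma> (\<tau> ! i)) w" if "i < length \<tau>" for i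
      using j k(3)[OF that] unfolding odds_def by auto
    ultimately show ?thesis using k(1) by (auto simp: layer_tuples_def j(2))
  qed
  with 1 2 assms show "struct_lang padded \<Sigma> w \<tau> (odd_tensor D0 Ds)" unfolding struct_lang_def by auto
qed

lemma odd_tensor_diag:
  assumes "struct_lang padded \<Sigma> w \<tau> u"
  shows "odd_tensor (map fst u) (map (diag u) [0..<length \<tau>]) = u"
proof (rule nth_equalityI)
  fix j assume "j < length (odd_tensor (map fst u) (map (diag u) [0..<length \<tau>]))"
  then have j: "j < length u" by (simp add: odd_tensor_def)
  have "u ! j \<in> layer_tuples padded \<Sigma> w \<tau>" using assms j unfolding struct_lang_def by auto
  then have "length (snd (u ! j)) = length \<tau>" unfolding layer_tuples_def by auto
  then have "map (\<lambda>D. D ! j) (map (diag u) [0..<length \<tau>]) = snd (u ! j)"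
    using j by (intro nth_equalityI) (auto simp: diag_def)
  then show "odd_tensor (map fst u) (map (diag u) [0..<length \<tau>]) ! j = u ! j"
    using j by (simp add: odd_tensor_def del: map_map)
qed (simp add: odd_tensor_def)

section \<open>Finiteness of the alphabet of layer tuples\<close>

lemma finite_layers:
  fixes S :: "'c set"
  assumes "finite S"
  shows "finite (layers S w)"
proof -
  let ?mk = "\<lambda>(l, r, t, i, f, a, b). \<lparr>left = l, right = r, transitions = t, initial = i, final = f,
    is_first = a, is_last = b\<rparr> :: 'c layer"
  let ?A = "Pow {..<w}"
  have "layers S w \<subseteq> ?mk ` (?A \<times> ?A \<times> Pow ({..<w} \<times> insert None (Some ` S) \<times> {..<w}) \<times> ?A \<times> ?A \<times> UNIV \<times> UNIV)"
  proof
    fix B :: "'c layer" assume B: "B \<in> layers S w"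
    have "transitions B \<subseteq> {..<w} \<times> insert None (Some ` S) \<times> {..<w}"
    proof
      fix x assume "x \<in> transitions B"
      with B have "x \<in> left B \<times> insert None (Some ` S) \<times> right B" "left B \<subseteq> {..<w}" "right B \<subseteq> {..<w}"
        unfolding layers_def by blast+
      then show "x \<in> {..<w} \<times> insert None (Some ` S) \<times> {..<w}" by blast
    qed
    moreover have "left B \<in> ?A" "right B \<in> ?A" "initial B \<in> ?A" "final B \<in> ?A"
      using B unfolding layers_def by blast+
    moreover have "B = ?mk (left B, right B, transitions B, initial B, final B, is_first B, is_last B)" by simp
    ultimately show "B \<in> ?mk ` (?A \<times> ?A \<times> Pow ({..<w} \<times> insert None (Some ` S) \<times> {..<w}) \<times> ?A \<times> ?A \<times> UNIV \<times> UNIV)"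
      by blast
  qed
  then show ?thesis by (rule finite_subset) (use assms in simp)
qed

lemma finite_layer_tuples:
  assumes "finite \<Sigma>"
  shows "finite (layer_tuples padded \<Sigma> w \<tau>)"
proof -
  let ?A = "\<Union>i<length \<tau>. layers (alphabet_power padded \<Sigma> (\<tau> ! i)) w"
  have "finite (alphabet_power padded \<Sigma> a)" for a
    unfolding alphabet_power_def
    by (rule finite_subset[OF _ finite_lists_length_eq[of "insert None (Some ` \<Sigma>)" a]]) (use assms in auto)
  then have "finite ?A" by (auto intro: finite_layers)
  then have "finite (layers \<Sigma> w \<times> {Bs. set Bs \<subseteq> ?A \<and> length Bs = length \<tau>})"
    by (intro finite_cartesian_product finite_layers assms finite_lists_length_eq)
  moreover have "set Bs \<subseteq> ?A" if "length Bs = length \<tau>"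
    "\<forall>i<length \<tau>. Bs ! i \<in> layers (alphabet_power padded \<Sigma> (\<tau> ! i)) w" for Bs
  proof
    fix B assume "B \<in> set Bs"
    then obtain i where "i < length Bs" "B = Bs ! i" by (metis in_set_conv_nth)
    with that show "B \<in> ?A" by auto
  qed
  then have "layer_tuples padded \<Sigma> w \<tau> \<subseteq> layers \<Sigma> w \<times> {Bs. set Bs \<subseteq> ?A \<and> length Bs = length \<tau>}"
    unfolding layer_tuples_def by blast
  ultimately show ?thesis by (rule finite_subset[rotated])
qed

section \<open>Reduction of the two logics to tracks\<close>

lemma recog_exists_less:
  "recog 3 (\<lambda>u. \<exists>j<length u. (\<exists>i<j. C (u ! i)) \<and> C' (u ! j))"
proof (rule recogI)
  show "(\<exists>j<length u. (\<exists>i<j. C (u ! i)) \<and> C' (u ! j)) \<longleftrightarrow>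
    foldl (\<lambda>q b. if q = 0 then if C b then 1 else 0 else if q = 1 then if C' b then 2 else 1 else 2) 0 u = (2::nat)" for u
  proof -
    \<comment> \<open>State 1 records that some letter satisfied \<open>C\<close>, state 2 that a
      later one satisfied \<open>C'\<close>. A single letter advances by one state at most, which
      makes the order strict.\<close>
    have "foldl (\<lambda>q b. if q = 0 then if C b then 1 else 0 else if q = 1 then if C' b then 2 else 1 else 2) 0 u =
      (if \<exists>j<length u. (\<exists>i<j. C (u ! i)) \<and> C' (u ! j) then 2 else if \<exists>i<length u. C (u ! i) then 1 else (0::nat))"
    proof (induction u rule: rev_induct)
      case (snoc b u)
      have 1: "(\<exists>i<length (u @ [b]). C ((u @ [b]) ! i)) \<longleftrightarrow> (\<exists>i<length u. C (u ! i)) \<or> C b"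
        by (auto simp: nth_append Ex_less_Suc)
      have "(\<exists>i<j. C ((u @ [b]) ! i)) \<longleftrightarrow> (\<exists>i<j. C (u ! i))" if "j \<le> length u" for j
        using that by (metis nth_append order_less_le_trans)
      then have 2: "(\<exists>j<length (u @ [b]). (\<exists>i<j. C ((u @ [b]) ! i)) \<and> C' ((u @ [b]) ! j)) \<longleftrightarrow>
        (\<exists>j<length u. (\<exists>i<j. C (u ! i)) \<and> C' (u ! j)) \<or> (\<exists>i<length u. C (u ! i)) \<and> C' b"
        by (simp add: Ex_less_Suc nth_append cong: conj_cong) blast
      have 3: "\<exists>i<length u. C (u ! i)" if "\<exists>j<length u. (\<exists>i<j. C (u ! i)) \<and> C' (u ! j)"
        using that by (blast intro: order_less_trans)
      show ?case unfolding 1 2 foldl_append snoc using 3 by simp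
    qed simp
    then show ?thesis by simp
  qed
qed auto

lemma recog_if: "recog N P \<Longrightarrow> recog N Q \<Longrightarrow> recog N (\<lambda>u. if c then P u else Q u)"
  by (cases c) simp_all

lemma recog_exists_nth: "recog 2 (\<lambda>u. \<exists>i<length u. C (u ! i))"
  using recog_Bex[of C] by (simp add: list_ex_length flip: list_ex_iff)

lemma recog_all_nth: "recog 2 (\<lambda>u. \<forall>i<length u. C (u ! i))"
  using recog_Ball[of C] by (simp add: all_set_conv_all_nth)

lemma comp_fn_list_encode:
  "(\<And>f. f \<in> set fs \<Longrightarrow> comp_fn f) \<Longrightarrow> comp_fn (\<lambda>x. list_encode (map (\<lambda>f. f x) fs))"
  by (induction fs) (auto intro!: comp)

text \<open>The tracks to be read vary with the instance, the automaton does not: its input letter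
  depends only on the values on the selected tracks, a list of fixed length with entries below
  \<open>c\<close>.\<close>

lemma comp_pred_word_lang:
  assumes "regular P" "0 < c" "comp_fn k" "comp_fn e" "\<And>y. y \<in> set ys \<Longrightarrow> comp_fn y"
  shows "comp_pred (\<lambda>x. P (map (\<lambda>b. H (map (\<lambda>y. b (y x)) ys)) (word c (k x) (e x))))"
proof -
  let ?S = "list_encode ` {vs. set vs \<subseteq> {..<c} \<and> length vs = length ys}"
  let ?g = "\<lambda>i x. list_encode (map (\<lambda>y. digit c (e x) (y x * k x + i)) ys)"
  have "comp_pred (\<lambda>x. P (map (\<lambda>i. H (list_decode (?g i x))) [0..<k x]))"
  proof (rule comp_pred_regular[OF assms(1) _ assms(3), where g = ?g and S = ?S])
    show "finite ?S" by (intro finite_imageI finite_lists_length_eq) simp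
    show "?g i x \<in> ?S" for i x using digit_less[OF assms(2)] by (intro imageI) auto
    have "comp_fn (\<lambda>z. list_encode (map (\<lambda>f. f z) (map (\<lambda>y z. digit c (e (psnd z)) (y (psnd z) * k (psnd z) + pfst z)) ys)))"
    proof (rule comp_fn_list_encode)
      fix f assume "f \<in> set (map (\<lambda>y z. digit c (e (psnd z)) (y (psnd z) * k (psnd z) + pfst z)) ys)"
      then obtain y where y: "y \<in> set ys" "f = (\<lambda>z. digit c (e (psnd z)) (y (psnd z) * k (psnd z) + pfst z))" by auto
      have p: "comp_fn psnd" by (intro comp)
      note compose = comp_fn_compose[OF assms(3) p] comp_fn_compose[OF assms(4) p] comp_fn_compose[OF assms(5)[OF y(1)] p]
      show "comp_fn f" unfolding y(2) by (intro comp compose)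
    qed
    then show "comp_fn (\<lambda>z. ?g (pfst z) (psnd z))" by (simp add: comp_def)
  qed
  then show ?thesis by (simp add: word_def comp_def)
qed

text \<open>Used for relation symbols: the arity determines how many tracks are read, so each symbol
  has its own predicate.\<close>

lemma comp_pred_cases_less:
  fixes n :: nat
  shows "comp_fn f \<Longrightarrow> (\<And>i. i < n \<Longrightarrow> comp_pred (P i)) \<Longrightarrow> comp_pred (\<lambda>x. f x < n \<and> P (f x) x)"
proof (induction n)
  case (Suc n)
  have "comp_pred (\<lambda>x. f x < n \<and> P (f x) x)" using Suc by simp
  moreover have "comp_pred (\<lambda>x. f x = n \<and> P n x)"
    using Suc.prems(2)[of n] by (intro comp_pred_conj comp_pred_eq comp Suc.prems(1)) auto
  ultimately have "comp_pred (\<lambda>x. (f x < n \<and> P (f x) x) \<or> (f x = n \<and> P n x))" by (intro comp_pred_disj)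
  moreover have "(\<lambda>x. (f x < n \<and> P (f x) x) \<or> (f x = n \<and> P n x)) = (\<lambda>x. f x < Suc n \<and> P (f x) x)"
    by (auto simp: less_Suc_eq)
  ultimately show ?case by simp
qed (simp add: comp)

text \<open>\<open>list_encode\<close> maps a nonempty list to the successor of a pair, hence the
  subtraction of 1. The index is a constant, bounded by an arity of the fixed vocabulary.\<close>

fun code_nth :: "nat \<Rightarrow> nat \<Rightarrow> nat" where
  "code_nth l 0 = pfst (l - 1)"
| "code_nth l (Suc m) = code_nth (psnd (l - 1)) m"

lemma code_nth_list_encode: "m < length xs \<Longrightarrow> code_nth (list_encode xs) m = xs ! m"
  by (induction xs arbitrary: m) (auto simp: less_Suc_eq_0_disj)

lemma comp_fn_code_nth [comp]: "comp_fn f \<Longrightarrow> comp_fn (\<lambda>x. code_nth (f x) m)"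
proof (induction m arbitrary: f)
  case 0
  then show ?case by (simp only: code_nth.simps) (intro comp)
next
  case (Suc m)
  then show ?case by (simp only: code_nth.simps) (intro comp Suc.IH)
qed

lemma track_eq_iff: "t < 8 \<Longrightarrow> t' < 8 \<Longrightarrow> 8 * x + t = 8 * y + t' \<longleftrightarrow> x = y \<and> t = (t' :: nat)"
  by presburger

text \<open>The tags are those of \<open>mso_code\<close>, with 4 for negation, so the code of the
  track formula is the code given as input. Positions live on tracks \<open>8 * x + 6\<close>, sets
  on tracks \<open>8 * X + 7\<close>.\<close>

primrec mso_gf :: "('b \<Rightarrow> nat) \<Rightarrow> 'b mso \<Rightarrow> gf" where
  "mso_gf enc (MLess x y) = GAtom (pair 0 (pair x y))"
| "mso_gf enc (MEq x y) = GAtom (pair 1 (pair x y))"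
| "mso_gf enc (MLetter b x) = GAtom (pair 2 (pair (enc b) x))"
| "mso_gf enc (MMem x X) = GAtom (pair 3 (pair x X))"
| "mso_gf enc (MNeg \<psi>) = GNeg (mso_gf enc \<psi>)"
| "mso_gf enc (MConj \<psi> \<chi>) = GConj (mso_gf enc \<psi>) (mso_gf enc \<chi>)"
| "mso_gf enc (MEx1 x \<psi>) = GEx 6 x (mso_gf enc \<psi>)"
| "mso_gf enc (MEx2 X \<psi>) = GEx 7 X (mso_gf enc \<psi>)"

lemma gcode_mso_gf: "gcode 4 (mso_gf enc \<psi>) = mso_code enc \<psi>"
  by (induction \<psi>) auto

lemma gwf_mso_gf: "gwf 4 (mso_gf enc \<psi>)"
  by (induction \<psi>) auto

text \<open>Here 2 is the tag of negation, and elements live on tracks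
  \<open>8 * x + 4\<close>.\<close>

primrec fo_gf :: "fo \<Rightarrow> gf" where
  "fo_gf (FRel i xs) = GAtom (pair 0 (pair i (list_encode xs)))"
| "fo_gf (FEq x y) = GAtom (pair 1 (pair x y))"
| "fo_gf (FNeg \<phi>) = GNeg (fo_gf \<phi>)"
| "fo_gf (FConj \<phi> \<chi>) = GConj (fo_gf \<phi>) (fo_gf \<chi>)"
| "fo_gf (FEx x \<phi>) = GEx 4 x (fo_gf \<phi>)"

lemma gcode_fo_gf: "gcode 2 (fo_gf \<phi>) = fo_code \<phi>"
  by (induction \<phi>) (auto simp: numeral_3_eq_3 numeral_2_eq_2)

lemma gwf_fo_gf: "gwf 2 (fo_gf \<phi>)"
  by (induction \<phi>) auto

text \<open>Track 0 holds the string of layer tuples, the letter with number \<open>i < g\<close> being \<open>lett i\<close>. A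
  position is a track with a single nonzero value, a set of positions is the set of nonzero values of a
  track, and an element of the derived structure is a track of symbols \<open>sym i\<close> with \<open>i < h\<close>.\<close>

locale tracks =
  fixes padded :: bool and \<Sigma> :: "'a set" and w :: nat and \<tau> :: "nat list"
    and enc :: "'a layer_tuple \<Rightarrow> nat"
    and lett :: "nat \<Rightarrow> 'a layer_tuple" and g :: nat and sym :: "nat \<Rightarrow> 'a option" and h c :: nat
  assumes arity: "\<forall>a\<in>set \<tau>. a \<ge> 1"
    and lett: "bij_betw lett {..<g} (layer_tuples padded \<Sigma> w \<tau>)"
    and sym: "bij_betw sym {..<h} (insert None (Some ` \<Sigma>))"
    and inj_enc: "inj_on enc (layer_tuples padded \<Sigma> w \<tau>)"
    and c: "2 \<le> c" "g \<le> c" "h \<le> c"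
begin

text \<open>The coding \<open>enc\<close> is arbitrary; as a table over the \<open>g\<close> letter
  numbers it is computable.\<close>

definition letter_code :: "nat \<Rightarrow> nat" where
  "letter_code i = (if i \<in> {..<g} then enc (lett i) else 0)"

text \<open>Tag 6 is the guard of first-order variables, exactly one nonzero value; tag 7, the guard
  of set variables, falls under \<open>True\<close>.\<close>

definition mso_atom :: "nat \<Rightarrow> (nat \<Rightarrow> nat) list \<Rightarrow> bool" where
  "mso_atom a u \<longleftrightarrow>
    (if pfst a = 0 then \<exists>j<length u.
        (\<exists>i<j. (u ! i) (8 * pfst (psnd a) + 6) \<noteq> 0) \<and> (u ! j) (8 * psnd (psnd a) + 6) \<noteq> 0
     else if pfst a = 1 then \<exists>i<length u. (u ! i) (8 * pfst (psnd a) + 6) \<noteq> 0 \<and> (u ! i) (8 * psnd (psnd a) + 6) \<noteq> 0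
     else if pfst a = 2 then \<exists>i<length u. (u ! i) (8 * psnd (psnd a) + 6) \<noteq> 0 \<and> letter_code ((u ! i) 0) = pfst (psnd a)
     else if pfst a = 3 then \<exists>i<length u. (u ! i) (8 * pfst (psnd a) + 6) \<noteq> 0 \<and> (u ! i) (8 * psnd (psnd a) + 7) \<noteq> 0
     else if pfst a = 6 then (\<exists>i<length u. (u ! i) (8 * psnd a + 6) \<noteq> 0) \<and>
       \<not> (\<exists>j<length u. (\<exists>i<j. (u ! i) (8 * psnd a + 6) \<noteq> 0) \<and> (u ! j) (8 * psnd a + 6) \<noteq> 0)
     else True)"

text \<open>Tag 4 is the guard: the track is a padded string of the domain. It includes the bound
  \<open>h\<close>, below which \<open>sym\<close> is injective, so that equality may compare
  numbers instead of symbols.\<close>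

definition fo_atom :: "nat \<Rightarrow> (nat \<Rightarrow> nat) list \<Rightarrow> bool" where
  "fo_atom a u \<longleftrightarrow>
    (if pfst a = 0 then pfst (psnd a) < length \<tau> \<and>
       accepted w (map (\<lambda>b. (snd (lett (b 0)) ! pfst (psnd a),
         collapse (map (\<lambda>m. sym (b (8 * code_nth (psnd (psnd a)) m + 4))) [0..<\<tau> ! pfst (psnd a)]))) u)
     else if pfst a = 1 then \<forall>i<length u. (u ! i) (8 * pfst (psnd a) + 4) = (u ! i) (8 * psnd (psnd a) + 4)
     else if pfst a = 4 then (\<forall>i<length u. (u ! i) (8 * psnd a + 4) < h) \<and>
       accepted w (map (\<lambda>b. (fst (lett (b 0)), sym (b (8 * psnd a + 4)))) u)
     else True)"

definition struct_atom :: "(nat \<Rightarrow> nat) list \<Rightarrow> bool" where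
  "struct_atom u \<longleftrightarrow> (\<forall>i<length u. (u ! i) 0 < g) \<and> struct_lang padded \<Sigma> w \<tau> (map (\<lambda>b. lett (b 0)) u)"

text \<open>The largest case is the guard of first-order variables, with 2 states for the existence
  of a nonzero value times 3 for excluding a second one.\<close>

lemma recog_mso_atom: "6 \<le> M \<Longrightarrow> recog M (mso_atom a)"
proof -
  assume M: "6 \<le> M"
  have 2: "recog M (\<lambda>u. \<exists>i<length u. C (u ! i))" for C :: "(nat \<Rightarrow> nat) \<Rightarrow> bool"
    using M by (intro recog_mono[OF recog_exists_nth]) simp
  have 3: "recog M (\<lambda>u. \<exists>j<length u. (\<exists>i<j. C (u ! i)) \<and> C' (u ! j))" for C C' :: "(nat \<Rightarrow> nat) \<Rightarrow> bool"
    using M by (intro recog_mono[OF recog_exists_less]) simp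
  have 6: "recog M (\<lambda>u. (\<exists>i<length u. C (u ! i)) \<and>
    \<not> (\<exists>j<length u. (\<exists>i<j. C (u ! i)) \<and> C (u ! j)))" for C :: "(nat \<Rightarrow> nat) \<Rightarrow> bool"
    using M by (intro recog_mono[OF recog_conj[OF recog_exists_nth recog_not[OF recog_exists_less]]]) simp
  have 1: "recog M (\<lambda>u. True)"
    using M by (intro recog_mono[OF recog_const]) simp
  have "recog M (\<lambda>u. mso_atom a u)"
    unfolding mso_atom_def
    by (intro recog_if 1 2 3 6)
  then show ?thesis by simp
qed

lemma comp_pred_mso_atom: "comp_pred (\<lambda>z. mso_atom (pfst z) (word c (pfst (psnd z)) (psnd (psnd z))))"
proof -
  have lc: "comp_fn letter_code" unfolding letter_code_def by (rule comp_fn_finite) simp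
  have nth_word_less: "word c k e ! i = (\<lambda>y. digit c e (y * k + i))" if "i < j" "j < k" for k e i j
    using that by simp
  show ?thesis
    by (simp only: mso_atom_def length_word nth_word nth_word_less cong: conj_cong if_cong)
      (intro comp comp_fn_compose[OF lc])
qed

text \<open>The bound may not depend on \<open>a\<close>. Relation symbol, arity and variables only
  affect the letter map, which costs no states, so two automata for \<open>accepted\<close>, one per
  letter type, serve all atoms.\<close>

lemma recog_fo_atom: obtains M where "\<And>M' a. M \<le> M' \<Longrightarrow> recog M' (fo_atom a)"
proof -
  obtain N1 where N1: "recog N1 (accepted w :: ('a layer \<times> 'a option) list \<Rightarrow> bool)" using regular_accepted by blast
  obtain N2 where N2: "recog N2 (accepted w :: ('a option list layer \<times> 'a option list option) list \<Rightarrow> bool)"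
    using regular_accepted by blast
  \<comment> \<open>The three summands cover relation atoms, guards and equalities.\<close>
  have "recog M (fo_atom a)" if M: "1 * N2 + 2 * N1 + 2 \<le> M" for M a
  proof -
    have 0: "recog M (\<lambda>u. C \<and> accepted w (map (f :: _ \<Rightarrow> 'a option list layer \<times> 'a option list option) u))"
      for C and f :: "(nat \<Rightarrow> nat) \<Rightarrow> _"
      using M by (intro recog_mono[OF recog_conj[OF recog_const recog_map[OF N2]]]) simp
    have 1: "recog M (\<lambda>u. \<forall>i<length u. C (u ! i))" for C :: "(nat \<Rightarrow> nat) \<Rightarrow> bool"
      using M by (intro recog_mono[OF recog_all_nth]) simp
    have 4: "recog M (\<lambda>u. (\<forall>i<length u. C (u ! i)) \<and> accepted w (map (f :: _ \<Rightarrow> 'a layer \<times> 'a option) u))"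
      for C and f :: "(nat \<Rightarrow> nat) \<Rightarrow> _"
      using M by (intro recog_mono[OF recog_conj[OF recog_all_nth recog_map[OF N1]]]) simp
    have 5: "recog M (\<lambda>u. True)"
      using M by (intro recog_mono[OF recog_const]) simp
    have "recog M (\<lambda>u. fo_atom a u)"
      unfolding fo_atom_def
      by (intro recog_if 0 1 4 5)
    then show ?thesis by simp
  qed
  then show thesis by (rule that)
qed

lemma comp_pred_fo_atom: "comp_pred (\<lambda>z. fo_atom (pfst z) (word c (pfst (psnd z)) (psnd (psnd z))))"
proof -
  let ?W = "\<lambda>z. word c (pfst (psnd z)) (psnd (psnd z))"
  have c0: "0 < c" using c by simp
  have rel: "comp_pred (\<lambda>z. accepted w (map (\<lambda>b. (snd (lett (b 0)) ! i,
      collapse (map (\<lambda>m. sym (b (8 * code_nth (psnd (psnd (pfst z))) m + 4))) [0..<\<tau> ! i]))) (?W z)))" for i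
  proof -
    let ?ys = "(\<lambda>z. 0) # map (\<lambda>m z. 8 * code_nth (psnd (psnd (pfst z))) m + 4) [0..<\<tau> ! i]"
    have "comp_pred (\<lambda>z. accepted w (map (\<lambda>b. (\<lambda>vs. (snd (lett (hd vs)) ! i, collapse (map sym (tl vs))))
      (map (\<lambda>y. b (y z)) ?ys)) (?W z)))"
      by (rule comp_pred_word_lang[OF regular_accepted c0]) (auto intro!: comp)
    then show ?thesis by (simp add: comp_def)
  qed
  have dom: "comp_pred (\<lambda>z. accepted w (map (\<lambda>b. (fst (lett (b 0)), sym (b (8 * psnd (pfst z) + 4)))) (?W z)))"
  proof -
    have "comp_pred (\<lambda>z. accepted w (map (\<lambda>b. (\<lambda>vs. (fst (lett (vs ! 0)), sym (vs ! 1)))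
      (map (\<lambda>y. b (y z)) [\<lambda>z. 0, \<lambda>z. 8 * psnd (pfst z) + 4])) (?W z)))"
      by (rule comp_pred_word_lang[OF regular_accepted c0]) (auto intro!: comp)
    then show ?thesis by simp
  qed
  have rels: "comp_pred (\<lambda>z. pfst (psnd (pfst z)) < length \<tau> \<and> accepted w (map (\<lambda>b. (snd (lett (b 0)) ! pfst (psnd (pfst z)),
      collapse (map (\<lambda>m. sym (b (8 * code_nth (psnd (psnd (pfst z))) m + 4))) [0..<\<tau> ! pfst (psnd (pfst z))]))) (?W z)))"
    by (rule comp_pred_cases_less[where f = "\<lambda>z. pfst (psnd (pfst z))"]) (intro comp rel)+
  show ?thesis
    by (simp only: fo_atom_def length_word nth_word cong: imp_cong) (intro comp_pred_if rels comp dom)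
qed

lemma regular_struct_atom: "regular struct_atom"
proof -
  have "regular (\<lambda>u. \<forall>i<length u. (u ! i) 0 < g)" using recog_all_nth[of "\<lambda>b. b 0 < g"] by blast
  then have "regular (\<lambda>u. struct_atom u)"
    unfolding struct_atom_def by (intro regular_conj regular_map[OF regular_struct_lang[OF arity]])
  then show ?thesis by simp
qed

lemma comp_pred_struct_atom:
  assumes "comp_fn k" "comp_fn s"
  shows "comp_pred (\<lambda>x. struct_atom (word c (k x) (s x)))"
proof -
  \<comment> \<open>Only track 0 matters, so each letter may be replaced by the constant function
    with its value there.\<close>
  have "comp_pred (\<lambda>x. struct_atom (map (\<lambda>b. (\<lambda>vs y. vs ! 0) (map (\<lambda>y. b (y x)) [\<lambda>x. 0])) (word c (k x) (s x))))"
    using c by (intro comp_pred_word_lang regular_struct_atom assms) (auto intro: comp)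
  moreover have "struct_atom (map (\<lambda>b y. b 0) u) \<longleftrightarrow> struct_atom u" for u
    by (simp add: struct_atom_def comp_def)
  ultimately show ?thesis by simp
qed

end

section \<open>Correctness of the translations and the decision procedure\<close>

context tracks
begin

definition holds_string :: "(nat \<Rightarrow> nat) list \<Rightarrow> 'a layer_tuple list \<Rightarrow> bool" where
  "holds_string u s \<longleftrightarrow> length u = length s \<and> (\<forall>j<length s. (u ! j) 0 < g \<and> lett ((u ! j) 0) = s ! j)"

lemma track_updateD:
  assumes "list_all2 (\<lambda>b b'. \<exists>d<c. b' = b(x := d)) u u'"
  shows "length u' = length u" "j < length u \<Longrightarrow> y \<noteq> x \<Longrightarrow> (u' ! j) y = (u ! j) y"
proof -
  show "length u' = length u" using list_all2_lengthD[OF assms] by simp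
  show "(u' ! j) y = (u ! j) y" if "j < length u" "y \<noteq> x"
    using list_all2_nthD[OF assms that(1)] that(2) by auto
qed

lemma track_update_exists:
  assumes "\<forall>j<length u. f j < c"
  shows "\<exists>u'. list_all2 (\<lambda>b b'. \<exists>d<c. b' = b(x := d)) u u' \<and> (\<forall>j<length u. (u' ! j) x = f j)"
proof (intro exI conjI)
  let ?u = "map (\<lambda>j. (u ! j)(x := f j)) [0..<length u]"
  show "list_all2 (\<lambda>b b'. \<exists>d<c. b' = b(x := d)) u ?u"
    using assms by (auto simp: list_all2_conv_all_nth)
  show "\<forall>j<length u. (?u ! j) x = f j" by simp
qed

text \<open>Quantified tracks have numbers \<open>8 * x + t\<close> with \<open>t\<close> nonzero,
  so no quantifier disturbs the string on track 0.\<close>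

lemma holds_string_update:
  assumes "holds_string u s" "list_all2 (\<lambda>b b'. \<exists>d<c. b' = b(x := d)) u u'" "x \<noteq> 0"
  shows "holds_string u' s"
  using assms track_updateD[OF assms(2)] unfolding holds_string_def by auto

text \<open>Tracks are tied to the assignments at free variables only; elsewhere they may hold
  anything.\<close>

lemma gsat_mso_gf:
  assumes "holds_string u s" "set s \<subseteq> layer_tuples padded \<Sigma> w \<tau>" "set_mso \<psi> \<subseteq> layer_tuples padded \<Sigma> w \<tau>"
    and "\<And>x. x \<in> mso_free1 \<psi> \<Longrightarrow> v x < length s \<and> (\<forall>j<length s. (u ! j) (8 * x + 6) \<noteq> 0 \<longleftrightarrow> j = v x)"
    and "\<And>X. X \<in> mso_free2 \<psi> \<Longrightarrow> V X \<subseteq> {..<length s} \<and> (\<forall>j<length s. (u ! j) (8 * X + 7) \<noteq> 0 \<longleftrightarrow> j \<in> V X)"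
  shows "gsat c mso_atom (mso_gf enc \<psi>) u \<longleftrightarrow> mso_sat s v V \<psi>"
  using assms
proof (induction \<psi> arbitrary: u v V)
  case (MLess x y)
  note len = MLess.prems(1)[unfolded holds_string_def]
  from MLess.prems(4)[of x] MLess.prems(4)[of y] have
    x: "v x < length s" "\<And>j. j < length s \<Longrightarrow> (u ! j) (8 * x + 6) \<noteq> 0 \<longleftrightarrow> j = v x" and
    y: "v y < length s" "\<And>j. j < length s \<Longrightarrow> (u ! j) (8 * y + 6) \<noteq> 0 \<longleftrightarrow> j = v y" by auto
  have "(\<exists>j<length s. (\<exists>i<j. (u ! i) (8 * x + 6) \<noteq> 0) \<and> (u ! j) (8 * y + 6) \<noteq> 0) \<longleftrightarrow> v x < v y"
  proof
    assume "\<exists>j<length s. (\<exists>i<j. (u ! i) (8 * x + 6) \<noteq> 0) \<and> (u ! j) (8 * y + 6) \<noteq> 0"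
    then obtain i j where ij: "j < length s" "i < j" "(u ! i) (8 * x + 6) \<noteq> 0" "(u ! j) (8 * y + 6) \<noteq> 0" by blast
    then have "i = v x" "j = v y" using x(2)[of i] y(2)[of j] by auto
    with ij show "v x < v y" by simp
  next
    assume "v x < v y"
    then show "\<exists>j<length s. (\<exists>i<j. (u ! i) (8 * x + 6) \<noteq> 0) \<and> (u ! j) (8 * y + 6) \<noteq> 0"
      using x y by blast
  qed
  with len show ?case by (simp add: mso_atom_def)
next
  case (MEq x y)
  note len = MEq.prems(1)[unfolded holds_string_def]
  from MEq.prems(4)[of x] MEq.prems(4)[of y] have
    x: "v x < length s" "\<And>j. j < length s \<Longrightarrow> (u ! j) (8 * x + 6) \<noteq> 0 \<longleftrightarrow> j = v x" and
    y: "v y < length s" "\<And>j. j < length s \<Longrightarrow> (u ! j) (8 * y + 6) \<noteq> 0 \<longleftrightarrow> j = v y" by auto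
  have "(\<exists>i<length s. (u ! i) (8 * x + 6) \<noteq> 0 \<and> (u ! i) (8 * y + 6) \<noteq> 0) \<longleftrightarrow> v x = v y"
    using x y by metis
  with len show ?case by (simp add: mso_atom_def)
next
  case (MLetter b x)
  note len = MLetter.prems(1)[unfolded holds_string_def]
  from MLetter.prems(4)[of x] have
    x: "v x < length s" "\<And>j. j < length s \<Longrightarrow> (u ! j) (8 * x + 6) \<noteq> 0 \<longleftrightarrow> j = v x" by auto
  have "letter_code ((u ! v x) 0) = enc (s ! v x)" using len x(1) by (simp add: letter_code_def)
  moreover have "enc (s ! v x) = enc b \<longleftrightarrow> s ! v x = b"
    using MLetter.prems(2,3) x(1) by (intro inj_on_eq_iff[OF inj_enc]) auto
  moreover have "(\<exists>i<length s. (u ! i) (8 * x + 6) \<noteq> 0 \<and> letter_code ((u ! i) 0) = enc b) \<longleftrightarrow>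
    letter_code ((u ! v x) 0) = enc b"
    using x by metis
  ultimately show ?case using len x(1) by (simp add: mso_atom_def)
next
  case (MMem x X)
  note len = MMem.prems(1)[unfolded holds_string_def]
  from MMem.prems(4)[of x] MMem.prems(5)[of X] have
    x: "v x < length s" "\<And>j. j < length s \<Longrightarrow> (u ! j) (8 * x + 6) \<noteq> 0 \<longleftrightarrow> j = v x" and
    X: "\<And>j. j < length s \<Longrightarrow> (u ! j) (8 * X + 7) \<noteq> 0 \<longleftrightarrow> j \<in> V X" by auto
  have "(\<exists>i<length s. (u ! i) (8 * x + 6) \<noteq> 0 \<and> (u ! i) (8 * X + 7) \<noteq> 0) \<longleftrightarrow> v x \<in> V X"
    using x X by metis
  with len show ?case by (simp add: mso_atom_def)
next
  case (MNeg \<psi>)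
  then show ?case by (simp add: MNeg.IH[of u v V])
next
  case (MConj \<psi> \<chi>)
  then show ?case by (simp add: MConj.IH(1)[of u v V] MConj.IH(2)[of u v V])
next
  case (MEx1 x \<psi>)
  have len: "length u = length s" using MEx1.prems(1) by (simp add: holds_string_def)
  have guard: "mso_atom (pair 6 x) u' \<longleftrightarrow> (\<exists>i<length u'. \<forall>j<length u'. (u' ! j) (8 * x + 6) \<noteq> 0 \<longleftrightarrow> j = i)" (is "?G \<longleftrightarrow> ?E") for u'
  proof
    assume ?G
    then have *: "\<exists>i<length u'. (u' ! i) (8 * x + 6) \<noteq> 0"
      "\<And>i j. j < length u' \<Longrightarrow> i < j \<Longrightarrow> (u' ! i) (8 * x + 6) \<noteq> 0 \<Longrightarrow> (u' ! j) (8 * x + 6) \<noteq> 0 \<Longrightarrow> False"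
      by (auto simp: mso_atom_def)
    from *(1) obtain i where i: "i < length u'" "(u' ! i) (8 * x + 6) \<noteq> 0" by blast
    with *(2) have "\<forall>j<length u'. (u' ! j) (8 * x + 6) \<noteq> 0 \<longleftrightarrow> j = i" by (metis linorder_neqE_nat)
    with i(1) show ?E by blast
  next
    assume ?E
    then obtain i where i: "i < length u'" "\<And>j. j < length u' \<Longrightarrow> (u' ! j) (8 * x + 6) \<noteq> 0 \<longleftrightarrow> j = i" by blast
    then show ?G
    proof -
      have "\<not> (\<exists>j<length u'. (\<exists>k<j. (u' ! k) (8 * x + 6) \<noteq> 0) \<and> (u' ! j) (8 * x + 6) \<noteq> 0)"
      proof (intro notI, elim exE conjE)
        fix j k assume jk: "j < length u'" "k < j" "(u' ! k) (8 * x + 6) \<noteq> 0" "(u' ! j) (8 * x + 6) \<noteq> 0"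
        then have "k = i" "j = i" using i(2)[of k] i(2)[of j] by auto
        with jk(2) show False by simp
      qed
      moreover have "\<exists>k<length u'. (u' ! k) (8 * x + 6) \<noteq> 0" using i by blast
      ultimately show ?thesis by (simp add: mso_atom_def)
    qed
  qed
  have IH: "gsat c mso_atom (mso_gf enc \<psi>) u' \<longleftrightarrow> mso_sat s (v(x := i)) V \<psi>"
    if u': "list_all2 (\<lambda>b b'. \<exists>d<c. b' = b(8 * x + 6 := d)) u u'" and i: "i < length s"
      "\<And>j. j < length s \<Longrightarrow> (u' ! j) (8 * x + 6) \<noteq> 0 \<longleftrightarrow> j = i" for u' i
  proof (rule MEx1.IH)
    show "holds_string u' s" using holds_string_update[OF MEx1.prems(1) u'] by simp
    show "(v(x := i)) y < length s \<and> (\<forall>j<length s. (u' ! j) (8 * y + 6) \<noteq> 0 \<longleftrightarrow> j = (v(x := i)) y)"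
      if "y \<in> mso_free1 \<psi>" for y
      using MEx1.prems(4)[of y] that i track_updateD(2)[OF u', of _ "8 * y + 6"] len by (cases "y = x") auto
    show "V X \<subseteq> {..<length s} \<and> (\<forall>j<length s. (u' ! j) (8 * X + 7) \<noteq> 0 \<longleftrightarrow> j \<in> V X)"
      if "X \<in> mso_free2 \<psi>" for X
    proof -
      have "8 * X + 7 \<noteq> 8 * x + 6" using track_eq_iff[of 7 6 X x] by simp
      then show ?thesis
        using MEx1.prems(5)[of X] that track_updateD(2)[OF u', of _ "8 * X + 7"] len by simp
    qed
  qed (use MEx1.prems in auto)
  show ?case
  proof
    assume "gsat c mso_atom (mso_gf enc (MEx1 x \<psi>)) u"
    then obtain u' where u': "list_all2 (\<lambda>b b'. \<exists>d<c. b' = b(8 * x + 6 := d)) u u'"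
      "mso_atom (pair 6 x) u'" "gsat c mso_atom (mso_gf enc \<psi>) u'" by auto
    from u'(2) obtain i where "i < length s" "\<And>j. j < length s \<Longrightarrow> (u' ! j) (8 * x + 6) \<noteq> 0 \<longleftrightarrow> j = i"
      unfolding guard using track_updateD(1)[OF u'(1)] len by auto
    with IH[OF u'(1) this] u'(3) show "mso_sat s v V (MEx1 x \<psi>)" by auto
  next
    assume "mso_sat s v V (MEx1 x \<psi>)"
    then obtain i where i: "i < length s" "mso_sat s (v(x := i)) V \<psi>" by auto
    \<comment> \<open>The witness is the indicator track of the position, which needs
      \<open>c \<ge> 2\<close>.\<close>
    have "\<forall>j<length u. (if j = i then 1 else 0) < c" using c(1) by simp
    from track_update_exists[OF this, of "8 * x + 6"]
    obtain u' where u': "list_all2 (\<lambda>b b'. \<exists>d<c. b' = b(8 * x + 6 := d)) u u'"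
      "\<forall>j<length u. (u' ! j) (8 * x + 6) = (if j = i then 1 else 0)" by blast
    then have nz: "(u' ! j) (8 * x + 6) \<noteq> 0 \<longleftrightarrow> j = i" if "j < length s" for j using that len by simp
    have "mso_atom (pair 6 x) u'" unfolding guard using nz i(1) track_updateD(1)[OF u'(1)] len by auto
    moreover have "gsat c mso_atom (mso_gf enc \<psi>) u'" using IH[OF u'(1) i(1) nz] i(2) by simp
    ultimately show "gsat c mso_atom (mso_gf enc (MEx1 x \<psi>)) u" using u'(1) by auto
  qed
next
  case (MEx2 X \<psi>)
  have len: "length u = length s" using MEx2.prems(1) by (simp add: holds_string_def)
  have guard: "mso_atom (pair 7 X) u'" for u' by (simp add: mso_atom_def)
  have IH: "gsat c mso_atom (mso_gf enc \<psi>) u' \<longleftrightarrow> mso_sat s v (V(X := P)) \<psi>"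
    if u': "list_all2 (\<lambda>b b'. \<exists>d<c. b' = b(8 * X + 7 := d)) u u'" and P: "P \<subseteq> {..<length s}"
      "\<And>j. j < length s \<Longrightarrow> (u' ! j) (8 * X + 7) \<noteq> 0 \<longleftrightarrow> j \<in> P" for u' P
  proof (rule MEx2.IH)
    show "holds_string u' s" using holds_string_update[OF MEx2.prems(1) u'] by simp
    show "v y < length s \<and> (\<forall>j<length s. (u' ! j) (8 * y + 6) \<noteq> 0 \<longleftrightarrow> j = v y)"
      if "y \<in> mso_free1 \<psi>" for y
    proof -
      have "8 * y + 6 \<noteq> 8 * X + 7" using track_eq_iff[of 6 7 y X] by simp
      then show ?thesis
        using MEx2.prems(4)[of y] that track_updateD(2)[OF u', of _ "8 * y + 6"] len by simp
    qed
    show "(V(X := P)) Y \<subseteq> {..<length s} \<and> (\<forall>j<length s. (u' ! j) (8 * Y + 7) \<noteq> 0 \<longleftrightarrow> j \<in> (V(X := P)) Y)"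
      if "Y \<in> mso_free2 \<psi>" for Y
      using MEx2.prems(5)[of Y] that P track_updateD(2)[OF u', of _ "8 * Y + 7"] len by (cases "Y = X") auto
  qed (use MEx2.prems in auto)
  show ?case
  proof
    assume "gsat c mso_atom (mso_gf enc (MEx2 X \<psi>)) u"
    then obtain u' where u': "list_all2 (\<lambda>b b'. \<exists>d<c. b' = b(8 * X + 7 := d)) u u'"
      "gsat c mso_atom (mso_gf enc \<psi>) u'" by auto
    let ?P = "{j. j < length s \<and> (u' ! j) (8 * X + 7) \<noteq> 0}"
    have "mso_sat s v (V(X := ?P)) \<psi>" using IH[OF u'(1), of ?P] u'(2) by auto
    then show "mso_sat s v V (MEx2 X \<psi>)" by (auto intro!: exI[of _ ?P])
  next
    assume "mso_sat s v V (MEx2 X \<psi>)"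
    then obtain P where P: "P \<subseteq> {..<length s}" "mso_sat s v (V(X := P)) \<psi>" by auto
    have "\<forall>j<length u. (if j \<in> P then 1 else 0) < c" using c(1) by simp
    from track_update_exists[OF this, of "8 * X + 7"]
    obtain u' where u': "list_all2 (\<lambda>b b'. \<exists>d<c. b' = b(8 * X + 7 := d)) u u'"
      "\<forall>j<length u. (u' ! j) (8 * X + 7) = (if j \<in> P then 1 else 0)" by blast
    have "gsat c mso_atom (mso_gf enc \<psi>) u'" using IH[OF u'(1) P(1)] u'(2) P(2) len by simp
    then show "gsat c mso_atom (mso_gf enc (MEx2 X \<psi>)) u" using u'(1) guard by auto
  qed
qed

text \<open>An accepting run reads this symbol through a transition of layer \<open>j\<close>. It
  makes every element of the domain expressible by symbol numbers below \<open>h\<close>.\<close>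

lemma odd_lang_symbols:
  assumes "D \<in> odds \<Sigma> w k" "s \<in> odd_lang D" "j < k"
  shows "pad_nth s j \<in> insert None (Some ` \<Sigma>)"
proof -
  have "length D = k" "D ! j \<in> layers \<Sigma> w" using assms unfolding odds_def by auto
  moreover from this obtain p q where "(p j, pad_nth s j, q j) \<in> transitions (D ! j)"
    using assms(2,3) unfolding odd_lang_def by auto
  ultimately show ?thesis unfolding layers_def by blast
qed

lemma gsat_fo_gf:
  fixes s :: "'a layer_tuple list"
  defines "D0 \<equiv> map fst s" and "Ds \<equiv> map (diag s) [0..<length \<tau>]"
  assumes "holds_string u s" "struct_lang padded \<Sigma> w \<tau> s" "fo_over \<tau> \<phi>"
    and "\<And>x. x \<in> fo_free \<phi> \<Longrightarrow> v x \<in> odd_lang D0 \<and>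
      (\<forall>j<length s. (u ! j) (8 * x + 4) < h \<and> sym ((u ! j) (8 * x + 4)) = pad_nth (v x) j)"
  shows "gsat c fo_atom (fo_gf \<phi>) u \<longleftrightarrow> fo_sat (derived_struct \<tau> D0 Ds) v \<phi>"
proof -
  note D = struct_langD[OF assms(4), folded D0_def]
  have lenD: "length D0 = length s" by (simp add: D0_def)
  have inj_sym: "i = j" if "sym i = sym j" "i < h" "j < h" for i j
    using inj_onD[OF bij_betw_imp_inj_on[OF sym] that(1)] that by simp
  show ?thesis
    using assms(3,5,6)
  proof (induction \<phi> arbitrary: u v)
    case (FRel i xs)
    have i: "i < length \<tau>" "length xs = \<tau> ! i" using FRel.prems(2) by auto
    then have "\<tau> ! i \<ge> 1" using arity by auto
    then have ne: "map v xs \<noteq> []" using i by auto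
    have len: "length u = length s" using FRel.prems(1) by (simp add: holds_string_def)
    have mem: "x \<noteq> [] \<and> length x \<le> length s" if "x \<in> set (map v xs)" for x
      using that FRel.prems(3) odd_langD[of x D0] lenD by auto
    have "map (\<lambda>b. (snd (lett (b 0)) ! i, collapse (map (\<lambda>m. sym (b (8 * code_nth (list_encode xs) m + 4))) [0..<\<tau> ! i]))) u
      = zip (diag s i) (map (\<lambda>j. collapse (map (\<lambda>u. pad_nth u j) (map v xs))) [0..<length s])"
    proof (rule nth_equalityI)
      fix j assume "j < length (map (\<lambda>b. (snd (lett (b 0)) ! i,
        collapse (map (\<lambda>m. sym (b (8 * code_nth (list_encode xs) m + 4))) [0..<\<tau> ! i]))) u)"
      then have j: "j < length s" using len by simp
      have "map (\<lambda>m. sym ((u ! j) (8 * code_nth (list_encode xs) m + 4))) [0..<\<tau> ! i] = map (\<lambda>u. pad_nth u j) (map v xs)"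
        using i j FRel.prems(3) by (intro nth_equalityI) (auto simp: code_nth_list_encode)
      then show "map (\<lambda>b. (snd (lett (b 0)) ! i,
          collapse (map (\<lambda>m. sym (b (8 * code_nth (list_encode xs) m + 4))) [0..<\<tau> ! i]))) u ! j =
        zip (diag s i) (map (\<lambda>j. collapse (map (\<lambda>u. pad_nth u j) (map v xs))) [0..<length s]) ! j"
        using j len FRel.prems(1) by (simp add: diag_def holds_string_def del: map_map)
    qed (simp add: len diag_def)
    then have "gsat c fo_atom (fo_gf (FRel i xs)) u \<longleftrightarrow>
      accepted w (zip (diag s i) (map (\<lambda>j. collapse (map (\<lambda>u. pad_nth u j) (map v xs))) [0..<length s]))"
      using i by (simp add: fo_atom_def del: map_map)
    also have "\<dots> \<longleftrightarrow> tensor (map v xs) \<in> odd_lang (Ds ! i)"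
      using tensor_in_odd_lang_iff[OF D(3)[OF i(1)] D(1) ne mem] i by (simp add: Ds_def)
    also have "\<dots> \<longleftrightarrow> fo_sat (derived_struct \<tau> D0 Ds) v (FRel i xs)"
      using i mem by (auto simp: derived_struct_def lang_rel_def)
    finally show ?case .
  next
    case (FEq x y)
    have len: "length u = length s" using FEq.prems(1) by (simp add: holds_string_def)
    from FEq.prems(3)[of x] FEq.prems(3)[of y] have
      x: "length (v x) \<le> length s" "\<And>j. j < length s \<Longrightarrow> (u ! j) (8 * x + 4) < h \<and> sym ((u ! j) (8 * x + 4)) = pad_nth (v x) j" and
      y: "length (v y) \<le> length s" "\<And>j. j < length s \<Longrightarrow> (u ! j) (8 * y + 4) < h \<and> sym ((u ! j) (8 * y + 4)) = pad_nth (v y) j"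
      using lenD by (auto dest: odd_langD)
    have "(\<forall>j<length s. (u ! j) (8 * x + 4) = (u ! j) (8 * y + 4)) \<longleftrightarrow> v x = v y"
      using pads_inject[OF x(1) y(1)] x(2) y(2) inj_sym by metis
    then show ?case using len by (simp add: fo_atom_def)
  next
    case (FNeg \<phi>)
    then show ?case by (simp add: FNeg.IH[of u v])
  next
    case (FConj \<phi> \<chi>)
    then show ?case by (simp add: FConj.IH(1)[of u v] FConj.IH(2)[of u v])
  next
    case (FEx x \<phi>)
    have len: "length u = length s" using FEx.prems(1) by (simp add: holds_string_def)
    have guard: "fo_atom (pair 4 x) u' \<longleftrightarrow>
      (\<exists>z\<in>odd_lang D0. \<forall>j<length s. (u' ! j) (8 * x + 4) < h \<and> sym ((u' ! j) (8 * x + 4)) = pad_nth z j)" (is "?G \<longleftrightarrow> ?E")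
      if u': "holds_string u' s" for u'
    proof -
      let ?t = "map (\<lambda>b. sym (b (8 * x + 4))) u'"
      have len': "length u' = length s" using u' by (simp add: holds_string_def)
      have "map (\<lambda>b. (fst (lett (b 0)), sym (b (8 * x + 4)))) u' = zip D0 ?t"
        using u' by (intro nth_equalityI) (auto simp: D0_def holds_string_def)
      then have *: "?G \<longleftrightarrow> (\<forall>j<length s. (u' ! j) (8 * x + 4) < h) \<and> accepted w (zip D0 ?t)"
        using len' by (simp add: fo_atom_def)
      show ?thesis
      proof
        assume ?G
        with * have h: "\<forall>j<length s. (u' ! j) (8 * x + 4) < h" and acc: "accepted w (zip D0 ?t)" by auto
        from accepted_pads[OF acc lenD] len' obtain z where
          z: "z \<noteq> []" "length z \<le> length s" "?t = pads (length s) z" by auto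
        have "z \<in> odd_lang D0" using in_odd_lang_iff[OF D(2,1) z(1,2)] acc z(3) by simp
        moreover have "sym ((u' ! j) (8 * x + 4)) = pad_nth z j" if "j < length s" for j
          using arg_cong[OF z(3), of "\<lambda>t. t ! j"] that len' by simp
        ultimately show ?E using h by blast
      next
        assume ?E
        then obtain z where z: "z \<in> odd_lang D0"
          "\<And>j. j < length s \<Longrightarrow> (u' ! j) (8 * x + 4) < h \<and> sym ((u' ! j) (8 * x + 4)) = pad_nth z j" by blast
        then have z': "z \<noteq> []" "length z \<le> length s" using lenD by (auto dest: odd_langD)
        have "?t = pads (length s) z" using z(2) len' by (intro nth_equalityI) auto
        then have "accepted w (zip D0 ?t)" using in_odd_lang_iff[OF D(2,1) z'] z(1) by simp
        with * z(2) show ?G by simp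
      qed
    qed
    have IH: "gsat c fo_atom (fo_gf \<phi>) u' \<longleftrightarrow> fo_sat (derived_struct \<tau> D0 Ds) (v(x := z)) \<phi>"
      if u': "list_all2 (\<lambda>b b'. \<exists>d<c. b' = b(8 * x + 4 := d)) u u'" and z: "z \<in> odd_lang D0"
        "\<And>j. j < length s \<Longrightarrow> (u' ! j) (8 * x + 4) < h \<and> sym ((u' ! j) (8 * x + 4)) = pad_nth z j" for u' z
    proof (rule FEx.IH)
      show "holds_string u' s" using holds_string_update[OF FEx.prems(1) u'] by simp
      show "(v(x := z)) y \<in> odd_lang D0 \<and> (\<forall>j<length s. (u' ! j) (8 * y + 4) < h \<and>
        sym ((u' ! j) (8 * y + 4)) = pad_nth ((v(x := z)) y) j)" if "y \<in> fo_free \<phi>" for y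
        using FEx.prems(3)[of y] that z track_updateD(2)[OF u', of _ "8 * y + 4"] len by (cases "y = x") auto
    qed (use FEx.prems in auto)
    show ?case
    proof
      assume "gsat c fo_atom (fo_gf (FEx x \<phi>)) u"
      then obtain u' where u': "list_all2 (\<lambda>b b'. \<exists>d<c. b' = b(8 * x + 4 := d)) u u'"
        "fo_atom (pair 4 x) u'" "gsat c fo_atom (fo_gf \<phi>) u'" by auto
      have "holds_string u' s" using holds_string_update[OF FEx.prems(1) u'(1)] by simp
      from u'(2) obtain z where z: "z \<in> odd_lang D0"
        "\<And>j. j < length s \<Longrightarrow> (u' ! j) (8 * x + 4) < h \<and> sym ((u' ! j) (8 * x + 4)) = pad_nth z j"
        unfolding guard[OF \<open>holds_string u' s\<close>] by blast
      have "fo_sat (derived_struct \<tau> D0 Ds) (v(x := z)) \<phi>" using IH[OF u'(1) z] u'(3) by simp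
      then show "fo_sat (derived_struct \<tau> D0 Ds) v (FEx x \<phi>)" using z(1) by (auto simp: derived_struct_def)
    next
      assume "fo_sat (derived_struct \<tau> D0 Ds) v (FEx x \<phi>)"
      then obtain z where z: "z \<in> odd_lang D0" "fo_sat (derived_struct \<tau> D0 Ds) (v(x := z)) \<phi>"
        by (auto simp: derived_struct_def)
      have "\<exists>i<h. sym i = pad_nth z j" if "j < length s" for j
        using odd_lang_symbols[OF D(2) z(1) that] bij_betw_imp_surj_on[OF sym] by (metis imageE lessThan_iff)
      then obtain f where f: "\<And>j. j < length s \<Longrightarrow> f j < h \<and> sym (f j) = pad_nth z j" by metis
      have fc: "\<forall>j<length u. f j < c" using f c(3) len by (auto intro: less_le_trans)
      obtain u' where u': "list_all2 (\<lambda>b b'. \<exists>d<c. b' = b(8 * x + 4 := d)) u u'"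
        "\<forall>j<length u. (u' ! j) (8 * x + 4) = f j"
        using track_update_exists[of u f "8 * x + 4", OF fc] by blast
      then have fj: "(u' ! j) (8 * x + 4) < h \<and> sym ((u' ! j) (8 * x + 4)) = pad_nth z j" if "j < length s" for j
        using f len that by simp
      have "holds_string u' s" using holds_string_update[OF FEx.prems(1) u'(1)] by simp
      then have "fo_atom (pair 4 x) u'" using guard z(1) fj by blast
      moreover have "gsat c fo_atom (fo_gf \<phi>) u'" using IH[OF u'(1) z(1) fj] z(2) by simp
      ultimately show "gsat c fo_atom (fo_gf (FEx x \<phi>)) u" using u'(1) by auto
    qed
  qed
qed

lemma satisfiable_iff:
  assumes \<psi>: "\<psi> \<in> mso_sentences (layer_tuples padded \<Sigma> w \<tau>)" and \<phi>: "\<phi> \<in> fo_sentences \<tau>"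
  shows "(\<exists>D0 Ds. structural padded \<Sigma> w \<tau> D0 Ds \<and>
       mso_models (odd_tensor D0 Ds) \<psi> \<and> fo_models (derived_struct \<tau> D0 Ds) \<phi>) \<longleftrightarrow>
    (\<exists>k u. list_all2 (\<lambda>b b'. \<exists>d<c. b' = b(0 := d)) (replicate k (\<lambda>_. 0)) u \<and>
      struct_atom u \<and> gsat c mso_atom (mso_gf enc \<psi>) u \<and> gsat c fo_atom (fo_gf \<phi>) u)" (is "?L \<longleftrightarrow> ?R")
proof -
  have sat: "gsat c mso_atom (mso_gf enc \<psi>) u \<longleftrightarrow> mso_models s \<psi>"
    "gsat c fo_atom (fo_gf \<phi>) u \<longleftrightarrow> fo_models (derived_struct \<tau> (map fst s) (map (diag s) [0..<length \<tau>])) \<phi>"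
    if "holds_string u s" "struct_lang padded \<Sigma> w \<tau> s" for u s
  proof -
    note D = struct_langD[OF that(2)]
    show "gsat c mso_atom (mso_gf enc \<psi>) u \<longleftrightarrow> mso_models s \<psi>"
      using gsat_mso_gf[OF that(1) D(4), of \<psi>] \<psi> unfolding mso_models_def mso_sentences_def by auto
    show "gsat c fo_atom (fo_gf \<phi>) u \<longleftrightarrow> fo_models (derived_struct \<tau> (map fst s) (map (diag s) [0..<length \<tau>])) \<phi>"
      using gsat_fo_gf[OF that, of \<phi>] \<phi> unfolding fo_models_def fo_sentences_def by auto
  qed
  show ?thesis
  proof
    assume ?L
    then obtain D0 Ds where D: "structural padded \<Sigma> w \<tau> D0 Ds"
       "mso_models (odd_tensor D0 Ds) \<psi>" "fo_models (derived_struct \<tau> D0 Ds) \<phi>" by blast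
    note ot = odd_tensor_inverse[OF D(1)]
    define s where "s = odd_tensor D0 Ds"
    have "\<exists>i<g. lett i = s ! j" if "j < length s" for j
    proof -
      have "s ! j \<in> layer_tuples padded \<Sigma> w \<tau>" using struct_langD(4)[OF ot(3)] that unfolding s_def by auto
      then show ?thesis using bij_betw_imp_surj_on[OF lett] by (metis imageE lessThan_iff)
    qed
    then obtain f where f: "\<And>j. j < length s \<Longrightarrow> f j < g \<and> lett (f j) = s ! j" by metis
    have fc: "\<forall>j<length (replicate (length s) (\<lambda>_ :: nat. 0 :: nat)). f j < c" using f c(2) by (auto intro: less_le_trans)
    obtain u where u: "list_all2 (\<lambda>b b'. \<exists>d<c. b' = b(0 := d)) (replicate (length s) (\<lambda>_ :: nat. 0)) u"
      "\<forall>j<length s. (u ! j) 0 = f j"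
      using track_update_exists[OF fc, of 0] by auto
    have len: "length u = length s" using track_updateD(1)[OF u(1)] by simp
    then have hs: "holds_string u s" using u(2) f unfolding holds_string_def by simp
    have "map (\<lambda>b. lett (b 0)) u = s" using len u(2) f by (intro nth_equalityI) auto
    then have "struct_atom u" using ot(3) len u(2) f unfolding struct_atom_def s_def by simp
    moreover have "gsat c mso_atom (mso_gf enc \<psi>) u" "gsat c fo_atom (fo_gf \<phi>) u"
      using sat[OF hs] ot D(2,3) unfolding s_def by simp_all
    ultimately show ?R using u(1) by blast
  next
    assume ?R
    then obtain u where u: "struct_atom u" "gsat c mso_atom (mso_gf enc \<psi>) u" "gsat c fo_atom (fo_gf \<phi>) u" by blast
    define s where "s = map (\<lambda>b. lett (b 0)) u"
    have st: "struct_lang padded \<Sigma> w \<tau> s" using u(1) unfolding struct_atom_def s_def by simp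
    have hs: "holds_string u s" using u(1) unfolding struct_atom_def s_def holds_string_def by simp
    let ?D0 = "map fst s" and ?Ds = "map (diag s) [0..<length \<tau>]"
    have "structural padded \<Sigma> w \<tau> ?D0 ?Ds" using st unfolding struct_lang_def by blast
    moreover have "mso_models (odd_tensor ?D0 ?Ds) \<psi>" unfolding odd_tensor_diag[OF st] using sat(1)[OF hs st] u(2) by simp
    moreover have "fo_models (derived_struct \<tau> ?D0 ?Ds) \<phi>" using sat(2)[OF hs st] u(3) by simp
    ultimately show ?L by blast
  qed
qed

lemma decidable_satisfiable:
  "\<exists>Q. comp_pred Q \<and> (\<forall>\<psi>\<in>mso_sentences (layer_tuples padded \<Sigma> w \<tau>). \<forall>\<phi>\<in>fo_sentences \<tau>.
    Q (pair (mso_code enc \<psi>) (fo_code \<phi>)) \<longleftrightarrow> (\<exists>D0 Ds. structural padded \<Sigma> w \<tau> D0 Ds \<and>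
       mso_models (odd_tensor D0 Ds) \<psi> \<and> fo_models (derived_struct \<tau> D0 Ds) \<phi>))"
proof -
  obtain N1 where N1: "\<And>M a. N1 \<le> M \<Longrightarrow> recog M (fo_atom a)" using recog_fo_atom by blast
  obtain N2 where N2: "recog N2 struct_atom" using regular_struct_atom by blast
  \<comment> \<open>A common number of states for the atoms of both logics and for the structural
    condition; 6 is what \<open>recog_mso_atom\<close> asks for.\<close>
  define M where "M = N1 + N2 + 6"
  have M: "recog M (fo_atom a)" "recog M (mso_atom a)" "recog M struct_atom" "2 \<le> M" for a
    using N1 recog_mso_atom recog_mono[OF N2] by (auto simp: M_def)
  have c0: "0 < c" using c by simp
  obtain Em where Em: "comp_pred (\<lambda>z. Em (pfst z) (psnd z))"
    "\<And>k N f e. gwf 4 f \<Longrightarrow> 8 * gcode 4 f + 8 \<le> N \<Longrightarrow> e < c ^ (k * N) \<Longrightarrow>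
      Em (pair k N) (gcode 4 f * c ^ (k * N) + e) \<longleftrightarrow> gsat c mso_atom f (word c k e)"
    by (rule comp_gsat[OF c0 _ comp_pred_mso_atom, of 4]) (simp, blast)
  obtain Ef where Ef: "comp_pred (\<lambda>z. Ef (pfst z) (psnd z))"
    "\<And>k N f e. gwf 2 f \<Longrightarrow> 8 * gcode 2 f + 8 \<le> N \<Longrightarrow> e < c ^ (k * N) \<Longrightarrow>
      Ef (pair k N) (gcode 2 f * c ^ (k * N) + e) \<longleftrightarrow> gsat c fo_atom f (word c k e)"
    by (rule comp_gsat[OF c0 _ comp_pred_fo_atom, of 2]) (simp, blast)
  have Em': "comp_pred (\<lambda>x. Em (a x) (b x))" if "comp_fn a" "comp_fn b" for a b
    using comp_pred_compose[OF Em(1) comp_fn_pair[OF that]] by simp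
  have Ef': "comp_pred (\<lambda>x. Ef (a x) (b x))" if "comp_fn a" "comp_fn b" for a b
    using comp_pred_compose[OF Ef(1) comp_fn_pair[OF that]] by simp
  define test where "test k e a b N \<longleftrightarrow> struct_atom (word c k e) \<and>
    Em (pair k N) (a * c ^ (k * N) + e) \<and> Ef (pair k N) (b * c ^ (k * N) + e)" for k e a b N
  \<comment> \<open>The exponent counts the states of the conjunction: \<open>M\<close> for
    \<open>struct_atom\<close> times one tower per formula. The outer power of 2 is the projection
    of the string track, which the codes \<open>e < c ^ k\<close> run through; the number of tracks
    suffices for both formulas.\<close>
  define Q where "Q z \<longleftrightarrow> (\<exists>k<2 ^ (M * (tower M (pfst z) * tower M (psnd z))). \<exists>e<c ^ k.
    test k e (pfst z) (psnd z) (8 * (pfst z + psnd z) + 8))" for z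
  have "comp_pred Q"
    unfolding Q_def[abs_def] test_def by (intro comp comp_pred_struct_atom Em' Ef')
  moreover have "Q (pair (mso_code enc \<psi>) (fo_code \<phi>)) \<longleftrightarrow> (\<exists>D0 Ds. structural padded \<Sigma> w \<tau> D0 Ds \<and>
       mso_models (odd_tensor D0 Ds) \<psi> \<and> fo_models (derived_struct \<tau> D0 Ds) \<phi>)"
    if \<psi>: "\<psi> \<in> mso_sentences (layer_tuples padded \<Sigma> w \<tau>)" and \<phi>: "\<phi> \<in> fo_sentences \<tau>" for \<psi> \<phi>
  proof -
    let ?a = "mso_code enc \<psi>" and ?b = "fo_code \<phi>"
    let ?K = "2 ^ (M * (tower M ?a * tower M ?b))"
    define P where "P u \<longleftrightarrow> (\<exists>u'. list_all2 (\<lambda>b b'. \<exists>d<c. b' = b(0 := d)) u u' \<and>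
      struct_atom u' \<and> gsat c mso_atom (mso_gf enc \<psi>) u' \<and> gsat c fo_atom (fo_gf \<phi>) u')" for u
    have "recog ?K P"
      unfolding P_def
      using recog_gsat[OF M(2,4) _ gwf_mso_gf[of enc \<psi>]] recog_gsat[OF M(1,4) _ gwf_fo_gf[of \<phi>]]
      unfolding gcode_mso_gf gcode_fo_gf
      by (intro recog_projection recog_conj M(3)) simp_all
    note short = recog_replicate[OF this]
    have test: "(\<exists>e<c ^ k. test k e ?a ?b (8 * (?a + ?b) + 8)) \<longleftrightarrow> P (replicate k (\<lambda>_. 0))" for k
    proof -
      let ?N = "8 * (?a + ?b) + 8"
      \<comment> \<open>The blank word has code 0. Rewriting its track 0, with a single track in
        use, yields exactly the words with codes below \<open>c ^ k\<close>.\<close>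
      have "word c k 0 = replicate k (\<lambda>_. 0)"
        by (intro nth_equalityI) (auto simp: digit_def)
      with word_update[OF c0, of 0 k 1 0] c0
      have "P (replicate k (\<lambda>_. 0)) \<longleftrightarrow> (\<exists>e<c ^ k. struct_atom (word c k e) \<and>
        gsat c mso_atom (mso_gf enc \<psi>) (word c k e) \<and> gsat c fo_atom (fo_gf \<phi>) (word c k e))"
        unfolding P_def by auto
      moreover have "test k e ?a ?b ?N \<longleftrightarrow> struct_atom (word c k e) \<and>
        gsat c mso_atom (mso_gf enc \<psi>) (word c k e) \<and> gsat c fo_atom (fo_gf \<phi>) (word c k e)" if "e < c ^ k" for e
      proof -
        have "c ^ k \<le> c ^ (k * ?N)" using c0 by (intro power_increasing) auto
        with that have "e < c ^ (k * ?N)" by linarith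
        then show ?thesis
          unfolding test_def
          using Em(2)[OF gwf_mso_gf[of enc \<psi>], of ?N e k] Ef(2)[OF gwf_fo_gf[of \<phi>], of ?N e k]
          by (simp add: gcode_mso_gf gcode_fo_gf)
      qed
      ultimately show ?thesis by blast
    qed
    show ?thesis
      unfolding satisfiable_iff[OF \<psi> \<phi>] Q_def prod_encode_inverse fst_conv snd_conv test
      using short unfolding P_def[symmetric] by blast
  qed
  ultimately show ?thesis by blast
qed

end

theorem theorem3:
  fixes \<Sigma> :: "'a set" and w :: nat and \<tau> :: "nat list" and padded :: bool
    and enc :: "'a layer_tuple \<Rightarrow> nat"
  assumes "finite \<Sigma>" and "w \<ge> 1" and "\<forall>a\<in>set \<tau>. a \<ge> 1"
    and "inj_on enc (layer_tuples padded \<Sigma> w \<tau>)"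
  shows "decidable
    (mso_sentences (layer_tuples padded \<Sigma> w \<tau>) \<times> fo_sentences \<tau>)
    (\<lambda>(\<psi>, \<phi>). prod_encode (mso_code enc \<psi>, fo_code \<phi>))
    (\<lambda>(\<psi>, \<phi>). \<exists>D0 Ds. structural padded \<Sigma> w \<tau> D0 Ds \<and>
       mso_models (odd_tensor D0 Ds) \<psi> \<and> fo_models (derived_struct \<tau> D0 Ds) \<phi>)"
proof -
  obtain lett g where lett: "bij_betw lett {..<g :: nat} (layer_tuples padded \<Sigma> w \<tau>)"
    using ex_bij_betw_nat_finite[OF finite_layer_tuples[OF assms(1)]] unfolding atLeast0LessThan by blast
  obtain sym h where sym: "bij_betw sym {..<h :: nat} (insert None (Some ` \<Sigma>))"
    using ex_bij_betw_nat_finite[of "insert None (Some ` \<Sigma>)"] assms(1) unfolding atLeast0LessThan by blast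
  \<comment> \<open>The last argument is a common bound on letter numbers, symbol numbers and the
    values 0 and 1.\<close>
  interpret tracks padded \<Sigma> w \<tau> enc lett g sym h "g + h + 2"
    by unfold_locales (use assms lett sym in auto)
  from decidable_satisfiable obtain Q where Q: "comp_pred Q"
    "\<And>\<psi> \<phi>. \<psi> \<in> mso_sentences (layer_tuples padded \<Sigma> w \<tau>) \<Longrightarrow> \<phi> \<in> fo_sentences \<tau> \<Longrightarrow>
    Q (pair (mso_code enc \<psi>) (fo_code \<phi>)) \<longleftrightarrow> (\<exists>D0 Ds. structural padded \<Sigma> w \<tau> D0 Ds \<and>
       mso_models (odd_tensor D0 Ds) \<psi> \<and> fo_models (derived_struct \<tau> D0 Ds) \<phi>)" by blast
  from Q(1) obtain r where r: "\<And>x. rec_eval r [x] (if Q x then 1 else 0)"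
    unfolding comp_pred_def comp_fn_def rec_fn_def by (metis length_Cons list.size(3) nth_Cons_0 One_nat_def)
  show ?thesis
    unfolding decidable_def
  proof (intro exI ballI, clarify)
    fix \<psi> \<phi> assume "\<psi> \<in> mso_sentences (layer_tuples padded \<Sigma> w \<tau>)" "\<phi> \<in> fo_sentences \<tau>"
    from r[of "pair (mso_code enc \<psi>) (fo_code \<phi>)", unfolded Q(2)[OF this]]
    show "rec_eval r [pair (mso_code enc \<psi>) (fo_code \<phi>)]
      (if \<exists>D0 Ds. structural padded \<Sigma> w \<tau> D0 Ds \<and>
        mso_models (odd_tensor D0 Ds) \<psi> \<and> fo_models (derived_struct \<tau> D0 Ds) \<phi> then 1 else 0)" .
  qed
qed

end
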